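(* Let $n\geq 2$. Then: (1) The set $\boldsymbol{\mu}_n(\mathcal{A}^{\mathrm{mp}})$ is a union of open faces of the polytope $P_n$. (2) Let $H$ be a nonempty face subgraph of $G_{n-1}$ and $F_H$ the corresponding face of $P_n$. Then $\mathrm{Int}(F_H)\subseteq\boldsymbol{\mu}_n(\mathcal{A}^{\mathrm{mp}})$ if and only if $H$ is driftless. (3) The closure of $\boldsymbol{\mu}_n(\mathcal{A}^{\mathrm{mp}})$ is $P_n$.
   Context: Notation: $I=[0,1]$, $\mu_{\mathrm{Leb}}$ Lebesgue measure, $[n]=\{1,\dots,n\}$, permutations $\sigma\in S_n$ are bijections $[n]\to[n]$. For distinct reals $y_1,\dots,y_n$, $\mathrm{Order}(y_1,\dots,y_n)$ is the unique $\sigma\in S_n$ with $y_i<y_j$ iff $\sigma(i)<\sigma(j)$. Define $\rho,\rho':S_{n+1}\to S_n$ by $\rho(\sigma)=\mathrm{Order}(\sigma(1),\dots,\sigma(n))$ and $\rho'(\sigma)=\mathrm{Order}(\sigma(2),\dots,\sigma(n+1))$. Functions: $\mathcal{A}$ is the set of $f:I\to I$ such that Lebesgue-almost every $x$ has infinite orbit $\{x,f(x),f^2(x),\dots\}$; $\mathcal{A}^{\mathrm{mp}}=\{f\in\mathcal{A}:\mu_{\mathrm{Leb}}(f^{-1}(S))=\mu_{\mathrm{Leb}}(S)$ for all measurable $S\}$. $\Delta_n$ is the simplex of probability distributions on $S_n$, and for $f\in\mathcal{A}$, $\boldsymbol{\mu}_n(f)\in\Delta_n$ is $\boldsymbol{\mu}_n(f)(\sigma)=\mu_{\mathrm{Leb}}\{x$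 with infinite orbit $:\mathrm{Order}(x,f(x),\dots,f^{n-1}(x))=\sigma\}$. Digraphs: the permutation digraph $G_k$ ($k\ge1$) has vertex set $S_k$ and edge set $S_{k+1}$, the edge $e$ directed from $\rho(e)$ to $\rho'(e)$. A path of length $\ell$ is $p=(v_0,e_1,v_1,\dots,e_\ell,v_\ell)$ with $e_i$ directed from $v_{i-1}$ to $v_i$; a loop is a finite path with $v_\ell=v_0$ (based at $v_0$). The support of a loop is the subgraph formed by its vertices and edges. A face subgraph of $G_k$ is a subgraph in which every edge lies on a loop contained in the subgraph (equivalently each connected component is strongly connected). Poset of a path: for a path $p$ of length $\ell$ in $G_k$, put $m=\ell+k$ and $Q_p=\{x_1,\dots,x_m\}$ with $\leq$ the reflexive-transitive closure of the relations: $x_{a+c}\le x_{a+d}$ whenever $0\le a\le\ell$, $c,d\in[k]$, $v_a(c)\le v_a(d)$; and $x_{a-1+c}\le x_{a-1+d}$ whenever $1\le a\le\ell$, $c,d\in[k+1]$, $e_a(c)\le e_a(d)$ (this is a partial order). Drift: for a loop $\gamma$ of length $\ell\ge1$ in $G_k$ write $y_i=x_{\ell+i}$ in $Q_\gamma$; for $i,j\in[k]$, $\mathrm{Drift}_\gamma(i,j)=+$ if $x_i\le y_j$, $=-$ if $x_i\ge y_j$, and $=0$ otherwise; $\mathrm{Drift}_\gamma(i)=\mathrm{Drift}_\gamma(i,i)$. A strongly connected subgraph $H\subseteq G_k$ drifts if there exist a vertex $v$ of $H$, $j\in[k]$ and $\epsilon\in\{+,-\}$ such that every loop $\gamma$ in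 $H$ based at $v$ has $\mathrm{Drift}_\gamma(j)=\epsilon$; otherwise it is driftless. A face subgraph drifts if some connected component drifts; otherwise it is driftless. Polytope: $P_n=\{\mu\in\Delta_n:\sum_{\sigma:\rho(\sigma)=\tau}\mu(\sigma)=\sum_{\sigma:\rho'(\sigma)=\tau}\mu(\sigma)\ \forall\tau\in S_{n-1}\}$, i.e. the normalized flows on $G_{n-1}$ (whose edge set is $S_n$). For a face subgraph $H$ of $G_{n-1}$, $F_H=\{\mu\in P_n:\mu(\sigma)=0$ for all edges $\sigma\notin H\}$; $H\mapsto F_H$ is a bijection between face subgraphs and faces of $P_n$. The open face $\mathrm{Int}(F_H)=\{\mu\in P_n:\mu(\sigma)>0\iff\sigma$ is an edge of $H\}$ is the relative interior of $F_H$; the open faces of $P_n$ are the sets $\mathrm{Int}(F_H)$. *)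

theory Defs
  imports
    "HOL-Analysis.Analysis"
    "HOL-Combinatorics.Permutations"
    "Graph_Theory.Digraph_Component"
    "Graph_Theory.Arc_Walk"
begin

section \<open>Permutations and order patterns\<close>

text \<open>
  Permutations of \<open>{1..n}\<close> are total functions fixing every point outside \<open>{1..n}\<close>, so that
  equality of permutations is equality of functions.
\<close>

definition perms :: "nat \<Rightarrow> (nat \<Rightarrow> nat) set" where
  "perms n = {\<sigma>. \<sigma> permutes {1..n}}"

text \<open>Meaningful only if \<open>y\<close> is injective on \<open>{1..n}\<close>.\<close>

definition Order :: "nat \<Rightarrow> (nat \<Rightarrow> 'a::linorder) \<Rightarrow> nat \<Rightarrow> nat" where
  "Order n y = (THE \<sigma>. \<sigma> \<in> perms n \<and> (\<forall>i\<in>{1..n}. \<forall>j\<in>{1..n}. y i < y j \<longleftrightarrow> \<sigma> i < \<sigma> j))"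

text \<open>For \<open>\<sigma> \<in> perms (n + 1)\<close>, the results lie in \<open>perms n\<close>.\<close>

definition \<rho> :: "nat \<Rightarrow> (nat \<Rightarrow> nat) \<Rightarrow> nat \<Rightarrow> nat" where
  "\<rho> n \<sigma> = Order n \<sigma>"

definition \<rho>' :: "nat \<Rightarrow> (nat \<Rightarrow> nat) \<Rightarrow> nat \<Rightarrow> nat" where
  "\<rho>' n \<sigma> = Order n (\<lambda>i. \<sigma> (i + 1))"

lemma Order_unique:
  assumes "\<sigma> \<in> perms n" "\<tau> \<in> perms n"
    and eq: "\<And>i j. i \<in> {1..n} \<Longrightarrow> j \<in> {1..n} \<Longrightarrow> \<sigma> i < \<sigma> j \<longleftrightarrow> \<tau> i < \<tau> j"
  shows "\<sigma> = \<tau>"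
proof
  have rank: "\<pi> i = card {j \<in> {1..n}. \<pi> j \<le> \<pi> i}" if "\<pi> \<in> perms n" "i \<in> {1..n}" for \<pi> i
  proof -
    have p: "\<pi> permutes {1..n}" using that by (simp add: perms_def)
    have "\<pi> ` {j \<in> {1..n}. \<pi> j \<le> \<pi> i} = {1..\<pi> i}"
    proof
      show "\<pi> ` {j \<in> {1..n}. \<pi> j \<le> \<pi> i} \<subseteq> {1..\<pi> i}"
        using permutes_in_image[OF p] by fastforce
      show "{1..\<pi> i} \<subseteq> \<pi> ` {j \<in> {1..n}. \<pi> j \<le> \<pi> i}"
      proof
        fix a assume a: "a \<in> {1..\<pi> i}"
        have "\<pi> i \<in> {1..n}" using permutes_in_image[OF p] that(2) by blast
        then have "a \<in> \<pi> ` {1..n}" using a permutes_image[OF p] by auto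
        then show "a \<in> \<pi> ` {j \<in> {1..n}. \<pi> j \<le> \<pi> i}" using a by auto
      qed
    qed
    moreover have "inj_on \<pi> {j \<in> {1..n}. \<pi> j \<le> \<pi> i}"
      using permutes_inj[OF p] by (rule inj_on_subset) simp
    ultimately show ?thesis by (auto dest: card_image)
  qed
  fix i
  show "\<sigma> i = \<tau> i"
  proof (cases "i \<in> {1..n}")
    case True
    have "{j \<in> {1..n}. \<sigma> j \<le> \<sigma> i} = {j \<in> {1..n}. \<tau> j \<le> \<tau> i}"
      using eq[OF True] by (auto simp: not_less[symmetric])
    then show ?thesis using rank[OF assms(1) True] rank[OF assms(2) True] by simp
  next
    case False
    then show ?thesis using assms(1,2) by (simp add: perms_def permutes_def)
  qed
qed

lemma Order:
  assumes "inj_on y {1..n}"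
  shows "Order n y \<in> perms n"
    and "\<And>i j. i \<in> {1..n} \<Longrightarrow> j \<in> {1..n} \<Longrightarrow> y i < y j \<longleftrightarrow> Order n y i < Order n y j"
proof -
  define r where "r i = (if i \<in> {1..n} then card {j \<in> {1..n}. y j \<le> y i} else i)" for i
  have less: "r i < r j" if "i \<in> {1..n}" "j \<in> {1..n}" "y i < y j" for i j
  proof -
    have "{k \<in> {1..n}. y k \<le> y i} \<subset> {k \<in> {1..n}. y k \<le> y j}"
    proof
      show "{k \<in> {1..n}. y k \<le> y i} \<subseteq> {k \<in> {1..n}. y k \<le> y j}" using that by auto
      have "j \<in> {k \<in> {1..n}. y k \<le> y j}" "j \<notin> {k \<in> {1..n}. y k \<le> y i}" using that by auto
      then show "{k \<in> {1..n}. y k \<le> y i} \<noteq> {k \<in> {1..n}. y k \<le> y j}" by blast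
    qed
    then show ?thesis using that by (simp add: r_def psubset_card_mono)
  qed
  have iff: "y i < y j \<longleftrightarrow> r i < r j" if "i \<in> {1..n}" "j \<in> {1..n}" for i j
  proof (cases "y i" "y j" rule: linorder_cases)
    case equal
    then have "i = j" using assms that by (auto dest: inj_onD)
    then show ?thesis by simp
  qed (use less[OF that] less[OF that(2,1)] in auto)
  have "inj_on r {1..n}"
  proof (rule inj_onI)
    fix i j assume ij: "i \<in> {1..n}" "j \<in> {1..n}" "r i = r j"
    then have "y i = y j" using iff[OF ij(1,2)] iff[OF ij(2,1)] by auto
    then show "i = j" using assms ij by (auto dest: inj_onD)
  qed
  moreover have "r ` {1..n} \<subseteq> {1..n}"
  proof
    fix a assume "a \<in> r ` {1..n}"
    then obtain i where i: "i \<in> {1..n}" "a = card {j \<in> {1..n}. y j \<le> y i}" by (auto simp: r_def)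
    have "card {j \<in> {1..n}. y j \<le> y i} \<le> card {1..n}" by (rule card_mono) auto
    moreover have "i \<in> {j \<in> {1..n}. y j \<le> y i}" using i by simp
    then have "card {j \<in> {1..n}. y j \<le> y i} > 0" by (subst card_gt_0_iff) auto
    ultimately show "a \<in> {1..n}" using i by simp
  qed
  ultimately have "bij_betw r {1..n} {1..n}"
    by (simp add: bij_betw_def endo_inj_surj)
  then have "r \<in> perms n" unfolding perms_def
    by (auto intro!: bij_imp_permutes simp: r_def)
  with iff have "\<exists>!\<sigma>. \<sigma> \<in> perms n \<and> (\<forall>i\<in>{1..n}. \<forall>j\<in>{1..n}. y i < y j \<longleftrightarrow> \<sigma> i < \<sigma> j)"
  proof (intro ex1I[of _ r])
    fix \<sigma> assume "\<sigma> \<in> perms n \<and> (\<forall>i\<in>{1..n}. \<forall>j\<in>{1..n}. y i < y j \<longleftrightarrow> \<sigma> i < \<sigma> j)"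
    with iff \<open>r \<in> perms n\<close> show "\<sigma> = r" by (intro Order_unique[of \<sigma> n r]) (simp, simp, metis)
  qed simp
  from theI'[OF this] have "Order n y \<in> perms n \<and>
    (\<forall>i\<in>{1..n}. \<forall>j\<in>{1..n}. y i < y j \<longleftrightarrow> Order n y i < Order n y j)"
    unfolding Order_def .
  then show "Order n y \<in> perms n"
    and "\<And>i j. i \<in> {1..n} \<Longrightarrow> j \<in> {1..n} \<Longrightarrow> y i < y j \<longleftrightarrow> Order n y i < Order n y j"
    by simp_all
qed


section \<open>Interval maps and their pattern distributions\<close>

abbreviation unit_leb :: "real measure" where
  "unit_leb \<equiv> lebesgue_on {0..1}"

definition infinite_orbit :: "(real \<Rightarrow> real) \<Rightarrow> real \<Rightarrow> bool" where
  "infinite_orbit f x \<longleftrightarrow> infinite (range (\<lambda>k. (f ^^ k) x))"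

text \<open>
  Maps of the unit interval are total functions on the reals mapping \<open>{0..1}\<close> to itself;
  their values elsewhere play no role.
\<close>

definition maps_A :: "(real \<Rightarrow> real) set" where
  "maps_A = {f \<in> {0..1} \<rightarrow> {0..1}. AE x in unit_leb. infinite_orbit f x}"

definition maps_A_mp :: "(real \<Rightarrow> real) set" where
  "maps_A_mp = {f \<in> maps_A. f \<in> measurable unit_leb unit_leb \<and>
     (\<forall>S \<in> sets unit_leb. emeasure unit_leb (f -` S \<inter> {0..1}) = emeasure unit_leb S)}"

definition pattern_dist :: "nat \<Rightarrow> (real \<Rightarrow> real) \<Rightarrow> (nat \<Rightarrow> nat) \<Rightarrow> real" where
  "pattern_dist n f \<sigma> =
     measure unit_leb {x \<in> {0..1}. infinite_orbit f x \<and> Order n (\<lambda>i. (f ^^ (i - 1)) x) = \<sigma>}"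


section \<open>The permutation digraph\<close>

definition perm_digraph :: "nat \<Rightarrow> (nat \<Rightarrow> nat, nat \<Rightarrow> nat) pre_digraph" where
  "perm_digraph k = \<lparr>verts = perms k, arcs = perms (k + 1), tail = \<rho> k, head = \<rho>' k\<rparr>"

lemma wf_perm_digraph: "wf_digraph (perm_digraph k)"
proof
  fix e assume "e \<in> arcs (perm_digraph k)"
  then have "inj e" by (auto simp: perm_digraph_def perms_def dest: permutes_inj)
  then have "inj_on e {1..k}" "inj_on (\<lambda>i. e (i + 1)) {1..k}"
    by (auto intro!: inj_onI dest: injD)
  then show "tail (perm_digraph k) e \<in> verts (perm_digraph k)"
    and "head (perm_digraph k) e \<in> verts (perm_digraph k)"
    using Order(1) by (auto simp: perm_digraph_def \<rho>_def \<rho>'_def)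
qed

text \<open>
  The condition on vertices excludes isolated vertices. Without it, distinct face subgraphs could
  have the same edges and hence correspond to the same face of the polytope of normalized flows.
\<close>

definition face_subgraph :: "nat \<Rightarrow> (nat \<Rightarrow> nat, nat \<Rightarrow> nat) pre_digraph \<Rightarrow> bool" where
  "face_subgraph k H \<longleftrightarrow> subgraph H (perm_digraph k) \<and>
     (\<forall>e \<in> arcs H. \<exists>v p. pre_digraph.awalk H v p v \<and> e \<in> set p) \<and>
     (\<forall>v \<in> verts H. \<exists>e \<in> arcs H. v = tail H e \<or> v = head H e)"

definition connected_components :: "('a, 'b) pre_digraph \<Rightarrow> ('a, 'b) pre_digraph set" where
  "connected_components H = {C. induced_subgraph C H \<and> Digraph_Component.connected C \<and>
     \<not> (\<exists>C'. induced_subgraph C' H \<and> Digraph_Component.connected C' \<and> verts C \<subset> verts C')}"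


section \<open>The poset of a path and drift\<close>

text \<open>
  A path is given by its initial vertex \<open>v\<close> and its list of edges \<open>p\<close>. The pair \<open>(i, j)\<close> stands
  for \<open>x\<^sub>i \<le> x\<^sub>j\<close>. The reflexive pairs of \<open>path_le\<close> outside \<open>{1..length p + k}\<close> are harmless:
  the generating pairs all lie inside, and only indices from that range are ever queried.
\<close>

definition path_gen :: "nat \<Rightarrow> (nat \<Rightarrow> nat) \<Rightarrow> (nat \<Rightarrow> nat) list \<Rightarrow> (nat \<times> nat) set" where
  "path_gen k v p =
     {(a + c, a + d) | a c d. a \<le> length p \<and> c \<in> {1..k} \<and> d \<in> {1..k} \<and>
        (pre_digraph.awalk_verts (perm_digraph k) v p ! a) c
          \<le> (pre_digraph.awalk_verts (perm_digraph k) v p ! a) d} \<union>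
     {(a - 1 + c, a - 1 + d) | a c d. a \<in> {1..length p} \<and> c \<in> {1..k+1} \<and> d \<in> {1..k+1} \<and>
        (p ! (a - 1)) c \<le> (p ! (a - 1)) d}"

definition path_le :: "nat \<Rightarrow> (nat \<Rightarrow> nat) \<Rightarrow> (nat \<Rightarrow> nat) list \<Rightarrow> nat \<Rightarrow> nat \<Rightarrow> bool" where
  "path_le k v p i j \<longleftrightarrow> (i, j) \<in> (path_gen k v p)\<^sup>*"

text \<open>The signs \<open>+\<close>, \<open>-\<close> and the value \<open>0\<close> are encoded as the integers \<open>1\<close>, \<open>-1\<close> and \<open>0\<close>.\<close>

definition Drift2 :: "nat \<Rightarrow> (nat \<Rightarrow> nat) \<Rightarrow> (nat \<Rightarrow> nat) list \<Rightarrow> nat \<Rightarrow> nat \<Rightarrow> int" where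
  "Drift2 k v p i j =
     (if path_le k v p i (length p + j) then 1
      else if path_le k v p (length p + j) i then -1
      else 0)"

definition Drift :: "nat \<Rightarrow> (nat \<Rightarrow> nat) \<Rightarrow> (nat \<Rightarrow> nat) list \<Rightarrow> nat \<Rightarrow> int" where
  "Drift k v p i = Drift2 k v p i i"

text \<open>
  Drift of a loop is only defined for loops of positive length, hence the restriction
  \<open>p \<noteq> []\<close>.
\<close>

definition component_drifts :: "nat \<Rightarrow> (nat \<Rightarrow> nat, nat \<Rightarrow> nat) pre_digraph \<Rightarrow> bool" where
  "component_drifts k C \<longleftrightarrow>
     (\<exists>v \<in> verts C. \<exists>j \<in> {1..k}. \<exists>\<epsilon> \<in> {1, -1}.
        \<forall>p. p \<noteq> [] \<and> pre_digraph.awalk C v p v \<longrightarrow> Drift k v p j = \<epsilon>)"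

definition driftless :: "nat \<Rightarrow> (nat \<Rightarrow> nat, nat \<Rightarrow> nat) pre_digraph \<Rightarrow> bool" where
  "driftless k H \<longleftrightarrow> \<not> (\<exists>C \<in> connected_components H. component_drifts k C)"


section \<open>The polytope of normalized flows\<close>

text \<open>
  Points of the simplex are functions vanishing outside \<open>perms n\<close>. On such functions the product
  topology of the function type is the Euclidean topology of the coordinates in \<open>perms n\<close>.
\<close>

definition prob_simplex :: "nat \<Rightarrow> ((nat \<Rightarrow> nat) \<Rightarrow> real) set" where
  "prob_simplex n = {\<mu>. (\<forall>\<sigma> \<in> perms n. 0 \<le> \<mu> \<sigma>) \<and> (\<forall>\<sigma>. \<sigma> \<notin> perms n \<longrightarrow> \<mu> \<sigma> = 0) \<and>
     (\<Sum>\<sigma>\<in>perms n. \<mu> \<sigma>) = 1}"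

definition polytope_P :: "nat \<Rightarrow> ((nat \<Rightarrow> nat) \<Rightarrow> real) set" where
  "polytope_P n = {\<mu> \<in> prob_simplex n. \<forall>\<tau> \<in> perms (n - 1).
     (\<Sum>\<sigma> \<in> {\<sigma> \<in> perms n. \<rho> (n - 1) \<sigma> = \<tau>}. \<mu> \<sigma>) =
     (\<Sum>\<sigma> \<in> {\<sigma> \<in> perms n. \<rho>' (n - 1) \<sigma> = \<tau>}. \<mu> \<sigma>)}"

text \<open>The relative interior of the face \<open>{\<mu> \<in> polytope_P n. \<forall>\<sigma> \<in> perms n - arcs H. \<mu> \<sigma> = 0}\<close>.\<close>

definition open_face ::
  "nat \<Rightarrow> (nat \<Rightarrow> nat, nat \<Rightarrow> nat) pre_digraph \<Rightarrow> ((nat \<Rightarrow> nat) \<Rightarrow> real) set" where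
  "open_face n H = {\<mu> \<in> polytope_P n. \<forall>\<sigma> \<in> perms n. \<mu> \<sigma> > 0 \<longleftrightarrow> \<sigma> \<in> arcs H}"

definition open_faces :: "nat \<Rightarrow> ((nat \<Rightarrow> nat) \<Rightarrow> real) set set" where
  "open_faces n = {open_face n H | H. face_subgraph (n - 1) H}"

end

theory Submission
  imports Defs "HOL-Number_Theory.Cong"
begin

text \<open>
  For a loop at \<open>v\<close>, the relation \<open>x\<^sub>i \<le> y\<^sub>j\<close> between its first and last block is monotone in the
  ranks \<open>v i\<close> and \<open>v j\<close>, and for concatenated loops these relations compose. Hence if no \<open>j\<close> drifts upwards along all loops, a suitable product of loops has no upward
  relation between its first and last block at all; with the same for downwards, one obtains a loop
  whose end blocks are incomparable. Such a loop, also when preceded by any other loop at \<open>v\<close>, can be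
  closed up to a cyclic order pattern. Repeating an arbitrary loop many times before one free loop
  shows that a strictly positive flow on a driftless graph is a nonnegative combination of cyclic
  patterns. Such a combination is realized by finitely many intervals that are permuted
  cyclically, each step being combined with an irrational rotation inside the interval to make all
  orbits infinite.

  Conversely, almost every orbit of a measure-preserving map follows edges of positive measure, and
  by Poincare recurrence it runs through loops of the support graph. If that graph drifted, some
  coordinate would strictly increase (or decrease) at each return to a set of positive measure,
  which recurrence forbids.
\<close>

section \<open>Order posets of paths\<close>

text \<open>Flow decomposition alone does not suffice: the support of a single loop in a driftless
  graph may drift, and then its normalized edge count is not attained. Positivity of the flow on
  every edge leaves room to subtract small multiples of free loops and to spend them on the
  remaining loops; this is why open faces, rather than closed ones, appear. Absence of drift offers
  a different loop for each index and sign and speaks only of the pairs (i, i), whereas closing up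
  needs all pairs (i, j); the total order inside a block bridges the two. Rigidly permuted intervals
  would have finite orbits only, hence the rotations, which leave the patterns alone since the first
  n points of an orbit lie in distinct intervals. The support graph of a distribution is the only
  face subgraph whose open face contains it, so the two directions combine to an equivalence.
  Density comes from the full permutation digraph, which is driftless because any vertex pattern can
  be followed by a copy of itself wholly above or wholly below.\<close>

interpretation perm_digraph: wf_digraph "perm_digraph k" for k
  by (rule wf_perm_digraph)

lemma perm_digraph_simps [simp]:
  "verts (perm_digraph k) = perms k" "arcs (perm_digraph k) = perms (Suc k)"
  "tail (perm_digraph k) = \<rho> k" "head (perm_digraph k) = \<rho>' k"
  by (simp_all add: perm_digraph_def)

lemma finite_perms [simp]: "finite (perms n)"
  by (simp add: perms_def finite_permutations)

lemma perms_inj: "\<sigma> \<in> perms n \<Longrightarrow> inj \<sigma>"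
  by (auto simp: perms_def dest: permutes_inj)

lemma perms_eq_iff: "\<sigma> \<in> perms n \<Longrightarrow> \<sigma> i = \<sigma> j \<longleftrightarrow> i = j"
  using perms_inj[of \<sigma> n] by (auto dest: injD)

lemma perms_in_iff: "\<sigma> \<in> perms n \<Longrightarrow> \<sigma> i \<in> {1..n} \<longleftrightarrow> i \<in> {1..n}"
  by (simp only: perms_def mem_Collect_eq permutes_in_image)

lemma perms_surj:
  assumes "\<sigma> \<in> perms n" "t \<in> {1..n}" obtains i where "i \<in> {1..n}" "\<sigma> i = t"
proof -
  have "\<sigma> ` {1..n} = {1..n}" using assms(1) unfolding perms_def by (auto dest: permutes_image)
  with assms(2) have "t \<in> \<sigma> ` {1..n}" by simp
  with that show ?thesis by blast
qed

lemma Order_eqI: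
  assumes "\<sigma> \<in> perms n"
    and "\<And>i j. i \<in> {1..n} \<Longrightarrow> j \<in> {1..n} \<Longrightarrow> y i < y j \<longleftrightarrow> \<sigma> i < \<sigma> j"
  shows "Order n y = \<sigma>"
  unfolding Order_def
proof (rule the_equality)
  fix \<tau> assume "\<tau> \<in> perms n \<and> (\<forall>i\<in>{1..n}. \<forall>j\<in>{1..n}. y i < y j \<longleftrightarrow> \<tau> i < \<tau> j)"
  then show "\<tau> = \<sigma>" using assms by (intro Order_unique[of \<tau> n \<sigma>]) auto
qed (use assms in auto)

lemma Order_cong:
  assumes "\<And>i j. i \<in> {1..n} \<Longrightarrow> j \<in> {1..n} \<Longrightarrow> y i < y j \<longleftrightarrow> y' i < y' j"
  shows "Order n y = Order n y'"
  unfolding Order_def using assms by (intro arg_cong[where f = The] ext) auto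

lemma rho_in [simp]: "e \<in> perms (Suc k) \<Longrightarrow> \<rho> k e \<in> perms k" "e \<in> perms (Suc k) \<Longrightarrow> \<rho>' k e \<in> perms k"
  using perm_digraph.tail_in_verts[of e k] perm_digraph.head_in_verts[of e k] by auto

lemma rho_less:
  assumes "e \<in> perms (Suc k)" "c \<in> {1..k}" "d \<in> {1..k}"
  shows "\<rho> k e c < \<rho> k e d \<longleftrightarrow> e c < e d"
  using Order(2)[of e k c d] assms perms_inj[OF assms(1)] inj_on_subset unfolding \<rho>_def by blast

lemma rho'_less:
  assumes "e \<in> perms (Suc k)" "c \<in> {1..k}" "d \<in> {1..k}"
  shows "\<rho>' k e c < \<rho>' k e d \<longleftrightarrow> e (Suc c) < e (Suc d)"
proof -
  have "inj_on (\<lambda>i. e (i + 1)) {1..k}"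
    using perms_inj[OF assms(1)] by (auto intro!: inj_onI dest: injD)
  from Order(2)[OF this assms(2,3)] show ?thesis unfolding \<rho>'_def by simp
qed

lemma rho_Order:
  assumes "inj_on y {1..Suc k}"
  shows "\<rho> k (Order (Suc k) y) = Order k y" "\<rho>' k (Order (Suc k) y) = Order k (\<lambda>i. y (Suc i))"
proof -
  show "\<rho> k (Order (Suc k) y) = Order k y"
    unfolding \<rho>_def by (rule Order_cong) (use Order(2)[OF assms] in auto)
  show "\<rho>' k (Order (Suc k) y) = Order k (\<lambda>i. y (Suc i))"
    unfolding \<rho>'_def by (rule Order_cong) (use Order(2)[OF assms] in auto)
qed

text \<open>A realization of a path by values in a linear order: \<open>z\<close> restricted to each
  window of \<open>Suc k\<close> positions has the pattern of the corresponding edge. Inner vertices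
  are determined by the edges, so a vertex pattern is compared only at the end of the list.\<close>

primrec fits :: "nat \<Rightarrow> (nat \<Rightarrow> 'a::linorder) \<Rightarrow> (nat \<Rightarrow> nat) \<Rightarrow> (nat \<Rightarrow> nat) list \<Rightarrow> bool" where
  "fits k z v [] \<longleftrightarrow> (\<forall>c\<in>{1..k}. \<forall>d\<in>{1..k}. z c < z d \<longleftrightarrow> v c < v d)"
| "fits k z v (e # p) \<longleftrightarrow> (\<forall>c\<in>{1..Suc k}. \<forall>d\<in>{1..Suc k}. z c < z d \<longleftrightarrow> e c < e d) \<and>
     fits k (\<lambda>i. z (Suc i)) (\<rho>' k e) p"

abbreviation shift :: "nat \<Rightarrow> (nat \<times> nat) set \<Rightarrow> (nat \<times> nat) set" where
  "shift m R \<equiv> (\<lambda>(i, j). (m + i, m + j)) ` R"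

section \<open>Recursive form of the generators of the path poset\<close>

lemma path_gen_Nil: "path_gen k v [] = {(c, d). c \<in> {1..k} \<and> d \<in> {1..k} \<and> v c \<le> v d}"
  by (auto simp: path_gen_def)

lemma path_gen_range:
  assumes "(i, j) \<in> path_gen k v p"
  shows "i \<in> {1..length p + k}" "j \<in> {1..length p + k}"
  using assms unfolding path_gen_def by auto

text \<open>The relations of the initial vertex are among those of \<open>e\<close>, since
  \<open>\<rho>\<close> keeps the order of the first \<open>k\<close> places. This turns the indexed
  definition into a recursion on which the inductions along paths rest.\<close>

lemma path_gen_Cons:
  assumes e: "e \<in> perms (Suc k)"
  shows "path_gen k (\<rho> k e) (e # p) =
    {(c, d). c \<in> {1..Suc k} \<and> d \<in> {1..Suc k} \<and> e c \<le> e d} \<union> shift 1 (path_gen k (\<rho>' k e) p)"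
    (is "?L = ?E \<union> ?S")
proof
  let ?V = "pre_digraph.awalk_verts (perm_digraph k) (\<rho> k e) (e # p)"
  let ?W = "pre_digraph.awalk_verts (perm_digraph k) (\<rho>' k e) p"
  have V: "?V = \<rho> k e # ?W" by (simp add: pre_digraph.awalk_verts.simps)
  show "?L \<subseteq> ?E \<union> ?S"
  proof
    fix x assume "x \<in> ?L"
    then consider a c d where "x = (a + c, a + d)" "a \<le> Suc (length p)" "c \<in> {1..k}" "d \<in> {1..k}"
        "(?V ! a) c \<le> (?V ! a) d"
      | a c d where "x = (a - 1 + c, a - 1 + d)" "a \<in> {1..Suc (length p)}" "c \<in> {1..k+1}" "d \<in> {1..k+1}"
        "((e # p) ! (a - 1)) c \<le> ((e # p) ! (a - 1)) d"
      unfolding path_gen_def by auto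
    then show "x \<in> ?E \<union> ?S"
    proof cases
      case 1
      show ?thesis
      proof (cases a)
        case 0
        have "e c \<le> e d" using rho_less[OF e 1(4,3)] 1(5) 0 V by (simp add: not_less[symmetric])
        then show ?thesis using 1 0 by auto
      next
        case (Suc b)
        have "(b + c, b + d) \<in> path_gen k (\<rho>' k e) p"
          unfolding path_gen_def using 1 Suc V by auto
        then show ?thesis using 1(1) Suc by (auto intro!: image_eqI[where x = "(b + c, b + d)"])
      qed
    next
      case 2
      show ?thesis
      proof (cases "a = 1")
        case True then show ?thesis using 2 by auto
      next
        case False
        then obtain b where b: "a = Suc b" "b \<ge> 1" using 2(2) by (cases a) auto
        have "(b - 1 + c, b - 1 + d) \<in> path_gen k (\<rho>' k e) p"
          unfolding path_gen_def using 2 b by (auto simp: nth_Cons')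
        then show ?thesis using 2(1) b
          by (auto intro!: image_eqI[where x = "(b - 1 + c, b - 1 + d)"])
      qed
    qed
  qed
  show "?E \<union> ?S \<subseteq> ?L"
  proof
    fix x assume "x \<in> ?E \<union> ?S"
    then consider c d where "x = (c, d)" "c \<in> {1..Suc k}" "d \<in> {1..Suc k}" "e c \<le> e d"
      | i j where "x = (Suc i, Suc j)" "(i, j) \<in> path_gen k (\<rho>' k e) p" by auto
    then show "x \<in> ?L"
    proof cases
      case 1
      then have "\<exists>a c' d'. x = (a - 1 + c', a - 1 + d') \<and> a \<in> {1..Suc (length p)} \<and> c' \<in> {1..k+1} \<and> d' \<in> {1..k+1} \<and>
        ((e # p) ! (a - 1)) c' \<le> ((e # p) ! (a - 1)) d'"
        by (intro exI[of _ 1] exI[of _ c] exI[of _ d]) auto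
      then show ?thesis unfolding path_gen_def by auto
    next
      case 2
      from 2(2) consider a c d where "i = a + c" "j = a + d" "a \<le> length p" "c \<in> {1..k}" "d \<in> {1..k}"
          "(?W ! a) c \<le> (?W ! a) d"
        | a c d where "i = a - 1 + c" "j = a - 1 + d" "a \<in> {1..length p}" "c \<in> {1..k+1}" "d \<in> {1..k+1}"
          "(p ! (a - 1)) c \<le> (p ! (a - 1)) d"
        unfolding path_gen_def by auto
      then show ?thesis
      proof cases
        case 11: 1
        have "\<exists>a c d. x = (a + c, a + d) \<and> a \<le> length (e # p) \<and> c \<in> {1..k} \<and> d \<in> {1..k} \<and>
            (?V ! a) c \<le> (?V ! a) d"
          using 11 2 V by (intro exI[of _ "Suc a"] exI[of _ c] exI[of _ d]) auto
        then show ?thesis unfolding path_gen_def by auto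
      next
        case 22: 2
        have "\<exists>a c' d'. x = (a - 1 + c', a - 1 + d') \<and> a \<in> {1..length (e # p)} \<and> c' \<in> {1..k+1} \<and> d' \<in> {1..k+1} \<and>
          ((e # p) ! (a - 1)) c' \<le> ((e # p) ! (a - 1)) d'"
          using 22 2 by (intro exI[of _ "Suc a"] exI[of _ c] exI[of _ d]) (auto simp: nth_Cons')
        then show ?thesis unfolding path_gen_def by blast
      qed
    qed
  qed
qed

lemma awalk_perm_Cons:
  "perm_digraph.awalk k v (e # p) w \<longleftrightarrow> e \<in> perms (Suc k) \<and> v = \<rho> k e \<and> perm_digraph.awalk k (\<rho>' k e) p w"
  by (auto simp: perm_digraph.awalk_simps)

lemma path_gen_start:
  assumes "perm_digraph.awalk k v p w"
  shows "path_gen k v [] \<subseteq> path_gen k v p"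
proof (cases p)
  case (Cons e q)
  with assms have e: "e \<in> perms (Suc k)" "v = \<rho> k e" by (auto simp: awalk_perm_Cons)
  show ?thesis unfolding Cons e(2) path_gen_Cons[OF e(1)] path_gen_Nil
    using rho_less[OF e(1)] by (fastforce simp: not_less[symmetric])
qed auto

lemma path_gen_append:
  assumes "perm_digraph.awalk k v p w" "perm_digraph.awalk k w q u"
  shows "path_gen k v (p @ q) = path_gen k v p \<union> shift (length p) (path_gen k w q)"
  using assms
proof (induction p arbitrary: v)
  case Nil
  then have "v = w" by (simp add: perm_digraph.awalk_simps)
  with path_gen_start[OF Nil(2)] show ?case by (auto simp: image_iff)
next
  case (Cons e p)
  then have e: "e \<in> perms (Suc k)" "v = \<rho> k e" "perm_digraph.awalk k (\<rho>' k e) p w"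
    by (auto simp: awalk_perm_Cons)
  show ?case unfolding e(2) append_Cons path_gen_Cons[OF e(1)] Cons.IH[OF e(3) Cons.prems(2)]
    by (auto simp: image_Un image_image case_prod_beta)
qed

lemma path_gen_end:
  assumes "perm_digraph.awalk k v p w"
  shows "shift (length p) (path_gen k w []) \<subseteq> path_gen k v p"
proof -
  have "perm_digraph.awalk k w [] w" using perm_digraph.awalk_last_in_verts[OF assms]
    by (simp add: perm_digraph.awalk_simps)
  from path_gen_append[OF assms this] show ?thesis by auto
qed

lemma fits_gen:
  assumes "perm_digraph.awalk k v p w" "fits k z v p" "(i, j) \<in> path_gen k v p"
  shows "z i \<le> z j"
  using assms
proof (induction p arbitrary: v z i j)
  case Nil
  then show ?case by (auto simp: path_gen_Nil not_less[symmetric])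
next
  case (Cons e p)
  then have e: "e \<in> perms (Suc k)" "v = \<rho> k e" "perm_digraph.awalk k (\<rho>' k e) p w"
    by (auto simp: awalk_perm_Cons)
  from Cons.prems(3) consider "i \<in> {1..Suc k}" "j \<in> {1..Suc k}" "e i \<le> e j"
    | i' j' where "i = Suc i'" "j = Suc j'" "(i', j') \<in> path_gen k (\<rho>' k e) p"
    unfolding e(2) path_gen_Cons[OF e(1)] by auto
  then show ?case
  proof cases
    case 1 then show ?thesis using Cons.prems(2) by (force simp: not_less[symmetric])
  next
    case 2 then show ?thesis using Cons.IH[OF e(3) _ 2(3), of "\<lambda>i. z (Suc i)"] Cons.prems(2) by simp
  qed
qed

text \<open>Realizations are monotone on the path poset, so actual numbers can refute a relation,
  and relations forced by a path constrain orbits.\<close>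

lemma fits_path_le:
  assumes "perm_digraph.awalk k v p w" "fits k z v p" "path_le k v p i j"
  shows "z i \<le> z j"
  using assms(3) unfolding path_le_def
  by (induction rule: rtrancl_induct) (auto intro: order_trans fits_gen[OF assms(1,2)])

text \<open>Provides the gap into which a new first value is inserted; one side is empty when that
  value is extreme among those it is compared with.\<close>

lemma finite_sets_separate:
  fixes A B :: "real set"
  assumes "finite A" "finite B" "\<And>x y. x \<in> A \<Longrightarrow> y \<in> B \<Longrightarrow> x < y"
  shows "\<exists>l h. l < h \<and> (\<forall>x\<in>A. x \<le> l) \<and> (\<forall>y\<in>B. h \<le> y)"
proof (cases "A = {}")
  case True
  show ?thesis
  proof (cases "B = {}")
    case True then show ?thesis using \<open>A = {}\<close> by (intro exI[of _ 0] exI[of _ 1]) auto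
  next
    case False then show ?thesis using \<open>A = {}\<close> Min_le[OF assms(2)]
      by (intro exI[of _ "Min B - 1"] exI[of _ "Min B"]) simp
  qed
next
  case False
  show ?thesis
  proof (cases "B = {}")
    case True then show ?thesis using Max_ge[OF assms(1)]
      by (intro exI[of _ "Max A"] exI[of _ "Max A + 1"]) simp
  next
    case False then show ?thesis
      using \<open>A \<noteq> {}\<close> assms Max_in[of A] Min_in[of B] Max_ge[OF assms(1)] Min_le[OF assms(2)]
      by (intro exI[of _ "Max A"] exI[of _ "Min B"]) simp
  qed
qed

text \<open>A realization of the remaining path is extended by one value at the front. The first
  edge compares this value only with the next \<open>k\<close> ones, which the realization already
  orders correctly, so it fits into a gap; density of the reals lets it avoid all later
  values.\<close>

lemma fits_exists:
  assumes "perm_digraph.awalk k v p w"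
  shows "\<exists>z :: nat \<Rightarrow> real. inj_on z {1..length p + k} \<and> fits k z v p"
  using assms
proof (induction p arbitrary: v)
  case Nil
  then have v: "v \<in> perms k" by (auto simp: perm_digraph.awalk_simps)
  have "inj_on (\<lambda>i. real (v i)) {1..k}" by (rule inj_onI) (simp add: perms_eq_iff[OF v])
  then show ?case by (intro exI[of _ "\<lambda>i. real (v i)"]) auto
next
  case (Cons e p)
  then have e: "e \<in> perms (Suc k)" "v = \<rho> k e" "perm_digraph.awalk k (\<rho>' k e) p w"
    by (auto simp: awalk_perm_Cons)
  obtain z :: "nat \<Rightarrow> real" where z: "inj_on z {1..length p + k}" "fits k z (\<rho>' k e) p"
    using Cons.IH[OF e(3)] by blast
  have ez: "z c < z d \<longleftrightarrow> e (Suc c) < e (Suc d)" if "c \<in> {1..k}" "d \<in> {1..k}" for c d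
  proof -
    have "z c < z d" if "c \<in> {1..k}" "d \<in> {1..k}" "\<rho>' k e c < \<rho>' k e d" for c d
    proof -
      have "(c, d) \<in> path_gen k (\<rho>' k e) p"
        using path_gen_start[OF e(3)] that by (auto simp: path_gen_Nil)
      then have "z c \<le> z d" using fits_gen[OF e(3) z(2)] by blast
      moreover have "z c \<noteq> z d" using z(1) that by (auto dest!: inj_onD)
      ultimately show ?thesis by simp
    qed
    from this[OF that] this[OF that(2,1)] show ?thesis
      using rho'_less[OF e(1) that] perms_eq_iff[OF rho_in(2)[OF e(1)], of c d]
      by (metis less_asym linorder_neqE_nat less_irrefl)
  qed
  let ?Lo = "z ` {c \<in> {1..k}. e (Suc c) < e 1}" and ?Hi = "z ` {c \<in> {1..k}. e (Suc c) > e 1}"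
  obtain l h where lh: "l < h" "\<forall>x\<in>?Lo. x \<le> l" "\<forall>x\<in>?Hi. h \<le> x"
  proof -
    have LH: "x < y" if "x \<in> ?Lo" "y \<in> ?Hi" for x y using that ez by force
    show thesis using finite_sets_separate[of ?Lo ?Hi] LH that by auto
  qed
  have "infinite ({l<..<h} - z ` {1..length p + k})"
    using infinite_Ioo[OF lh(1)] by (intro Diff_infinite_finite) auto
  then obtain t where "t \<in> {l<..<h} - z ` {1..length p + k}"
    using infinite_imp_nonempty by blast
  then have t: "l < t" "t < h" "t \<notin> z ` {1..length p + k}" by simp_all
  define y where "y i = (if i = 1 then t else z (i - 1))" for i
  have yS: "y (Suc i) = z i" if "i \<noteq> 0" for i using that by (simp add: y_def)
  have "inj_on y {1..length (e # p) + k}"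
  proof (rule inj_onI)
    fix i j assume ij: "i \<in> {1..length (e # p) + k}" "j \<in> {1..length (e # p) + k}" "y i = y j"
    have in': "i - 1 \<in> {1..length p + k}" if "i \<in> {1..length (e # p) + k}" "i \<noteq> 1" for i using that by auto
    have t': "t \<noteq> z (i - 1)" if "i \<in> {1..length (e # p) + k}" "i \<noteq> 1" for i
      using in'[OF that] t(3) by blast
    show "i = j"
    proof (cases "i = 1 \<or> j = 1")
      case True then show ?thesis using ij t'[of i] t'[of j] by (auto simp: y_def split: if_splits)
    next
      case False
      then have "z (i - 1) = z (j - 1)" using ij(3) by (simp add: y_def)
      then have "i - 1 = j - 1" using inj_onD[OF z(1)] in' ij False by blast
      then show ?thesis using ij by auto
    qed
  qed
  moreover have "fits k y v (e # p)"
  proof -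
    have "y c < y d \<longleftrightarrow> e c < e d" if cd: "c \<in> {1..Suc k}" "d \<in> {1..Suc k}" for c d
    proof -
      have c1: "y c < y d \<longleftrightarrow> e c < e d" if cd: "c = 1" "d \<in> {1..Suc k}" "d \<noteq> 1" for c d
      proof -
        obtain d' where d': "d = Suc d'" "d' \<in> {1..k}" using cd by (cases d) auto
        have "e 1 \<noteq> e d" using perms_eq_iff[OF e(1)] cd by auto
        moreover have "z d' \<le> l" if "e d < e 1" using lh(2) d' that by auto
        moreover have "h \<le> z d'" if "e 1 < e d" using lh(3) d' that by auto
        ultimately show ?thesis using cd d' t unfolding y_def by (cases "e d < e 1") auto
      qed
      have c2: "y d < y c \<longleftrightarrow> e d < e c" if cd: "c = 1" "d \<in> {1..Suc k}" "d \<noteq> 1" for c d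
      proof -
        obtain d' where d': "d = Suc d'" "d' \<in> {1..k}" using cd by (cases d) auto
        have "e 1 \<noteq> e d" using perms_eq_iff[OF e(1)] cd by auto
        moreover have "z d' \<le> l" if "e d < e 1" using lh(2) d' that by auto
        moreover have "h \<le> z d'" if "e 1 < e d" using lh(3) d' that by auto
        ultimately show ?thesis using cd d' t unfolding y_def by (cases "e d < e 1") auto
      qed
      show ?thesis
      proof (cases "c = 1 \<or> d = 1")
        case True then show ?thesis using c1[of c d] c2[of d c] cd by blast
      next
        case False
        then obtain c' d' where "c = Suc c'" "c' \<in> {1..k}" "d = Suc d'" "d' \<in> {1..k}"
          using cd by (cases c; cases d) auto
        then show ?thesis using ez[of c' d'] by (simp add: y_def)
      qed
    qed
    moreover have "fits k (\<lambda>i. y (Suc i)) (\<rho>' k e) p"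
    proof -
      have "fits k a v q \<longleftrightarrow> fits k b v q" if "\<And>i. i \<ge> 1 \<Longrightarrow> a i = b i" for a b :: "nat \<Rightarrow> real" and v q
        using that
      proof (induction q arbitrary: a b v)
        case (Cons f q)
        show ?case using Cons.IH[of "\<lambda>i. a (Suc i)" "\<lambda>i. b (Suc i)"] Cons.prems by simp
      qed simp
      from this[of "\<lambda>i. y (Suc i)" z] show ?thesis using z(2) yS by simp
    qed
    ultimately show ?thesis by simp
  qed
  ultimately show ?case by blast
qed

text \<open>Reading off the patterns of consecutive windows gives a walk that the sequence realizes.
  Injectivity is asked per window only, because periodic sequences are used as well as
  orbits.\<close>

lemma window_walk:
  fixes z :: "nat \<Rightarrow> 'a::linorder"
  assumes "\<And>a. a \<le> m \<Longrightarrow> inj_on (\<lambda>i. z (a + i)) {1..k}"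
    and "\<And>a. a < m \<Longrightarrow> inj_on (\<lambda>i. z (a + i)) {1..Suc k}"
  shows "perm_digraph.awalk k (Order k z) (map (\<lambda>a. Order (Suc k) (\<lambda>i. z (a + i))) [0..<m])
      (Order k (\<lambda>i. z (m + i)))" (is "?A m z")
    and "fits k z (Order k z) (map (\<lambda>a. Order (Suc k) (\<lambda>i. z (a + i))) [0..<m])" (is "?B m z")
proof -
  have "?A m z \<and> ?B m z" using assms
  proof (induction m arbitrary: z)
    case 0
    then have "inj_on z {1..k}" by simp
    then show ?case using Order[of z k] by (auto simp: perm_digraph.awalk_simps)
  next
    case (Suc m)
    have inj: "inj_on z {1..Suc k}" using Suc.prems(2)[of 0] by simp
    have IH: "?A m (\<lambda>i. z (Suc i)) \<and> ?B m (\<lambda>i. z (Suc i))"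
      by (rule Suc.IH) (use Suc.prems(1)[of "Suc a" for a] Suc.prems(2)[of "Suc a" for a] in auto)
    have "[0..<Suc m] = 0 # map Suc [0..<m]" by (simp add: map_Suc_upt upt_conv_Cons)
    then have eq: "map (\<lambda>a. Order (Suc k) (\<lambda>i. z (a + i))) [0..<Suc m] =
      Order (Suc k) z # map (\<lambda>a. Order (Suc k) (\<lambda>i. z (Suc (a + i)))) [0..<m]"
      by (simp del: upt_Suc)
    show ?case unfolding eq using IH Order[OF inj]
      by (simp add: awalk_perm_Cons rho_Order[OF inj])
  qed
  then show "?A m z" "?B m z" by blast+
qed

section \<open>Free loops\<close>

lemma path_le_antisym:
  assumes "perm_digraph.awalk k v p w" "path_le k v p i j" "path_le k v p j i"
  shows "i = j"
proof (rule ccontr)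
  assume ne: "i \<noteq> j"
  obtain z :: "nat \<Rightarrow> real" where z: "inj_on z {1..length p + k}" "fits k z v p"
    using fits_exists[OF assms(1)] by blast
  have "z i = z j" using fits_path_le[OF assms(1) z(2)] assms(2,3) by (intro antisym) auto
  \<comment> \<open>A nontrivial chain starts and ends with a generator, which puts both indices
    into the range where \<open>z\<close> is injective.\<close>
  moreover have "i \<in> {1..length p + k} \<and> j \<in> {1..length p + k}"
    using assms(2) ne path_gen_range[of _ _ k v p] unfolding path_le_def
    by (metis converse_rtranclE rtranclE)
  ultimately show False using ne z(1) by (auto dest: inj_onD)
qed

text \<open>\<open>v\<close> orders the block totally, so any further relation within it would
  reverse an existing one, against antisymmetry. The rest of the path therefore adds nothing inside
  its first block.\<close>

lemma path_le_start:
  assumes "perm_digraph.awalk k v p w" "c \<in> {1..k}" "d \<in> {1..k}"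
  shows "path_le k v p c d \<longleftrightarrow> v c \<le> v d"
proof -
  have v: "v \<in> perms k" using perm_digraph.awalk_hd_in_verts[OF assms(1)] by simp
  have *: "path_le k v p c d" if "v c \<le> v d" "c \<in> {1..k}" "d \<in> {1..k}" for c d
    using path_gen_start[OF assms(1)] that unfolding path_le_def path_gen_Nil by blast
  show ?thesis
  proof
    assume le: "path_le k v p c d"
    show "v c \<le> v d"
    proof (rule ccontr)
      assume "\<not> v c \<le> v d"
      then have "c = d" using path_le_antisym[OF assms(1) le] *[of d c] assms by auto
      then show False using \<open>\<not> v c \<le> v d\<close> by simp
    qed
  qed (use * assms in auto)
qed

lemma path_le_end:
  assumes "perm_digraph.awalk k v p w" "c \<in> {1..k}" "d \<in> {1..k}"
  shows "path_le k v p (length p + c) (length p + d) \<longleftrightarrow> w c \<le> w d"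
proof -
  have w: "w \<in> perms k" using perm_digraph.awalk_last_in_verts[OF assms(1)] by simp
  have *: "path_le k v p (length p + c) (length p + d)" if "w c \<le> w d" "c \<in> {1..k}" "d \<in> {1..k}" for c d
    using path_gen_end[OF assms(1)] that unfolding path_le_def path_gen_Nil by (auto simp: image_iff subset_iff)
  show ?thesis
  proof
    assume le: "path_le k v p (length p + c) (length p + d)"
    show "w c \<le> w d"
    proof (rule ccontr)
      assume "\<not> w c \<le> w d"
      then have "length p + c = length p + d" using path_le_antisym[OF assms(1) le] *[of d c] assms by auto
      then show False using \<open>\<not> w c \<le> w d\<close> by simp
    qed
  qed (use * assms in auto)
qed

section \<open>Factorization of relations across a concatenation\<close>

lemma rtrancl_shift:
  assumes "(m + i, x) \<in> (shift m R)\<^sup>*"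
  obtains j where "x = m + j" "(i, j) \<in> R\<^sup>*"
proof -
  from assms have "\<exists>j. x = m + j \<and> (i, j) \<in> R\<^sup>*"
    by (induction rule: rtrancl_induct) (auto intro: rtrancl_into_rtrancl)
  with that show ?thesis by blast
qed

text \<open>A chain can change from \<open>A\<close> to \<open>B\<close> or back only inside the
  overlap \<open>P \<inter> Q\<close>. By hypothesis a \<open>B\<close>-detour between two overlap
  points can be replaced by an \<open>A\<close>-chain, so every chain starting in \<open>P\<close>
  normalizes to an \<open>A\<close>-part followed by at most one \<open>B\<close>-part.\<close>

lemma rtrancl_Un_junction:
  assumes "A \<subseteq> P \<times> P" "B \<subseteq> Q \<times> Q"
    and BA: "\<And>a b. a \<in> P \<inter> Q \<Longrightarrow> b \<in> P \<inter> Q \<Longrightarrow> (a, b) \<in> B\<^sup>* \<Longrightarrow> (a, b) \<in> A\<^sup>*"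
    and "(i, b) \<in> (A \<union> B)\<^sup>*" "i \<in> P"
  shows "(b \<in> P \<longrightarrow> (i, b) \<in> A\<^sup>*) \<and> (b \<in> Q \<longrightarrow> (\<exists>m\<in>P \<inter> Q. (i, m) \<in> A\<^sup>* \<and> (m, b) \<in> B\<^sup>*))"
  using assms(4)
proof (induction rule: rtrancl_induct)
  case base
  then show ?case using assms(5) by auto
next
  case (step b c)
  show ?case
  proof (cases "(b, c) \<in> A")
    case True
    then have "b \<in> P" "c \<in> P" using assms(1) by auto
    then have "(i, c) \<in> A\<^sup>*" using step True by (auto intro: rtrancl_into_rtrancl)
    then show ?thesis using \<open>c \<in> P\<close> by auto
  next
    case False
    then have B: "(b, c) \<in> B" "b \<in> Q" "c \<in> Q" using step(2) assms(2) by auto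
    then obtain m where m: "m \<in> P \<inter> Q" "(i, m) \<in> A\<^sup>*" "(m, b) \<in> B\<^sup>*" using step by auto
    then have mc: "(m, c) \<in> B\<^sup>*" using B by (auto intro: rtrancl_into_rtrancl)
    have "(i, c) \<in> A\<^sup>*" if "c \<in> P"
      using BA[OF m(1) _ mc] that B m(2) by auto
    then show ?thesis using m mc by blast
  qed
qed

text \<open>The overlap of the two posets is the middle block, which both order totally according to
  \<open>w\<close>. Hence detours can be exchanged and each relation across the concatenation passes
  through a single middle element; for the reverse direction the factors swap roles.\<close>

lemma path_le_append:
  assumes p: "perm_digraph.awalk k v p w" and q: "perm_digraph.awalk k w q u"
    and ij: "i \<in> {1..length p + k}" "j \<in> {1..length q + k}"
  shows "path_le k v (p @ q) i (length p + j) \<Longrightarrow>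
      \<exists>m\<in>{1..k}. path_le k v p i (length p + m) \<and> path_le k w q m j"
    and "path_le k v (p @ q) (length p + j) i \<Longrightarrow>
      \<exists>m\<in>{1..k}. path_le k v p (length p + m) i \<and> path_le k w q j m"
proof -
  let ?A = "path_gen k v p" and ?B = "shift (length p) (path_gen k w q)"
  let ?P = "{1..length p + k}" and ?Q = "{length p + 1..length p + length q + k}"
  have A: "?A \<subseteq> ?P \<times> ?P" using path_gen_range by fast
  have B: "?B \<subseteq> ?Q \<times> ?Q" using path_gen_range[of _ _ k w q] by fastforce
  have PQ: "\<exists>c\<in>{1..k}. a = length p + c" if "a \<in> ?P \<inter> ?Q" for a
    using that by (intro bexI[of _ "a - length p"]) auto
  have BA: "(a, b) \<in> ?A\<^sup>*" if ab: "a \<in> ?P \<inter> ?Q" "b \<in> ?P \<inter> ?Q" "(a, b) \<in> ?B\<^sup>*" for a b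
  proof -
    obtain c d where cd: "a = length p + c" "b = length p + d" "c \<in> {1..k}" "d \<in> {1..k}"
      using PQ ab by meson
    then have "path_le k w q c d" using ab(3) rtrancl_shift[of "length p" c b "path_gen k w q"]
      by (auto simp: path_le_def)
    then show ?thesis using path_le_start[OF q cd(3,4)] path_le_end[OF p cd(3,4)] cd
      by (simp add: path_le_def)
  qed
  have AB: "(a, b) \<in> ?B\<^sup>*" if ab: "a \<in> ?Q \<inter> ?P" "b \<in> ?Q \<inter> ?P" "(a, b) \<in> ?A\<^sup>*" for a b
  proof -
    obtain c d where cd: "a = length p + c" "b = length p + d" "c \<in> {1..k}" "d \<in> {1..k}"
      using PQ ab by (metis Int_commute)
    then have "w c \<le> w d" using ab(3) path_le_end[OF p cd(3,4)] by (simp add: path_le_def)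
    then have "(c, d) \<in> path_gen k w q"
      using path_gen_start[OF q] cd by (auto simp: path_gen_Nil)
    then show ?thesis using cd by (auto simp: image_iff intro!: r_into_rtrancl)
  qed
  have gen: "path_gen k v (p @ q) = ?A \<union> ?B" by (rule path_gen_append[OF p q])
  have jQ: "length p + j \<in> ?Q" using ij(2) by auto
  {
    assume "path_le k v (p @ q) i (length p + j)"
    then have "(i, length p + j) \<in> (?A \<union> ?B)\<^sup>*" by (simp add: path_le_def gen)
    from rtrancl_Un_junction[OF A B BA this ij(1)] jQ
    obtain m where m: "m \<in> ?P \<inter> ?Q" "(i, m) \<in> ?A\<^sup>*" "(m, length p + j) \<in> ?B\<^sup>*" by blast
    from PQ[OF m(1)] obtain c where c: "c \<in> {1..k}" "m = length p + c" by blast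
    have "(c, j) \<in> (path_gen k w q)\<^sup>*" using m(3) c(2)
      by (auto elim!: rtrancl_shift)
    then show "\<exists>m\<in>{1..k}. path_le k v p i (length p + m) \<and> path_le k w q m j"
      using c m by (auto simp: path_le_def)
  next
    assume "path_le k v (p @ q) (length p + j) i"
    then have "(length p + j, i) \<in> (?B \<union> ?A)\<^sup>*" by (simp add: path_le_def gen Un_commute)
    from rtrancl_Un_junction[OF B A AB this jQ] ij(1)
    obtain m where m: "m \<in> ?P \<inter> ?Q" "(length p + j, m) \<in> ?B\<^sup>*" "(m, i) \<in> ?A\<^sup>*" by blast
    from PQ[OF m(1)] obtain c where c: "c \<in> {1..k}" "m = length p + c" by blast
    have "(j, c) \<in> (path_gen k w q)\<^sup>*" using m(2) c(2)
      by (auto elim!: rtrancl_shift)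
    then show "\<exists>m\<in>{1..k}. path_le k v p (length p + m) i \<and> path_le k w q j m"
      using c m by (auto simp: path_le_def)
  }
qed

text \<open>Incomparability is demanded for all pairs of indices, not only for the diagonal pairs
  that drift concerns: closing up identifies the i-th elements of both blocks for all i at once and
  must not create a cycle between different indices.\<close>

definition free_loop :: "nat \<Rightarrow> (nat \<Rightarrow> nat) \<Rightarrow> (nat \<Rightarrow> nat) list \<Rightarrow> bool" where
  "free_loop k v p \<longleftrightarrow> perm_digraph.awalk k v p v \<and>
     (\<forall>i\<in>{1..k}. \<forall>j\<in>{1..k}. \<not> path_le k v p i (length p + j) \<and> \<not> path_le k v p (length p + j) i)"

lemma free_loopD:
  assumes "free_loop k v p" "i \<in> {1..k}" "j \<in> {1..k}"
  shows "\<not> path_le k v p i (length p + j)" "\<not> path_le k v p (length p + j) i"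
  using assms unfolding free_loop_def by blast+

lemma free_loop_append:
  assumes p: "perm_digraph.awalk k v p v" and q: "free_loop k v q"
  shows "free_loop k v (p @ q)"
proof -
  have q': "perm_digraph.awalk k v q v" using q by (simp add: free_loop_def)
  show ?thesis unfolding free_loop_def
  proof (intro conjI ballI notI)
    fix i j assume ij: "i \<in> {1..k}" "j \<in> {1..k}"
    { assume "path_le k v (p @ q) i (length (p @ q) + j)"
      then show False using path_le_append(1)[OF p q', of i "length q + j"] ij q
        by (auto simp: free_loop_def ac_simps) }
    { assume "path_le k v (p @ q) (length (p @ q) + j) i"
      then show False using path_le_append(2)[OF p q', of i "length q + j"] ij q
        by (auto simp: free_loop_def ac_simps) }
  qed (use p q' perm_digraph.awalk_appendI in blast)
qed

text \<open>If the blocks overlapped or were adjacent, the first edge would already compare the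
  first elements of the two blocks. A length above \<open>k\<close> also keeps the windows of a
  cyclic pattern free of repetitions.\<close>

lemma free_loop_length:
  assumes "free_loop k v p" "k \<ge> 1"
  shows "k < length p"
proof (rule ccontr)
  assume l: "\<not> k < length p"
  show False
  proof (cases p)
    case Nil
    have "path_le k v p 1 (length p + 1)" using Nil by (simp add: path_le_def)
    then show False using free_loopD[OF assms(1), of 1 1] assms(2) by auto
  next
    case (Cons e q)
    with assms have e: "e \<in> perms (Suc k)" "v = \<rho> k e"
      by (auto simp: free_loop_def awalk_perm_Cons)
    have "e 1 \<le> e (length p + 1) \<or> e (length p + 1) \<le> e 1" by linarith
    then have "(1, length p + 1) \<in> path_gen k v p \<or> (length p + 1, 1) \<in> path_gen k v p"
      unfolding Cons e(2) path_gen_Cons[OF e(1)] using l Cons assms(2) by auto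
    then have "path_le k v p 1 (length p + 1) \<or> path_le k v p (length p + 1) 1"
      by (auto simp: path_le_def)
    then show False using free_loopD[OF assms(1), of 1 1] assms(2) by auto
  qed
qed

text \<open>
  The relation between the first and the last block of a concatenation is the composition of the
  relations of the factors. As these are monotone in the rank order of \<open>v\<close>, prefixing loops without
  positive drift at the point of rank \<open>t\<close>, for descending \<open>t\<close>, removes every upward relation.
\<close>

lemma free_loop_exists:
  assumes sub: "subgraph H (perm_digraph k)" and v: "v \<in> verts H"
    and dr: "\<And>j \<epsilon>. j \<in> {1..k} \<Longrightarrow> \<epsilon> \<in> {1, -1} \<Longrightarrow>
      \<exists>p. p \<noteq> [] \<and> pre_digraph.awalk H v p v \<and> Drift k v p j \<noteq> \<epsilon>"
  shows "\<exists>p. pre_digraph.awalk H v p v \<and> free_loop k v p"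
proof -
  interpret H: wf_digraph H using sub by auto
  have aw: "perm_digraph.awalk k v p v" if "H.awalk v p v" for p
    using perm_digraph.subgraph_awalk_imp_awalk[OF that sub] .
  have nil: "H.awalk v [] v" using v by (simp add: H.awalk_simps)
  have vp: "v \<in> perms k" using perm_digraph.awalk_hd_in_verts[OF aw[OF nil]] by simp
  have vpos: "1 \<le> v i \<and> v i \<le> k" if "i \<in> {1..k}" for i using perms_in_iff[OF vp, of i] that by auto
  have "\<exists>w. H.awalk v w v \<and> (\<forall>i\<in>{1..k}. \<forall>j\<in>{1..k}. t \<le> v i \<longrightarrow> \<not> path_le k v w i (length w + j))"
    if "t \<le> k + 1" for t using that
  proof (induction t rule: inc_induct)
    case base
    \<comment> \<open>Ranks are at most \<open>k\<close>, so for \<open>k + 1\<close> the claim is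
      vacuous and the empty loop serves.\<close>
    then show ?case using nil by (intro exI[of _ "[]"]) (use vpos in \<open>fastforce\<close>)
  next
    case (step t)
    then obtain w where w: "H.awalk v w v"
      "\<And>i j. i\<in>{1..k} \<Longrightarrow> j\<in>{1..k} \<Longrightarrow> Suc t \<le> v i \<Longrightarrow> \<not> path_le k v w i (length w + j)" by blast
    show ?case
    proof (cases "t = 0")
      case True
      then show ?thesis using w vpos by (intro exI[of _ w]) auto
    next
      case False
      then obtain i0 where i0: "i0 \<in> {1..k}" "v i0 = t"
        using perms_surj[OF vp, of t] step by auto
      obtain p where p: "p \<noteq> []" "H.awalk v p v" "Drift k v p i0 \<noteq> 1"
        using dr[OF i0(1), of 1] by auto
      then have np: "\<not> path_le k v p i0 (length p + i0)" by (auto simp: Drift_def Drift2_def)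
      have "\<not> path_le k v (p @ w) i (length (p @ w) + j)"
        if ij: "i \<in> {1..k}" "j \<in> {1..k}" "t \<le> v i" for i j
      proof
        assume "path_le k v (p @ w) i (length (p @ w) + j)"
        then obtain m where m: "m \<in> {1..k}" "path_le k v p i (length p + m)" "path_le k v w m (length w + j)"
          using path_le_append(1)[OF aw[OF p(2)] aw[OF w(1)], of i "length w + j"] ij by (auto simp: ac_simps)
        \<comment> \<open>The loop \<open>w\<close> has no upward relation from ranks above
          \<open>t\<close>, so the middle element has rank at most \<open>t\<close>. Then
          \<open>x_i0 \<le> x_i \<le> y_m \<le> y_i0\<close> in the poset of \<open>p\<close>
          contradicts the choice of \<open>p\<close>.\<close>
        then have "v m \<le> v i0" using w(2) i0 ij by (metis not_less_eq_eq)
        then have "path_le k v p (length p + m) (length p + i0)"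
          using path_le_end[OF aw[OF p(2)] m(1) i0(1)] by simp
        moreover have "path_le k v p i0 i" using path_le_start[OF aw[OF p(2)] i0(1) ij(1)] ij i0 by simp
        ultimately show False using np m(2) unfolding path_le_def by (meson rtrancl_trans)
      qed
      then show ?thesis using H.awalk_appendI[OF p(2) w(1)] by blast
    qed
  qed
  from this[of 0] obtain up where up: "H.awalk v up v"
    "\<And>i j. i\<in>{1..k} \<Longrightarrow> j\<in>{1..k} \<Longrightarrow> \<not> path_le k v up i (length up + j)" by auto
  have "\<exists>w. H.awalk v w v \<and> (\<forall>i\<in>{1..k}. \<forall>j\<in>{1..k}. v i \<le> t \<longrightarrow> \<not> path_le k v w (length w + j) i)"
    if "t \<le> k" for t using that
  proof (induction t)
    case 0
    then show ?case using nil by (intro exI[of _ "[]"]) (use vpos in \<open>fastforce\<close>)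
  next
    case (Suc t)
    then obtain w where w: "H.awalk v w v"
      "\<And>i j. i\<in>{1..k} \<Longrightarrow> j\<in>{1..k} \<Longrightarrow> v i \<le> t \<Longrightarrow> \<not> path_le k v w (length w + j) i" by auto
    obtain i0 where i0: "i0 \<in> {1..k}" "v i0 = Suc t"
      using perms_surj[OF vp, of "Suc t"] Suc by auto
    obtain p where p: "p \<noteq> []" "H.awalk v p v" "Drift k v p i0 \<noteq> -1"
      using dr[OF i0(1), of "-1"] by auto
    \<comment> \<open>\<open>Drift2\<close> tests the positive sign first, so a drift other than
      \<open>-1\<close> excludes the downward relation only together with antisymmetry on a nonempty
      loop.\<close>
    have np: "\<not> path_le k v p (length p + i0) i0"
    proof
      assume le: "path_le k v p (length p + i0) i0"
      then have "path_le k v p i0 (length p + i0)"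
        using p(3) by (auto simp: Drift_def Drift2_def split: if_splits)
      from path_le_antisym[OF aw[OF p(2)] this le] p(1) show False by simp
    qed
    have "\<not> path_le k v (p @ w) (length (p @ w) + j) i"
      if ij: "i \<in> {1..k}" "j \<in> {1..k}" "v i \<le> Suc t" for i j
    proof
      assume "path_le k v (p @ w) (length (p @ w) + j) i"
      then obtain m where m: "m \<in> {1..k}" "path_le k v p (length p + m) i" "path_le k v w (length w + j) m"
        using path_le_append(2)[OF aw[OF p(2)] aw[OF w(1)], of i "length w + j"] ij by (auto simp: ac_simps)
      then have "v i0 \<le> v m" using w(2) i0 ij by (metis not_less_eq_eq)
      then have "path_le k v p (length p + i0) (length p + m)"
        using path_le_end[OF aw[OF p(2)] i0(1) m(1)] by simp
      moreover have "path_le k v p i i0" using path_le_start[OF aw[OF p(2)] ij(1) i0(1)] ij i0 by simp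
      ultimately show False using np m(2) unfolding path_le_def by (meson rtrancl_trans)
    qed
    then show ?case using H.awalk_appendI[OF p(2) w(1)] by blast
  qed
  from this[of k] obtain dn where dn: "H.awalk v dn v"
    "\<And>i j. i\<in>{1..k} \<Longrightarrow> j\<in>{1..k} \<Longrightarrow> \<not> path_le k v dn (length dn + j) i"
    using vpos by blast
  \<comment> \<open>Every upward relation across the product would restrict to one across
    \<open>up\<close>, every downward relation to one across \<open>dn\<close>.\<close>
  have "free_loop k v (up @ dn)" unfolding free_loop_def
  proof (intro conjI ballI notI)
    fix i j assume ij: "i \<in> {1..k}" "j \<in> {1..k}"
    { assume "path_le k v (up @ dn) i (length (up @ dn) + j)"
      then show False using path_le_append(1)[OF aw[OF up(1)] aw[OF dn(1)], of i "length dn + j"] ij up(2)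
        by (auto simp: ac_simps) }
    { assume "path_le k v (up @ dn) (length (up @ dn) + j) i"
      then show False using path_le_append(2)[OF aw[OF up(1)] aw[OF dn(1)], of i "length dn + j"] ij dn(2)
        by (auto simp: ac_simps) }
  qed (use aw[OF H.awalk_appendI[OF up(1) dn(1)]] in simp)
  then show ?thesis using H.awalk_appendI[OF up(1) dn(1)] by blast
qed

section \<open>Closing up a free loop\<close>

lemma mult_add_less_inj:
  fixes x y s t N :: nat
  assumes "x * N + s = y * N + t" "s < N" "t < N"
  shows "x = y" "s = t"
proof -
  have "(x * N + s) div N = x" "(y * N + t) div N = y" using assms(2,3) by simp_all
  with assms(1) show "x = y" by simp
  with assms(1) show "s = t" by simp
qed

text \<open>
  Gluing the two end blocks of a free loop creates no cycle: the level \<open>L a\<close>, the highest rank of a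
  block element below \<open>a\<close>, is monotone and agrees on both blocks, and on each level the block
  elements come first while the remaining elements are sorted by any linear extension.
\<close>

lemma free_loop_cyclic:
  assumes fr: "free_loop k v p" and k: "k \<ge> 1"
  obtains z :: "nat \<Rightarrow> nat" where "inj_on z {..<length p}"
    "\<And>a. a < length p \<Longrightarrow> Order (Suc k) (\<lambda>i. z ((a + i - 1) mod length p)) = p ! a"
proof -
  define l where "l = length p"
  have aw: "perm_digraph.awalk k v p v" using fr by (simp add: free_loop_def)
  have kl: "k < l" using free_loop_length[OF fr k] by (simp add: l_def)
  have v: "v \<in> perms k" using perm_digraph.awalk_hd_in_verts[OF aw] by simp
  have vpos: "1 \<le> v i" "v i \<le> k" if "i \<in> {1..k}" for i using perms_in_iff[OF v, of i] that by auto
  obtain z0 :: "nat \<Rightarrow> real" where z0: "inj_on z0 {1..l + k}" "fits k z0 v p"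
    using fits_exists[OF aw] unfolding l_def by blast
  let ?le = "path_le k v p"
  have cross: "\<not> ?le i (l + j)" "\<not> ?le (l + j) i" if "i \<in> {1..k}" "j \<in> {1..k}" for i j
    using fr that by (auto simp: free_loop_def l_def)
  have tr: "?le a c" if "?le a b" "?le b c" for a b c
    using that unfolding path_le_def by (rule rtrancl_trans)
  define B where "B a = {i \<in> {1..k}. ?le i a \<or> ?le (l + i) a}" for a
  \<comment> \<open>The inserted \<open>0\<close> is the level of elements that lie above no block
    element; ranks of \<open>v\<close> start at 1.\<close>
  define L where "L a = Max (insert 0 (v ` B a))" for a
  have fB: "finite (B a)" for a by (simp add: B_def)
  have Lmono: "L a \<le> L b" if "?le a b" for a b
    unfolding L_def using fB tr[OF _ that] by (intro Max_mono) (auto simp: B_def)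
  have L1: "L i = v i" if i: "i \<in> {1..k}" for i
  proof -
    have "B i = {j \<in> {1..k}. v j \<le> v i}"
      using path_le_start[OF aw _ i] cross[OF i] by (auto simp: B_def)
    then show ?thesis unfolding L_def using i by (intro Max_eqI) auto
  qed
  have L2: "L (l + i) = v i" if i: "i \<in> {1..k}" for i
  proof -
    have "B (l + i) = {j \<in> {1..k}. v j \<le> v i}"
      using path_le_end[OF aw _ i] cross(1)[OF _ i] by (auto simp: B_def l_def)
    then show ?thesis unfolding L_def using i by (intro Max_eqI) auto
  qed
  have Lat: "?le i a \<or> ?le (l + i) a" if i: "i \<in> {1..k}" "L a = v i" for i a
  proof -
    have "L a \<in> insert 0 (v ` B a)" unfolding L_def using fB by (intro Max_in) auto
    then obtain j where "j \<in> B a" "v j = v i" using vpos[OF i(1)] i(2) by auto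
    then show ?thesis using perms_eq_iff[OF v] by (auto simp: B_def)
  qed
  define rk where "rk a = card {b \<in> {1..l + k}. z0 b < z0 a}" for a
  define N where "N = l + k + 2"
  have rkN: "1 + rk a < N" for a
  proof -
    have "rk a \<le> card {1..l + k}" unfolding rk_def by (intro card_mono) auto
    then show ?thesis by (simp add: N_def)
  qed
  have rkless: "rk a < rk b" if "z0 a < z0 b" "a \<in> {1..l + k}" for a b
    unfolding rk_def
  proof (rule psubset_card_mono)
    show "{c \<in> {1..l + k}. z0 c < z0 a} \<subset> {c \<in> {1..l + k}. z0 c < z0 b}"
      using that by (auto simp: psubset_eq)
  qed simp
  define block where "block a \<longleftrightarrow> a \<le> k \<or> l < a" for a
  define tl where "tl a = (if block a then 0 else 1 + rk a)" for a
  \<comment> \<open>Lexicographic order of level and \<open>tl\<close>, encoded in base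
    \<open>N\<close>, which exceeds every \<open>tl\<close>.\<close>
  define y where "y a = L a * N + tl a" for a
  have tlN: "tl a < N" for a using rkN[of a] by (simp add: tl_def)
  have less: "y a < y b" if "(a, b) \<in> path_gen k v p" "a \<noteq> b" for a b
  proof -
    have ab: "a \<in> {1..l + k}" "b \<in> {1..l + k}" "?le a b"
      using path_gen_range[OF that(1)] that(1) by (auto simp: l_def path_le_def)
    show ?thesis
    proof (cases "L a < L b")
      case True
      then have "Suc (L a) * N \<le> L b * N" by (intro mult_le_mono1) simp
      then show ?thesis using tlN[of a] by (simp add: y_def)
    next
      case False
      then have LL: "L a = L b" using Lmono[OF ab(3)] by simp
      have "tl a < tl b"
      \<comment> \<open>If \<open>b\<close> were a block element, one of its two copies would lie
        below \<open>a\<close> and hence below \<open>b\<close>. If this copy is \<open>b\<close>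
        itself, antisymmetry is violated, otherwise freeness is.\<close>
      proof (cases "block b")
        case True
        then obtain i where i: "i \<in> {1..k}" "b = i \<or> b = l + i"
          using ab(2) unfolding block_def by (metis atLeastAtMost_iff add_le_cancel_left le_add_diff_inverse less_imp_le_nat zero_less_diff Suc_leI One_nat_def)
        then have "?le i a \<or> ?le (l + i) a" using Lat[OF i(1), of a] L1 L2 LL by auto
        then have False using i ab(3) tr[of _ a b] cross[OF i(1,1)] path_le_antisym[OF aw ab(3)] that(2)
          by blast
        then show ?thesis ..
      next
        case False
        have "z0 a \<le> z0 b" using fits_gen[OF aw z0(2) that(1)] .
        moreover have "z0 a \<noteq> z0 b" using z0(1) ab that(2) by (auto dest: inj_onD)
        ultimately have "rk a < rk b" using rkless ab by simp
        then show ?thesis using False by (auto simp: tl_def)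
      qed
      then show ?thesis using LL by (simp add: y_def)
    qed
  qed
  define z where "z b = y (Suc b)" for b
  have zy: "z ((a + c - 1) mod l) = y (a + c)" if "a < l" "c \<in> {1..Suc k}" for a c
  proof (cases "a + c - 1 < l")
    case True
    then show ?thesis using that by (simp add: z_def)
  next
    case False
    define i where "i = a + c - l"
    have i: "i \<in> {1..k}" "a + c = l + i" using False that by (auto simp: i_def)
    have "(a + c - 1) mod l = i - 1" using i kl by (subst le_mod_geq) auto
    then have "z ((a + c - 1) mod l) = y i" using i by (simp add: z_def)
    \<comment> \<open>Both copies of a block element have the same level and \<open>tl\<close> value
      0, so wrapping the last block around to the first leaves \<open>y\<close> unchanged.\<close>
    also have "\<dots> = y (l + i)" using L1[OF i(1)] L2[OF i(1)] i by (simp add: y_def tl_def block_def)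
    finally show ?thesis using i by simp
  qed
  show thesis
  proof (rule that[of z])
    show "inj_on z {..<length p}"
    proof (rule inj_onI)
      fix b c assume bc: "b \<in> {..<length p}" "c \<in> {..<length p}" "z b = z c"
      then have e: "L (Suc b) = L (Suc c)" "tl (Suc b) = tl (Suc c)"
        using mult_add_less_inj[OF bc(3)[unfolded z_def y_def] tlN tlN] by blast+
      show "b = c"
      proof (cases "block (Suc b)")
        case True
        then have "block (Suc c)" using e by (auto simp: tl_def split: if_splits)
        then have "Suc b \<in> {1..k}" "Suc c \<in> {1..k}" using True bc by (auto simp: block_def l_def)
        then show ?thesis using e(1) L1 perms_eq_iff[OF v] by (metis Suc_inject)
      next
        case False
        then have "rk (Suc b) = rk (Suc c)" using e by (auto simp: tl_def split: if_splits)
        then have "z0 (Suc b) = z0 (Suc c)" using rkless[of "Suc b" "Suc c"] rkless[of "Suc c" "Suc b"] bc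
          by (force simp: l_def)
        then show ?thesis using z0(1) bc by (auto dest!: inj_onD simp: l_def)
      qed
    qed
    fix a assume a: "a < length p"
    then have pa: "p ! a \<in> perms (Suc k)" using aw nth_mem[OF a] by (auto simp: perm_digraph.awalk_def)
    show "Order (Suc k) (\<lambda>i. z ((a + i - 1) mod length p)) = p ! a"
    proof (rule Order_eqI[OF pa])
      have *: "y (a + c) < y (a + d)" if "c \<in> {1..Suc k}" "d \<in> {1..Suc k}" "(p ! a) c < (p ! a) d" for c d
      proof (rule less)
        show "(a + c, a + d) \<in> path_gen k v p"
          unfolding path_gen_def using that a
          by (intro UnI2 CollectI exI[of _ "Suc a"] exI[of _ c] exI[of _ d]) auto
      qed (use that in auto)
      fix c d assume cd: "c \<in> {1..Suc k}" "d \<in> {1..Suc k}"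
      have "y (a + c) < y (a + d) \<longleftrightarrow> (p ! a) c < (p ! a) d"
        using *[OF cd] *[OF cd(2,1)] perms_eq_iff[OF pa, of c d]
        by (metis less_asym less_irrefl linorder_neqE_nat)
      then show "z ((a + c - 1) mod length p) < z ((a + d - 1) mod length p) \<longleftrightarrow> (p ! a) c < (p ! a) d"
        using zy cd a by (simp add: l_def)
    qed
  qed
qed

section \<open>Components and drift\<close>

lemma connected_componentD:
  assumes "C \<in> connected_components H"
  shows "induced_subgraph C H" "Digraph_Component.connected C"
  using assms unfolding connected_components_def by blast+

text \<open>Components are maximal among connected induced subgraphs, connectedness being the weak
  one that ignores directions; adjoining the head of an arc that leaves \<open>C\<close> would
  enlarge it. So loops of the graph cannot leave the component of their base point.\<close>

lemma (in wf_digraph) component_arc_closed: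
  assumes C: "C \<in> connected_components G" and e: "e \<in> arcs G" "tail G e \<in> verts C"
  shows "e \<in> arcs C"
proof -
  have ind: "induced_subgraph C G" "Digraph_Component.connected C"
    using connected_componentD[OF C] by blast+
  have "head G e \<in> verts C"
  proof (rule ccontr)
    assume h: "head G e \<notin> verts C"
    define S where "S = insert (head G e) (verts C)"
    have sub: "verts C \<subseteq> verts G" "arcs C = {e \<in> arcs G. tail G e \<in> verts C \<and> head G e \<in> verts C}"
      "tail C = tail G" "head C = head G"
      using ind(1) by (auto simp: induced_subgraph_def subgraph_def compatible_def)
    have S: "S \<subseteq> verts G" "S \<noteq> {}" using sub(1) e unfolding S_def by auto
    let ?R = "rtrancl_on S ((arcs_ends (G \<restriction> S))\<^sup>s)"
    have th: "(tail G e, head G e) \<in> ?R" "(head G e, tail G e) \<in> ?R"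
      using e by (auto simp: S_def symcl_def arcs_ends_conv image_iff
          intro!: rtrancl_on_into_rtrancl_on[OF rtrancl_on_refl])
    have "(arcs_ends C)\<^sup>s \<subseteq> (arcs_ends (G \<restriction> S))\<^sup>s"
      unfolding symcl_def arcs_ends_conv sub S_def by auto
    from rtrancl_on_mono[OF this, of "verts C" S]
    have C2: "(u, w) \<in> ?R" if "u \<in> verts C" "w \<in> verts C" for u w
      using that ind(2) unfolding connected_conv by (auto simp: S_def)
    have "(u, tail G e) \<in> ?R \<and> (tail G e, u) \<in> ?R" if "u \<in> S" for u
      using that th C2 e(2) unfolding S_def by blast
    then have "Digraph_Component.connected (G \<restriction> S)"
      unfolding connected_conv using S(2) by (auto intro: rtrancl_on_trans)
    moreover have "induced_subgraph (G \<restriction> S) G" using S(1) by (rule induced_induce)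
    moreover have "verts C \<subset> verts (G \<restriction> S)" using h by (auto simp: S_def)
    ultimately show False using C unfolding connected_components_def by blast
  qed
  then show ?thesis using ind(1) e unfolding induced_subgraph_def by auto
qed

lemma (in wf_digraph) component_awalk:
  assumes C: "C \<in> connected_components G" and "awalk u p w" "u \<in> verts C"
  shows "pre_digraph.awalk C u p w"
proof -
  have "induced_subgraph C G" using connected_componentD[OF C] by blast
  then interpret C: wf_digraph C by (auto simp: induced_subgraph_def)
  have th: "tail C = tail G" "head C = head G"
    using \<open>induced_subgraph C G\<close> by (auto simp: induced_subgraph_def subgraph_def compatible_def)
  from assms(2,3) show ?thesis
  proof (induction p arbitrary: u)
    case Nil then show ?case by (simp add: awalk_simps C.awalk_simps)
  next
    case (Cons e p)
    then have e: "e \<in> arcs C" using component_arc_closed[OF C, of e] by (auto simp: awalk_simps)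
    then have "head G e \<in> verts C" using C.head_in_verts th by auto
    with Cons e show ?case by (auto simp: awalk_simps C.awalk_simps th)
  qed
qed

lemma (in wf_digraph) component_exists:
  assumes "finite (verts G)" "v \<in> verts G"
  obtains C where "C \<in> connected_components G" "v \<in> verts C"
proof -
  let ?F = "{S. v \<in> S \<and> S \<subseteq> verts G \<and> Digraph_Component.connected (G \<restriction> S)}"
  have "finite ?F" using assms(1) by (rule rev_finite_subset[OF finite_Pow_iff[THEN iffD2]]) auto
  moreover have "{v} \<in> ?F" using assms(2) by (auto simp: connected_conv)
  ultimately have "Max (card ` ?F) \<in> card ` ?F" by (intro Max_in) blast+
  then obtain S where S: "S \<in> ?F" "card S = Max (card ` ?F)" by (metis (no_types, lifting) imageE)
  have Smax: "card T \<le> card S" if "T \<in> ?F" for T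
    unfolding S(2) using \<open>finite ?F\<close> that by (intro Max_ge) blast+
  have "G \<restriction> S \<in> connected_components G"
    unfolding connected_components_def
  proof (intro CollectI conjI notI)
    show "induced_subgraph (G \<restriction> S) G" "Digraph_Component.connected (G \<restriction> S)"
      using S(1) induced_induce by auto
    assume "\<exists>C'. induced_subgraph C' G \<and> Digraph_Component.connected C' \<and> verts (G \<restriction> S) \<subset> verts C'"
    then obtain C' where C': "induced_subgraph C' G" "Digraph_Component.connected C'" "S \<subset> verts C'" by auto
    have sub: "verts C' \<subseteq> verts G" using C'(1) by (auto simp: induced_subgraph_def)
    have "G \<restriction> verts C' = C'"
      by (rule induced_eq_verts_imp_eq[OF induced_induce[OF sub] C'(1)]) simp
    then have "verts C' \<in> ?F" using C' sub S(1) by auto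
    moreover have "card S < card (verts C')"
      using C'(3) sub assms(1) by (meson finite_subset psubset_card_mono)
    ultimately show False using Smax[of "verts C'"] by simp
  qed
  with that show thesis using S(1) by auto
qed

text \<open>Loops of \<open>H\<close> at \<open>v\<close> are exactly the loops of the component of
  \<open>v\<close>, so components disappear from the condition: it becomes one about every vertex,
  index and sign separately.\<close>

lemma driftless_iff:
  assumes sub: "subgraph H (perm_digraph k)"
  shows "driftless k H \<longleftrightarrow> (\<forall>v\<in>verts H. \<forall>j\<in>{1..k}. \<forall>\<epsilon>\<in>{1, -1}.
    \<exists>p. p \<noteq> [] \<and> pre_digraph.awalk H v p v \<and> Drift k v p j \<noteq> \<epsilon>)" (is "_ \<longleftrightarrow> ?R")
proof -
  interpret H: wf_digraph H using sub by auto
  have fin: "finite (verts H)" using sub finite_subset[OF _ finite_perms[of k]] by auto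
  have ind: "verts C \<subseteq> verts H" "subgraph C H" if "C \<in> connected_components H" for C
    using connected_componentD(1)[OF that] by (auto dest: induced_imp_subgraph)
  show ?thesis
  proof
    assume d: "driftless k H"
    show ?R
    proof (intro ballI)
      fix v j \<epsilon> assume *: "v \<in> verts H" "j \<in> {1..k}" "\<epsilon> \<in> {1, -1 :: int}"
      obtain C where C: "C \<in> connected_components H" "v \<in> verts C"
        using H.component_exists[OF fin *(1)] .
      then have "\<not> component_drifts k C" using d by (auto simp: driftless_def)
      then obtain p where "p \<noteq> []" "pre_digraph.awalk C v p v" "Drift k v p j \<noteq> \<epsilon>"
        using C(2) * unfolding component_drifts_def by blast
      then show "\<exists>p. p \<noteq> [] \<and> H.awalk v p v \<and> Drift k v p j \<noteq> \<epsilon>"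
        using H.subgraph_awalk_imp_awalk[OF _ ind(2)[OF C(1)]] by blast
    qed
  next
    assume R: ?R
    show "driftless k H"
      unfolding driftless_def
    proof
      assume "\<exists>C\<in>connected_components H. component_drifts k C"
      then obtain C v j \<epsilon> where C: "C \<in> connected_components H" "v \<in> verts C" "j \<in> {1..k}" "\<epsilon> \<in> {1, -1 :: int}"
        "\<And>p. p \<noteq> [] \<Longrightarrow> pre_digraph.awalk C v p v \<Longrightarrow> Drift k v p j = \<epsilon>"
        unfolding component_drifts_def by blast
      then obtain p where "p \<noteq> []" "H.awalk v p v" "Drift k v p j \<noteq> \<epsilon>" using R ind(1)[OF C(1)] by (meson subsetD)
      then have "pre_digraph.awalk C v p v" using H.component_awalk[OF C(1) _ C(2)] by blast
      then show False using C(5)[OF \<open>p \<noteq> []\<close>] \<open>Drift k v p j \<noteq> \<epsilon>\<close> by blast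
    qed
  qed
qed

section \<open>Flows as combinations of cyclic patterns\<close>

text \<open>
  The elements of \<open>I\<close> stand for disjoint intervals of lengths \<open>w\<close>, placed from left to right in the
  order of the natural numbers; \<open>N\<close> maps each interval to the next one along the orbits.
\<close>

definition cell_system :: "nat \<Rightarrow> nat set \<Rightarrow> (nat \<Rightarrow> real) \<Rightarrow> (nat \<Rightarrow> nat) \<Rightarrow> bool" where
  "cell_system n I w N \<longleftrightarrow> finite I \<and> bij_betw N I I \<and>
     (\<forall>i\<in>I. 0 < w i \<and> w (N i) = w i \<and> inj_on (\<lambda>t. (N ^^ t) i) {..<n})"

definition cell_pattern :: "nat \<Rightarrow> (nat \<Rightarrow> nat) \<Rightarrow> nat \<Rightarrow> nat \<Rightarrow> nat" where
  "cell_pattern n N i = Order n (\<lambda>t. (N ^^ (t - 1)) i)"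

definition cell_dist :: "nat \<Rightarrow> nat set \<Rightarrow> (nat \<Rightarrow> real) \<Rightarrow> (nat \<Rightarrow> nat) \<Rightarrow> (nat \<Rightarrow> nat) \<Rightarrow> real" where
  "cell_dist n I w N \<sigma> = (\<Sum>i\<in>I. if cell_pattern n N i = \<sigma> then w i else 0)"

text \<open>The total weight stays free, so that sums and nonnegative multiples remain in the set;
  normalization returns only when the cells become subintervals of the unit interval.\<close>

definition cell_cone :: "nat \<Rightarrow> ((nat \<Rightarrow> nat) \<Rightarrow> real) set" where
  "cell_cone n = {cell_dist n I w N | I w N. cell_system n I w N}"

lemma subgraph_permD:
  assumes "subgraph H (perm_digraph k)"
  shows "verts H \<subseteq> perms k" "arcs H \<subseteq> perms (Suc k)" "tail H = \<rho> k" "head H = \<rho>' k"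
  using assms unfolding subgraph_def compatible_def by simp_all

lemma funpow_in:
  assumes "bij_betw N I I" "i \<in> I" shows "(N ^^ t) i \<in> I"
  using assms by (induction t) (auto dest: bij_betwE)

section \<open>The convex cone of cell distributions\<close>

lemma cell_cone_zero: "(\<lambda>\<sigma>. 0) \<in> cell_cone n"
  unfolding cell_cone_def cell_system_def
  by (intro CollectI exI[of _ "{}"]) (auto simp: cell_dist_def fun_eq_iff bij_betw_def)

lemma cell_cone_scale:
  assumes "\<mu> \<in> cell_cone n" "0 \<le> c"
  shows "(\<lambda>\<sigma>. c * \<mu> \<sigma>) \<in> cell_cone n"
proof (cases "c = 0")
  case True
  then show ?thesis using cell_cone_zero by simp
next
  case False
  obtain I w N where s: "cell_system n I w N" "\<mu> = cell_dist n I w N"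
    using assms(1) by (auto simp: cell_cone_def)
  have "cell_system n I (\<lambda>i. c * w i) N"
    using s(1) assms(2) False by (auto simp: cell_system_def)
  moreover have "(\<lambda>\<sigma>. c * \<mu> \<sigma>) = cell_dist n I (\<lambda>i. c * w i) N"
    by (auto simp: s(2) cell_dist_def fun_eq_iff sum_distrib_left intro!: sum.cong)
  ultimately show ?thesis by (auto simp: cell_cone_def)
qed

lemma cell_cone_add:
  assumes "\<mu> \<in> cell_cone n" "\<nu> \<in> cell_cone n"
  shows "(\<lambda>\<sigma>. \<mu> \<sigma> + \<nu> \<sigma>) \<in> cell_cone n"
proof -
  obtain I1 w1 N1 where s1: "cell_system n I1 w1 N1" "\<mu> = cell_dist n I1 w1 N1"
    using assms(1) by (auto simp: cell_cone_def)
  obtain I2 w2 N2 where s2: "cell_system n I2 w2 N2" "\<nu> = cell_dist n I2 w2 N2"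
    using assms(2) by (auto simp: cell_cone_def)
  have fin: "finite I1" "finite I2" and bij: "bij_betw N1 I1 I1" "bij_betw N2 I2 I2"
    using s1(1) s2(1) by (auto simp: cell_system_def)
  \<comment> \<open>The second system is placed to the right of the first by adding
    \<open>M\<close>. Orbits stay within their system, and a common offset does not change order
    patterns.\<close>
  define M where "M = Suc (Max (insert 0 I1))"
  have M: "i < M" if "i \<in> I1" for i
    unfolding M_def using that fin(1) by (simp add: le_imp_less_Suc)
  define I where "I = I1 \<union> (\<lambda>i. i + M) ` I2"
  define w where "w i = (if i < M then w1 i else w2 (i - M))" for i
  define N where "N i = (if i < M then N1 i else N2 (i - M) + M)" for i
  have it1: "(N ^^ t) i = (N1 ^^ t) i" if "i \<in> I1" for i t
    by (induction t) (use M funpow_in[OF bij(1) that] in \<open>auto simp: N_def\<close>)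
  have it2: "(N ^^ t) (i + M) = (N2 ^^ t) i + M" for i t
    by (induction t) (auto simp: N_def)
  have "bij_betw N1 I1 I1 \<longleftrightarrow> bij_betw N I1 I1"
    by (rule bij_betw_cong) (use M in \<open>auto simp: N_def\<close>)
  then have b1: "bij_betw N I1 I1" using bij by simp
  have "inj_on N ((\<lambda>i. i + M) ` I2)"
    using bij(2) by (auto simp: inj_on_def bij_betw_def N_def)
  moreover have "N ` (\<lambda>i. i + M) ` I2 = (\<lambda>i. i + M) ` N2 ` I2"
    unfolding image_image N_def by (rule image_cong) auto
  ultimately have "bij_betw N ((\<lambda>i. i + M) ` I2) ((\<lambda>i. i + M) ` I2)"
    using bij(2) by (simp add: bij_betw_def)
  then have bN: "bij_betw N I I"
    unfolding I_def using b1 M by (intro bij_betw_combine) auto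
  have sys: "cell_system n I w N" unfolding cell_system_def
  proof (intro conjI ballI)
    fix i assume "i \<in> I"
    then consider "i \<in> I1" | j where "j \<in> I2" "i = j + M" by (auto simp: I_def)
    then have "0 < w i \<and> w (N i) = w i \<and> inj_on (\<lambda>t. (N ^^ t) i) {..<n}"
    proof cases
      case 1
      then have "N1 i < M" using M bij(1) by (auto dest: bij_betwE)
      then show ?thesis using 1 s1(1) M it1[OF 1] by (auto simp: cell_system_def w_def N_def)
    next
      case 2
      then show ?thesis using s2(1) it2 by (auto simp: cell_system_def w_def N_def inj_on_def)
    qed
    then show "0 < w i" "w (N i) = w i" "inj_on (\<lambda>t. (N ^^ t) i) {..<n}" by auto
  qed (use fin bN in \<open>auto simp: I_def\<close>)
  have p1: "cell_pattern n N i = cell_pattern n N1 i" if "i \<in> I1" for i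
    by (simp add: cell_pattern_def it1[OF that])
  have p2: "cell_pattern n N (i + M) = cell_pattern n N2 i" for i
    unfolding cell_pattern_def it2 by (rule Order_cong) simp
  have "cell_dist n I w N \<sigma> = \<mu> \<sigma> + \<nu> \<sigma>" for \<sigma>
  proof -
    have "I1 \<inter> (\<lambda>i. i + M) ` I2 = {}" using M by fastforce
    then have "cell_dist n I w N \<sigma> = (\<Sum>i\<in>I1. if cell_pattern n N i = \<sigma> then w i else 0) +
        (\<Sum>i\<in>(\<lambda>i. i + M) ` I2. if cell_pattern n N i = \<sigma> then w i else 0)"
      unfolding cell_dist_def I_def using fin by (subst sum.union_disjoint) auto
    also have "(\<Sum>i\<in>I1. if cell_pattern n N i = \<sigma> then w i else 0) = \<mu> \<sigma>"
      unfolding s1(2) cell_dist_def by (rule sum.cong) (use p1 M in \<open>auto simp: w_def\<close>)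
    also have "(\<Sum>i\<in>(\<lambda>i. i + M) ` I2. if cell_pattern n N i = \<sigma> then w i else 0) = \<nu> \<sigma>"
      unfolding s2(2) cell_dist_def
      by (subst sum.reindex) (auto simp: p2 w_def intro!: sum.cong)
    finally show ?thesis .
  qed
  then have "(\<lambda>\<sigma>. \<mu> \<sigma> + \<nu> \<sigma>) = cell_dist n I w N" by auto
  with sys show ?thesis by (auto simp: cell_cone_def)
qed

lemma cell_cone_sum:
  assumes "finite A" "\<And>a. a \<in> A \<Longrightarrow> \<mu> a \<in> cell_cone n"
  shows "(\<lambda>\<sigma>. \<Sum>a\<in>A. \<mu> a \<sigma>) \<in> cell_cone n"
  using assms by (induction rule: finite_induct) (auto intro: cell_cone_zero cell_cone_add)

abbreviation edge_count :: "(nat \<Rightarrow> nat) list \<Rightarrow> (nat \<Rightarrow> nat) \<Rightarrow> real" where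
  "edge_count p \<equiv> (\<lambda>\<sigma>. real (count_list p \<sigma>))"

text \<open>The cyclic pattern \<open>z\<close> of the loop yields one cell of weight 1 per
  position; \<open>N\<close> moves each cell to that of the next position, and the pattern seen from
  position \<open>a\<close> is the edge \<open>p ! a\<close>.\<close>

lemma free_loop_cell_cone:
  assumes fr: "free_loop k v p" and k: "k \<ge> 1"
  shows "edge_count p \<in> cell_cone (Suc k)"
proof -
  define l where "l = length p"
  have l: "Suc k \<le> l" using free_loop_length[OF fr k] by (simp add: l_def)
  obtain z :: "nat \<Rightarrow> nat" where z: "inj_on z {..<l}" "\<And>a. a < l \<Longrightarrow> Order (Suc k) (\<lambda>i. z ((a + i - 1) mod l)) = p ! a"
    using free_loop_cyclic[OF fr k] unfolding l_def by blast
  define I where "I = z ` {..<l}"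
  define N where "N i = z ((inv_into {..<l} z i + 1) mod l)" for i
  have N: "N (z a) = z ((a + 1) mod l)" if "a < l" for a
    using that z(1) by (simp add: N_def)
  have it: "(N ^^ t) (z a) = z ((a + t) mod l)" if "a < l" for a t
    using that by (induction t) (auto simp: N mod_Suc_eq)
  have inj: "inj_on (\<lambda>t. (a + t) mod l) {..<l}" if "a < l" for a
  proof (rule inj_onI)
    fix s t assume st: "s \<in> {..<l}" "t \<in> {..<l}" "(a + s) mod l = (a + t) mod l"
    have "[s = t] (mod l)" using st(3) cong_add_lcancel_nat[of a s t l] by (simp add: cong_def)
    then show "s = t" using st by (simp add: cong_def)
  qed
  have zm: "z (x mod l) \<in> I" for x using l by (auto simp: I_def)
  have sub: "N ` I \<subseteq> I" using zm N by (auto simp: I_def)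
  have "inj_on N I"
  proof (rule inj_onI)
    fix i j assume "i \<in> I" "j \<in> I" "N i = N j"
    then obtain a b where ab: "a < l" "b < l" "i = z a" "j = z b" "z ((a + 1) mod l) = z ((b + 1) mod l)"
      using N by (auto simp: I_def)
    have "(a + 1) mod l = (b + 1) mod l" using inj_onD[OF z(1) ab(5)] l by simp
    then have "[a = b] (mod l)" using cong_add_rcancel_nat[of a 1 b l] by (simp add: cong_def)
    then show "i = j" using ab by (simp add: cong_def)
  qed
  then have bij: "bij_betw N I I" using sub endo_inj_surj[of I N] by (simp add: bij_betw_def I_def)
  have "cell_system (Suc k) I (\<lambda>_. 1) N" unfolding cell_system_def
  proof (intro conjI ballI)
    fix i assume "i \<in> I"
    then obtain a where a: "a < l" "i = z a" by (auto simp: I_def)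
    have "inj_on (z \<circ> (\<lambda>t. (a + t) mod l)) {..<l}"
      by (rule comp_inj_on[OF inj[OF a(1)]], rule inj_on_subset[OF z(1)]) (use l in auto)
    then have "inj_on (\<lambda>t. (N ^^ t) i) {..<l}" using a it by (simp add: comp_def)
    then show "inj_on (\<lambda>t. (N ^^ t) i) {..<Suc k}" by (rule inj_on_subset) (use l in auto)
  qed (use bij in \<open>auto simp: I_def\<close>)
  moreover have "cell_dist (Suc k) I (\<lambda>_. 1) N \<sigma> = real (count_list p \<sigma>)" for \<sigma>
  proof -
    have pat: "cell_pattern (Suc k) N (z a) = p ! a" if "a < l" for a
    proof -
      have "cell_pattern (Suc k) N (z a) = Order (Suc k) (\<lambda>i. z ((a + i - 1) mod l))"
        unfolding cell_pattern_def by (rule Order_cong) (simp add: it that)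
      then show ?thesis using z(2) that by simp
    qed
    have "cell_dist (Suc k) I (\<lambda>_. 1) N \<sigma> = (\<Sum>a<l. if p ! a = \<sigma> then 1 else 0)"
      unfolding cell_dist_def I_def using z(1) by (subst sum.reindex) (auto simp: pat intro!: sum.cong)
    also have "\<dots> = real (card {a. a < l \<and> \<sigma> = p ! a})"
      by (subst sum.inter_filter[symmetric]) (auto intro!: arg_cong[where f = card])
    also have "\<dots> = real (count_list p \<sigma>)"
      by (simp add: count_list_eq_length_filter length_filter_conv_card l_def)
    finally show ?thesis .
  qed
  ultimately show ?thesis unfolding cell_cone_def
    by (intro CollectI exI[of _ I] exI[of _ "\<lambda>_. 1"] exI[of _ N]) auto
qed

section \<open>Flows and their decomposition into loops\<close>

definition flow :: "nat \<Rightarrow> ((nat \<Rightarrow> nat) \<Rightarrow> real) \<Rightarrow> bool" where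
  "flow k \<nu> \<longleftrightarrow> (\<forall>\<tau>\<in>perms k. (\<Sum>\<sigma>\<in>{\<sigma> \<in> perms (Suc k). \<rho> k \<sigma> = \<tau>}. \<nu> \<sigma>) =
     (\<Sum>\<sigma>\<in>{\<sigma> \<in> perms (Suc k). \<rho>' k \<sigma> = \<tau>}. \<nu> \<sigma>))"

lemma flow_add: "flow k \<mu> \<Longrightarrow> flow k \<nu> \<Longrightarrow> flow k (\<lambda>\<sigma>. \<mu> \<sigma> + \<nu> \<sigma>)"
  by (simp add: flow_def sum.distrib)

lemma flow_scale: "flow k \<mu> \<Longrightarrow> flow k (\<lambda>\<sigma>. c * \<mu> \<sigma>)"
  by (simp add: flow_def sum_distrib_left[symmetric])

lemma flow_sum:
  assumes "finite A" "\<And>a. a \<in> A \<Longrightarrow> flow k (\<mu> a)"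
  shows "flow k (\<lambda>\<sigma>. \<Sum>a\<in>A. \<mu> a \<sigma>)"
  using assms by (induction rule: finite_induct) (auto intro: flow_add simp: flow_def[of _ "\<lambda>_. 0"])

text \<open>Each edge leaves its tail and enters its head, so all contributions cancel except at the
  two ends of the walk; for a loop nothing remains.\<close>

lemma walk_flow:
  assumes "perm_digraph.awalk k v p w"
  shows "(\<Sum>\<sigma>\<in>{\<sigma> \<in> perms (Suc k). \<rho> k \<sigma> = \<tau>}. edge_count p \<sigma>) + (if w = \<tau> then 1 else 0) =
    (\<Sum>\<sigma>\<in>{\<sigma> \<in> perms (Suc k). \<rho>' k \<sigma> = \<tau>}. edge_count p \<sigma>) + (if v = \<tau> then 1 else 0)"
  using assms
proof (induction p arbitrary: v)
  case Nil
  then show ?case by (simp add: perm_digraph.awalk_simps)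
next
  case (Cons e p)
  then have e: "e \<in> perms (Suc k)" "v = \<rho> k e" "perm_digraph.awalk k (\<rho>' k e) p w"
    by (auto simp: awalk_perm_Cons)
  have c: "edge_count (e # p) \<sigma> = edge_count p \<sigma> + (if e = \<sigma> then 1 else 0)" for \<sigma> by simp
  have d: "(\<Sum>\<sigma>\<in>{\<sigma> \<in> perms (Suc k). P \<sigma>}. if e = \<sigma> then 1 else 0) = (if P e then 1 else 0 :: real)" for P
    using e(1) by (subst sum.delta') auto
  show ?case using Cons.IH[OF e(3)] unfolding c sum.distrib d e(2) by (auto split: if_splits)
qed

lemma loop_flow: "perm_digraph.awalk k v p v \<Longrightarrow> flow k (edge_count p)"
  unfolding flow_def using walk_flow[of k v p v] by simp

lemma (in wf_digraph) awalk_seq: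
  assumes "\<And>t. i \<le> t \<Longrightarrow> t < j \<Longrightarrow> s t \<in> arcs G" "\<And>t. i \<le> t \<Longrightarrow> t < j \<Longrightarrow> tail G (s t) = x t"
    "\<And>t. i \<le> t \<Longrightarrow> t < j \<Longrightarrow> head G (s t) = x (Suc t)"  "i < j"
  shows "awalk (x i) (map s [i..<j]) (x j)"
  using assms
proof (induction "j - i" arbitrary: i)
  case (Suc d)
  have eq: "[i..<j] = i # [Suc i..<j]" using Suc.prems(4) by (simp add: upt_rec)
  have st: "s i \<in> arcs G" "tail G (s i) = x i" "head G (s i) = x (Suc i)" using Suc.prems by auto
  show ?case
  proof (cases "Suc i < j")
    case True
    then have "awalk (x (Suc i)) (map s [Suc i..<j]) (x j)" using Suc by auto
    then show ?thesis using st unfolding eq by (simp add: awalk_simps)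
  next
    case False
    then have "j = Suc i" using Suc.prems(4) by simp
    then show ?thesis using st head_in_verts[of "s i"] by (simp add: awalk_simps)
  qed
qed simp

text \<open>By conservation, a positive edge entering a vertex forces a positive edge leaving it.
  Following such successors among finitely many edges must repeat.\<close>

lemma flow_support_loop:
  assumes sub: "subgraph H (perm_digraph k)" and fl: "flow k \<nu>"
    and nn: "\<And>\<sigma>. 0 \<le> \<nu> \<sigma>" and sp: "\<And>\<sigma>. \<sigma> \<notin> arcs H \<Longrightarrow> \<nu> \<sigma> = 0" and e0: "\<nu> e0 \<noteq> 0"
  shows "\<exists>v p. p \<noteq> [] \<and> pre_digraph.awalk H v p v \<and> (\<forall>\<sigma>\<in>set p. \<nu> \<sigma> > 0)"
proof -
  interpret H: wf_digraph H using sub by auto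
  define S where "S = {\<sigma> \<in> arcs H. \<nu> \<sigma> > 0}"
  have HG: "arcs H \<subseteq> perms (Suc k)" "tail H = \<rho> k" "head H = \<rho>' k"
    using subgraph_permD[OF sub] by auto
  have fS: "finite S" using HG(1) finite_subset[OF _ finite_perms] by (auto simp: S_def)
  have e0S: "e0 \<in> S" using e0 sp nn[of e0] by (force simp: S_def)
  have nx: "\<exists>e'\<in>S. \<rho> k e' = \<rho>' k e" if e: "e \<in> S" for e
  proof -
    have eG: "e \<in> perms (Suc k)" "\<nu> e > 0" using e HG by (auto simp: S_def)
    then have "0 < (\<Sum>\<sigma>\<in>{\<sigma> \<in> perms (Suc k). \<rho>' k \<sigma> = \<rho>' k e}. \<nu> \<sigma>)"
      using nn by (intro sum_pos2[of _ e]) auto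
    also have "\<dots> = (\<Sum>\<sigma>\<in>{\<sigma> \<in> perms (Suc k). \<rho> k \<sigma> = \<rho>' k e}. \<nu> \<sigma>)"
      using fl eG unfolding flow_def by simp
    finally obtain e' where e': "e' \<in> perms (Suc k)" "\<rho> k e' = \<rho>' k e" "\<nu> e' \<noteq> 0"
      by (metis (mono_tags, lifting) less_irrefl mem_Collect_eq sum.neutral)
    then have "e' \<in> S" using sp nn[of e'] by (force simp: S_def)
    then show ?thesis using e' by blast
  qed
  then obtain g where g: "\<And>e. e \<in> S \<Longrightarrow> g e \<in> S \<and> \<rho> k (g e) = \<rho>' k e" by metis
  define s where "s t = (g ^^ t) e0" for t
  have sS: "s t \<in> S" for t by (induction t) (use g e0S in \<open>auto simp: s_def\<close>)
  have "\<not> inj s" using fS sS by (meson finite_subset image_subset_iff infinite_UNIV_nat inj_on_finite subset_UNIV)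
  then obtain a b where ab: "a < b" "s a = s b"
    unfolding inj_def by (metis linorder_neqE_nat)
  have "H.awalk (\<rho> k (s a)) (map s [a..<b]) (\<rho> k (s b))"
  proof (rule H.awalk_seq[where x = "\<lambda>t. \<rho> k (s t)"])
    fix t
    show "s t \<in> arcs H" "tail H (s t) = \<rho> k (s t)" "head H (s t) = \<rho> k (s (Suc t))"
      using sS[of t] g[OF sS[of t]] HG by (auto simp: S_def s_def)
  qed (use ab in auto)
  then show ?thesis using ab sS
    by (intro exI[of _ "\<rho> k (s a)"] exI[of _ "map s [a..<b]"]) (auto simp: S_def)
qed

text \<open>
  Any loop \<open>p\<close> can be realized up to an arbitrarily small multiple of a free loop \<open>d\<close> at the
  same vertex, because \<open>p\<close> repeated \<open>m\<close> times followed by \<open>d\<close> is free.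
\<close>

lemma loop_plus_free_cell_cone:
  assumes p: "perm_digraph.awalk k v p v" and d: "free_loop k v d" and k: "k \<ge> 1"
    and "0 \<le> t" "0 < \<epsilon>"
  shows "(\<lambda>\<sigma>. t * edge_count p \<sigma> + \<epsilon> * edge_count d \<sigma>) \<in> cell_cone (Suc k)"
proof -
  obtain m :: nat where m: "m > 0" "t / \<epsilon> < real m"
    using reals_Archimedean2[of "t / \<epsilon>"] assms(4,5) by (metis divide_nonneg_pos gr0I leD of_nat_0)
  have fr: "free_loop k v (concat (replicate j p) @ d)" for j
    by (induction j) (use d free_loop_append[OF p] in auto)
  have cnt: "edge_count (concat (replicate j p) @ d) \<sigma> = real j * edge_count p \<sigma> + edge_count d \<sigma>" for j \<sigma>
    by (induction j) (auto simp: algebra_simps)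
  \<comment> \<open>The free loop that repeats \<open>p\<close>, with weight \<open>t / m\<close>,
    contributes \<open>t\<close> times \<open>p\<close> and \<open>t / m\<close> times
    \<open>d\<close>. By the choice of \<open>m\<close>, \<open>t / m\<close> is below
    \<open>\<epsilon>\<close>, and \<open>d\<close> alone supplies the difference.\<close>
  have "(\<lambda>\<sigma>. (t / m) * edge_count (concat (replicate m p) @ d) \<sigma> + (\<epsilon> - t / m) * edge_count d \<sigma>) \<in> cell_cone (Suc k)"
    using m assms(4,5) by (intro cell_cone_add cell_cone_scale free_loop_cell_cone[OF fr k] free_loop_cell_cone[OF d k])
      (auto simp: field_simps)
  moreover have "(t / m) * edge_count (concat (replicate m p) @ d) \<sigma> + (\<epsilon> - t / m) * edge_count d \<sigma> =
      t * edge_count p \<sigma> + \<epsilon> * edge_count d \<sigma>" for \<sigma>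
    unfolding cnt using m(1) by (simp add: field_simps)
  ultimately show ?thesis by simp
qed

text \<open>Induction on the size of the support of the flow: a loop in the support is peeled off,
  and part of the free loop at its base point pays for its realization. \<open>\<epsilon>\<close> is
  arbitrary so that it can be halved at each stage.\<close>

lemma flow_plus_free_cell_cone:
  assumes sub: "subgraph H (perm_digraph k)" and k: "k \<ge> 1"
    and d: "\<And>v. v \<in> verts H \<Longrightarrow> free_loop k v (d v)"
    and "flow k \<nu>" "\<And>\<sigma>. 0 \<le> \<nu> \<sigma>" "\<And>\<sigma>. \<sigma> \<notin> arcs H \<Longrightarrow> \<nu> \<sigma> = 0" "0 < \<epsilon>"
  shows "(\<lambda>\<sigma>. \<nu> \<sigma> + \<epsilon> * (\<Sum>v\<in>verts H. edge_count (d v) \<sigma>)) \<in> cell_cone (Suc k)"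
  using assms(4-7)
proof (induction "card {\<sigma>. \<nu> \<sigma> \<noteq> 0}" arbitrary: \<nu> \<epsilon> rule: less_induct)
  case less
  interpret H: wf_digraph H using sub by auto
  have finV: "finite (verts H)" using subgraph_permD(1)[OF sub] finite_subset[OF _ finite_perms[of k]] by auto
  have finS: "finite {\<sigma>. \<nu> \<sigma> \<noteq> 0}"
    using subgraph_permD(2)[OF sub] less.prems(3) by (intro finite_subset[OF _ finite_perms[of "Suc k"]]) auto
  have dsum: "(\<lambda>\<sigma>. \<epsilon> * (\<Sum>v\<in>V. edge_count (d v) \<sigma>)) \<in> cell_cone (Suc k)" if "V \<subseteq> verts H" "0 \<le> \<epsilon>" for V \<epsilon>
    using that finV finite_subset[OF that(1)] d
    by (intro cell_cone_scale cell_cone_sum free_loop_cell_cone[OF _ k]) auto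
  show ?case
  proof (cases "\<forall>\<sigma>. \<nu> \<sigma> = 0")
    case True
    then show ?thesis using dsum[of "verts H" \<epsilon>] less.prems(4) by simp
  next
    case False
    then obtain e0 where e0: "\<nu> e0 \<noteq> 0" by blast
    obtain v p where p: "p \<noteq> []" "H.awalk v p v" "\<And>\<sigma>. \<sigma> \<in> set p \<Longrightarrow> \<nu> \<sigma> > 0"
      using flow_support_loop[OF sub less.prems(1-3) e0] by blast
    have v: "v \<in> verts H" using H.awalk_hd_in_verts[OF p(2)] .
    have pG: "perm_digraph.awalk k v p v" using perm_digraph.subgraph_awalk_imp_awalk[OF p(2) sub] .
    \<comment> \<open>The largest multiple of \<open>p\<close> that keeps the flow nonnegative; at
      an edge attaining the minimum the new flow vanishes, so the support shrinks.\<close>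
    define t where "t = Min ((\<lambda>\<sigma>. \<nu> \<sigma> / edge_count p \<sigma>) ` set p)"
    have cpos: "edge_count p \<sigma> > 0" if "\<sigma> \<in> set p" for \<sigma>
      using that count_notin[of \<sigma> p] by (simp add: count_list_0_iff zero_less_iff_neq_zero)
    have "t \<in> (\<lambda>\<sigma>. \<nu> \<sigma> / edge_count p \<sigma>) ` set p" unfolding t_def using p(1) by (intro Min_in) auto
    then obtain e where e: "e \<in> set p" "t = \<nu> e / edge_count p e" by auto
    have tpos: "t > 0" using e p(3) cpos by simp
    have tle: "t * edge_count p \<sigma> \<le> \<nu> \<sigma>" for \<sigma>
    proof (cases "\<sigma> \<in> set p")
      case True
      then have "t \<le> \<nu> \<sigma> / edge_count p \<sigma>" unfolding t_def by (intro Min_le) auto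
      then show ?thesis using cpos[OF True] by (simp add: field_simps)
    next
      case False then show ?thesis using less.prems(2) by simp
    qed
    define \<nu>' where "\<nu>' \<sigma> = \<nu> \<sigma> + (- t) * edge_count p \<sigma>" for \<sigma>
    have pz: "\<nu> \<sigma> = 0 \<Longrightarrow> edge_count p \<sigma> = 0" for \<sigma>
      by (metis count_list_0_iff less_irrefl of_nat_0 p(3))
    have "{\<sigma>. \<nu>' \<sigma> \<noteq> 0} \<subset> {\<sigma>. \<nu> \<sigma> \<noteq> 0}"
    proof
      show "{\<sigma>. \<nu>' \<sigma> \<noteq> 0} \<subseteq> {\<sigma>. \<nu> \<sigma> \<noteq> 0}" using pz by (auto simp: \<nu>'_def)
      have "\<nu>' e = 0" using e cpos[OF e(1)] by (simp add: \<nu>'_def)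
      moreover have "\<nu> e \<noteq> 0" using p(3)[OF e(1)] by simp
      ultimately show "{\<sigma>. \<nu>' \<sigma> \<noteq> 0} \<noteq> {\<sigma>. \<nu> \<sigma> \<noteq> 0}" by blast
    qed
    then have card: "card {\<sigma>. \<nu>' \<sigma> \<noteq> 0} < card {\<sigma>. \<nu> \<sigma> \<noteq> 0}" using finS by (rule psubset_card_mono[rotated])
    have fl': "flow k \<nu>'" unfolding \<nu>'_def by (intro flow_add flow_scale less.prems(1) loop_flow[OF pG])
    have IH: "(\<lambda>\<sigma>. \<nu>' \<sigma> + (\<epsilon> / 2) * (\<Sum>v\<in>verts H. edge_count (d v) \<sigma>)) \<in> cell_cone (Suc k)"
      by (rule less.hyps[OF card fl']) (use tle less.prems pz in \<open>auto simp: \<nu>'_def\<close>)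
    have L: "(\<lambda>\<sigma>. t * edge_count p \<sigma> + (\<epsilon> / 2) * edge_count (d v) \<sigma>) \<in> cell_cone (Suc k)"
      by (rule loop_plus_free_cell_cone[OF pG d[OF v] k]) (use tpos less.prems(4) in auto)
    have R: "(\<lambda>\<sigma>. (\<epsilon> / 2) * (\<Sum>u\<in>verts H - {v}. edge_count (d u) \<sigma>)) \<in> cell_cone (Suc k)"
      by (rule dsum) (use less.prems(4) in auto)
    \<comment> \<open>One half of \<open>\<epsilon>\<close> goes to \<open>\<nu>'\<close> by
      induction. Of the other half, the share of \<open>v\<close> is joined with \<open>t\<close>
      times \<open>p\<close>, and the shares of the remaining vertices are realized as they
      are.\<close>
    have "\<nu> \<sigma> + \<epsilon> * (\<Sum>v\<in>verts H. edge_count (d v) \<sigma>) =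
      (\<nu>' \<sigma> + (\<epsilon> / 2) * (\<Sum>v\<in>verts H. edge_count (d v) \<sigma>)) +
      ((t * edge_count p \<sigma> + (\<epsilon> / 2) * edge_count (d v) \<sigma>) +
       (\<epsilon> / 2) * (\<Sum>u\<in>verts H - {v}. edge_count (d u) \<sigma>))" for \<sigma>
      using finV v by (simp add: \<nu>'_def sum.remove[of _ v] field_simps)
    with cell_cone_add[OF IH cell_cone_add[OF L R]] show ?thesis by simp
  qed
qed

text \<open>Positivity on all edges of \<open>H\<close> allows \<open>\<epsilon> * D\<close> to be
  subtracted with a nonnegative flow remaining, where \<open>D\<close> sums one free loop per
  vertex; this multiple is what the realization of the remainder consumes.\<close>

lemma open_face_cell_cone:
  assumes face: "face_subgraph k H" and dr: "driftless k H" and k: "k \<ge> 1" and \<mu>: "\<mu> \<in> open_face (Suc k) H"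
  shows "\<mu> \<in> cell_cone (Suc k)"
proof -
  have sub: "subgraph H (perm_digraph k)" using face by (simp add: face_subgraph_def)
  then interpret H: wf_digraph H by auto
  have aH: "arcs H \<subseteq> perms (Suc k)" using subgraph_permD(2)[OF sub] .
  have finV: "finite (verts H)" using subgraph_permD(1)[OF sub] finite_subset[OF _ finite_perms[of k]] by auto
  have finA: "finite (arcs H)" using aH by (rule finite_subset) simp
  have "\<exists>p. H.awalk v p v \<and> free_loop k v p" if "v \<in> verts H" for v
    by (rule free_loop_exists[OF sub that]) (use dr that in \<open>auto simp: driftless_iff[OF sub]\<close>)
  then obtain d where d: "\<And>v. v \<in> verts H \<Longrightarrow> H.awalk v (d v) v" "\<And>v. v \<in> verts H \<Longrightarrow> free_loop k v (d v)"
    by metis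
  define D where "D \<sigma> = (\<Sum>v\<in>verts H. edge_count (d v) \<sigma>)" for \<sigma>
  have D0: "D \<sigma> = 0" if "\<sigma> \<notin> arcs H" for \<sigma>
    unfolding D_def
  proof (rule sum.neutral, rule ballI)
    fix v assume "v \<in> verts H"
    then have "\<sigma> \<notin> set (d v)" using d(1)[of v] that by (auto simp: H.awalk_def)
    then show "edge_count (d v) \<sigma> = 0" by (simp add: count_notin)
  qed
  have Dnn: "0 \<le> D \<sigma>" for \<sigma> by (simp add: D_def sum_nonneg)
  have Dfl: "flow k D" unfolding D_def using finV d(2)
    by (intro flow_sum) (auto simp: free_loop_def intro: loop_flow)
  have \<mu>nn: "0 \<le> \<mu> \<sigma>" and \<mu>0: "\<sigma> \<notin> arcs H \<Longrightarrow> \<mu> \<sigma> = 0" and \<mu>pos: "\<sigma> \<in> arcs H \<Longrightarrow> 0 < \<mu> \<sigma>" for \<sigma>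
    using \<mu> aH unfolding open_face_def polytope_P_def prob_simplex_def
    by (cases "\<sigma> \<in> perms (Suc k)"; force)+
  have \<mu>fl: "flow k \<mu>" using \<mu> by (auto simp: open_face_def polytope_P_def flow_def)
  obtain \<epsilon> where \<epsilon>: "\<epsilon> > 0" "\<And>\<sigma>. \<epsilon> * D \<sigma> \<le> \<mu> \<sigma>"
  proof (cases "arcs H = {}")
    case True
    then show ?thesis using D0 \<mu>nn by (intro that[of 1]) auto
  next
    case False
    define m where "m = Min (\<mu> ` arcs H)"
    have m: "m > 0" "\<And>\<sigma>. \<sigma> \<in> arcs H \<Longrightarrow> m \<le> \<mu> \<sigma>"
      unfolding m_def using False finA \<mu>pos by (auto simp: Min_gr_iff)
    define M where "M = (\<Sum>\<sigma>\<in>arcs H. D \<sigma>)"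
    have M: "0 \<le> M" "\<And>\<sigma>. \<sigma> \<in> arcs H \<Longrightarrow> D \<sigma> \<le> M"
      unfolding M_def using finA Dnn by (auto intro: sum_nonneg member_le_sum)
    show ?thesis
    \<comment> \<open>On the edges, \<open>m\<close> bounds \<open>\<mu>\<close> from below and
      \<open>M\<close> bounds \<open>D\<close> from above; the added 1 avoids a zero
      denominator.\<close>
    proof (rule that[of "m / (1 + M)"])
      show "m / (1 + M) > 0" using m M by simp
      fix \<sigma>
      show "m / (1 + M) * D \<sigma> \<le> \<mu> \<sigma>"
      proof (cases "\<sigma> \<in> arcs H")
        case True
        have "m * D \<sigma> \<le> m * (1 + M)" using m M(2)[OF True] by (intro mult_left_mono) auto
        then have "m / (1 + M) * D \<sigma> \<le> m" using M(1) by (simp add: field_simps)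
        then show ?thesis using m(2)[OF True] by simp
      next
        case False then show ?thesis using D0 \<mu>nn by simp
      qed
    qed
  qed
  have "(\<lambda>\<sigma>. (\<mu> \<sigma> + (- \<epsilon>) * D \<sigma>) + \<epsilon> * (\<Sum>v\<in>verts H. edge_count (d v) \<sigma>)) \<in> cell_cone (Suc k)"
    by (rule flow_plus_free_cell_cone[OF sub k d(2) flow_add[OF \<mu>fl flow_scale[OF Dfl]]])
      (use \<epsilon> \<mu>0 D0 in auto)
  then show ?thesis by (simp add: D_def)
qed

section \<open>Realization by rotating intervals\<close>

lemma emeasure_lebesgue_plus: "emeasure lebesgue ((+) a ` S) = emeasure lebesgue (S :: real set)"
  using emeasure_lebesgue_affine[of 1 a S] by (simp add: ac_simps cong: image_cong_simp)

lemma sets_unit_leb: "A \<in> sets unit_leb \<longleftrightarrow> A \<subseteq> {0..1} \<and> A \<in> sets lebesgue"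
  by (subst sets_restrict_space_iff) auto

lemma emeasure_unit_leb: "A \<subseteq> {0..1} \<Longrightarrow> emeasure unit_leb A = emeasure lebesgue A"
  by (rule emeasure_restrict_space) auto

lemma measure_unit_leb: "A \<subseteq> {0..1} \<Longrightarrow> measure unit_leb A = measure lebesgue A"
  by (rule measure_restrict_space) auto

lemma AE_lebesgue_neq: "AE x in lebesgue. x \<noteq> (c :: real)"
  by (intro AE_completion AE_lborel_singleton)

text \<open>One angle serves all cells, so after \<open>t\<close> steps the relative position has
  turned by \<open>t * \<alpha>\<close>, whichever cells were visited.\<close>

locale cell_rotation =
  fixes n :: nat and I :: "nat set" and w :: "nat \<Rightarrow> real" and N :: "nat \<Rightarrow> nat" and \<alpha> :: real
  assumes sys: "cell_system n I w N" and total: "sum w I = 1"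
    and \<alpha>: "0 < \<alpha>" "\<alpha> < 1" "\<alpha> \<notin> \<rat>"
begin

lemma finI: "finite I" and bijN: "bij_betw N I I" and wpos: "i \<in> I \<Longrightarrow> 0 < w i"
  and wN: "i \<in> I \<Longrightarrow> w (N i) = w i" and injN: "i \<in> I \<Longrightarrow> inj_on (\<lambda>t. (N ^^ t) i) {..<n}"
  using sys by (auto simp: cell_system_def)

lemma NI: "i \<in> I \<Longrightarrow> N i \<in> I"
  using bijN by (auto dest: bij_betwE)

definition left :: "nat \<Rightarrow> real" where
  "left i = (\<Sum>j\<in>{j \<in> I. j < i}. w j)"

definition cell :: "nat \<Rightarrow> real set" where
  "cell i = {left i..<left i + w i}"

lemma left_nonneg: "0 \<le> left i"
  unfolding left_def by (intro sum_nonneg) (auto intro: less_imp_le[OF wpos])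

lemma left_insert: "i \<in> I \<Longrightarrow> left i + w i = sum w (insert i {j \<in> I. j < i})"
  using finI by (simp add: left_def)

lemma left_mono: "i \<in> I \<Longrightarrow> j \<in> I \<Longrightarrow> i < j \<Longrightarrow> left i + w i \<le> left j"
  unfolding left_insert left_def[of j] using finI wpos by (intro sum_mono2) (auto intro: less_imp_le)

lemma left_top: "i \<in> I \<Longrightarrow> left i + w i \<le> 1"
  unfolding left_insert total[symmetric] using finI wpos by (intro sum_mono2) (auto intro: less_imp_le)

lemma cell_subset: "i \<in> I \<Longrightarrow> cell i \<subseteq> {0..<1}"
  using left_top[of i] left_nonneg[of i] by (auto simp: cell_def)

lemma cell_less:
  assumes "i \<in> I" "j \<in> I" "i < j" "x \<in> cell i" "y \<in> cell j" shows "x < y"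
  using assms left_mono[OF assms(1-3)] by (auto simp: cell_def)

lemma cell_unique:
  assumes "i \<in> I" "j \<in> I" "x \<in> cell i" "x \<in> cell j" shows "i = j"
  using assms cell_less[of i j x x] cell_less[of j i x x] by (metis less_irrefl linorder_neqE_nat)

lemma cell_cover:
  assumes "x \<in> {0..<1}" obtains i where "i \<in> I" "x \<in> cell i"
proof -
  have "I \<noteq> {}" using total by auto
  \<comment> \<open>The cell of \<open>x\<close> is the last one that starts at or before
    \<open>x\<close>. Were \<open>x\<close> beyond its right end, the next cell would also start at
    or before \<open>x\<close>, or, with no next cell, \<open>x\<close> would be at least 1.\<close>
  define J where "J = {i \<in> I. left i \<le> x}"
  have "{j \<in> I. j < Min I} = {}" using Min_le[OF finI] by force
  then have "left (Min I) = 0" by (simp only: left_def sum.empty)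
  then have "Min I \<in> J" using \<open>I \<noteq> {}\<close> finI assms by (simp add: J_def)
  then have mJ: "Max J \<in> J" using finI by (intro Max_in) (auto simp: J_def)
  define i where "i = Max J"
  have i: "i \<in> I" "left i \<le> x" using mJ by (auto simp: i_def J_def)
  have "x < left i + w i"
  proof (rule ccontr)
    assume x: "\<not> x < left i + w i"
    define K where "K = {j \<in> I. i < j}"
    show False
    proof (cases "K = {}")
      case True
      then have "I = insert i {j \<in> I. j < i}" using i(1) by (auto simp: K_def not_less_iff_gr_or_eq)
      then have "left i + w i = 1" using left_insert[OF i(1)] total by simp
      then show False using x assms by simp
    next
      case False
      define j where "j = Min K"
      have fK: "finite K" using finI by (simp add: K_def)
      have jK: "j \<in> K" using Min_in[OF fK False] by (simp add: j_def)
      have "m \<le> i" if "m \<in> I" "m < j" for m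
        using Min_le[OF fK, of m] that by (force simp: j_def K_def)
      then have "{m \<in> I. m < j} = insert i {m \<in> I. m < i}" using jK i(1) by (force simp: K_def)
      then have "left j = left i + w i" using left_insert[OF i(1)] by (simp add: left_def)
      then have "j \<in> J" using x jK by (simp add: J_def K_def)
      then have "j \<le> i" using finI by (auto simp: i_def J_def)
      then show False using jK by (simp add: K_def)
    qed
  qed
  with i that show thesis by (simp add: cell_def)
qed

definition idx :: "real \<Rightarrow> nat" where
  "idx x = (THE i. i \<in> I \<and> x \<in> cell i)"

lemma idx_eq: "i \<in> I \<Longrightarrow> x \<in> cell i \<Longrightarrow> idx x = i"
  unfolding idx_def using cell_unique by blast

definition pos :: "nat \<Rightarrow> real \<Rightarrow> real" where
  "pos i u = left i + w i * u"

text \<open>A step passes to the next cell and rotates the relative position inside it. The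
  half-open cells leave out the point 1, which is sent to 0 so that the unit interval is mapped into
  itself.\<close>

definition f :: "real \<Rightarrow> real" where
  "f x = (if x \<in> {0..<1} then pos (N (idx x)) (frac ((x - left (idx x)) / w (idx x) + \<alpha>)) else 0)"

section \<open>Orbits of the interval map\<close>

lemma pos_cell: "i \<in> I \<Longrightarrow> 0 \<le> u \<Longrightarrow> u < 1 \<Longrightarrow> pos i u \<in> cell i"
  using wpos[of i] mult_less_cancel_left_pos[of "w i" u 1] by (simp add: pos_def cell_def)

lemma cell_posE:
  assumes "i \<in> I" "x \<in> cell i" obtains u where "0 \<le> u" "u < 1" "x = pos i u"
  using assms wpos[of i] by (intro that[of "(x - left i) / w i"]) (auto simp: cell_def pos_def field_simps)

lemma unit_posE:
  assumes "x \<in> {0..<1}" obtains i u where "i \<in> I" "0 \<le> u" "u < 1" "x = pos i u" "idx x = i"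
  using cell_cover[OF assms] cell_posE idx_eq by metis

lemma f_cell:
  assumes "i \<in> I" "x \<in> cell i" shows "f x = pos (N i) (frac ((x - left i) / w i + \<alpha>))"
  using assms cell_subset[OF assms(1)] by (auto simp: f_def idx_eq[OF assms])

lemma f_pos: "i \<in> I \<Longrightarrow> 0 \<le> u \<Longrightarrow> u < 1 \<Longrightarrow> f (pos i u) = pos (N i) (frac (u + \<alpha>))"
  using f_cell[of i "pos i u"] pos_cell[of i u] wpos[of i] by (simp add: pos_def)

lemma frac_unit: "0 \<le> frac x" "frac x < 1"
  by (auto simp: frac_lt_1)

lemma f_iter:
  assumes "i \<in> I" "0 \<le> u" "u < 1"
  shows "(f ^^ t) (pos i u) = pos ((N ^^ t) i) (frac (u + real t * \<alpha>))"
proof (induction t)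
  case 0
  then show ?case using assms by (simp add: frac_eq_id)
next
  case (Suc t)
  have "f (pos ((N ^^ t) i) (frac (u + real t * \<alpha>))) = pos (N ((N ^^ t) i)) (frac (frac (u + real t * \<alpha>) + \<alpha>))"
    by (rule f_pos[OF funpow_in[OF bijN assms(1)] frac_unit])
  then show ?case using Suc by (simp add: algebra_simps)
qed

lemma f_unit: "f x \<in> {0..<1}"
proof (cases "x \<in> {0..<1}")
  case True
  then obtain i u where "i \<in> I" "0 \<le> u" "u < 1" "x = pos i u" by (rule unit_posE)
  then have "N i \<in> I" "f x \<in> cell (N i)" using pos_cell[OF NI frac_unit] by (simp_all add: f_pos NI)
  then show ?thesis using cell_subset by blast
next
  case False then show ?thesis by (simp only: f_def) simp
qed

lemma pos_inj:
  assumes "i \<in> I" "j \<in> I" "0 \<le> u" "u < 1" "0 \<le> v" "v < 1" "pos i u = pos j v"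
  shows "i = j" "u = v"
proof -
  show "i = j" using cell_unique[OF assms(1,2) pos_cell[OF assms(1,3,4)]] pos_cell[OF assms(2,5,6)] assms(7) by simp
  then show "u = v" using assms(7) wpos[OF assms(1)] by (simp add: pos_def)
qed

text \<open>Two equal orbit points have equal relative positions, so a nonzero integer multiple of
  \<open>\<alpha>\<close> would be an integer, which irrationality excludes.\<close>

lemma infinite_orbit_f:
  assumes "x \<in> {0..<1}" shows "infinite_orbit f x"
proof -
  obtain i u where x: "i \<in> I" "0 \<le> u" "u < 1" "x = pos i u" using unit_posE[OF assms] by metis
  have "inj (\<lambda>t. (f ^^ t) x)"
  proof (rule injI)
    fix s t assume "(f ^^ s) x = (f ^^ t) x"
    then have "frac (u + real s * \<alpha>) = frac (u + real t * \<alpha>)"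
      unfolding x(4) f_iter[OF x(1-3)]
      by (rule pos_inj(2)[OF funpow_in[OF bijN x(1)] funpow_in[OF bijN x(1)] frac_unit frac_unit])
    then obtain m :: int where "u + real s * \<alpha> = u + real t * \<alpha> + of_int m"
      by (rule frac_eqE)
    then have m: "(real s - real t) * \<alpha> = of_int m" by (simp add: algebra_simps)
    show "s = t"
    proof (rule ccontr)
      assume "s \<noteq> t"
      then have "\<alpha> = of_int m / (of_int (int s - int t))" using m by (simp add: field_simps)
      also have "\<dots> \<in> \<rat>" by (intro Rats_divide Rats_of_int)
      finally show False using \<alpha>(3) by simp
    qed
  qed
  then show ?thesis unfolding infinite_orbit_def by (rule range_inj_infinite)
qed

text \<open>The first \<open>n\<close> orbit points lie in distinct cells by \<open>injN\<close>, so
  the order of the cells decides, whatever the positions inside them.\<close>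

lemma Order_f:
  assumes "i \<in> I" "x \<in> cell i"
  shows "Order n (\<lambda>t. (f ^^ (t - 1)) x) = cell_pattern n N i"
proof -
  obtain u where u: "0 \<le> u" "u < 1" "x = pos i u" using cell_posE[OF assms] .
  have c: "(f ^^ t) x \<in> cell ((N ^^ t) i)" for t
    unfolding u(3) f_iter[OF assms(1) u(1,2)] by (rule pos_cell[OF funpow_in[OF bijN assms(1)] frac_unit])
  have "(f ^^ s) x < (f ^^ t) x \<longleftrightarrow> (N ^^ s) i < (N ^^ t) i" if "s < n" "t < n" for s t
  proof (cases "s = t")
    case False
    then have ne: "(N ^^ s) i \<noteq> (N ^^ t) i" using injN[OF assms(1)] that by (auto dest: inj_onD)
    have I: "(N ^^ s) i \<in> I" "(N ^^ t) i \<in> I" using funpow_in[OF bijN assms(1)] by auto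
    show ?thesis
      using cell_less[OF I _ c c] cell_less[OF I(2,1) _ c c] ne by (metis less_asym linorder_neqE_nat)
  qed simp
  then show ?thesis unfolding cell_pattern_def by (intro Order_cong) auto
qed

text \<open>On a cell the map consists of two translations, one before and one after the rotation
  wraps around, and their images partition the next cell, which has the same length.\<close>

lemma cell_preimage:
  assumes i: "i \<in> I" and S: "S \<in> sets lebesgue"
  shows "{x \<in> cell i. f x \<in> S} \<in> sets lebesgue"
    and "emeasure lebesgue {x \<in> cell i. f x \<in> S} = emeasure lebesgue (S \<inter> cell (N i))"
proof -
  define a where "a = left i"
  define b where "b = left (N i)"
  define h where "h = w i"
  have h: "h > 0" using wpos[OF i] by (simp add: h_def)
  \<comment> \<open>The translation of the points that do not wrap; the others move by
    \<open>d - h\<close>.\<close>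
  define d where "d = b - a + h * \<alpha>"
  have cells: "cell i = {a..<a + h}" "cell (N i) = {b..<b + h}"
    using wN[OF i] by (auto simp: cell_def a_def b_def h_def)
  have h\<alpha>: "0 < h * \<alpha>" "h * \<alpha> < h" using h \<alpha> by auto
  have F: "f x = b + h * frac ((x - a) / h + \<alpha>)" if "x \<in> cell i" for x
    using f_cell[OF i that] wN[OF i] by (simp add: pos_def a_def b_def h_def)
  have low: "f x = x + d" if "x \<in> {a..<a + h - h * \<alpha>}" for x
  proof -
    have "x \<in> cell i" using that h\<alpha> by (auto simp: cells)
    moreover have "frac ((x - a) / h + \<alpha>) = (x - a) / h + \<alpha>"
    proof (rule frac_eq_id)
      have "0 \<le> (x - a) / h" "(x - a) / h < 1 - \<alpha>" using that h by (auto simp: field_simps)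
      then show "(x - a) / h + \<alpha> \<in> {0..<1}" using \<alpha> by simp
    qed
    ultimately have "f x = b + h * ((x - a) / h + \<alpha>)" using F by simp
    then show ?thesis using h by (simp add: d_def distrib_left)
  qed
  have high: "f x = x + (d - h)" if "x \<in> {a + h - h * \<alpha>..<a + h}" for x
  proof -
    have "x \<in> cell i" using that h\<alpha> by (auto simp: cells)
    moreover have "frac ((x - a) / h + \<alpha>) = (x - a) / h + \<alpha> - 1"
    proof -
      have "(x - a) / h < 1" "0 \<le> (x - a) / h + \<alpha> - 1" using that h by (auto simp: field_simps)
      then show ?thesis using \<alpha> by (simp add: frac_unique_iff)
    qed
    ultimately have "f x = b + h * ((x - a) / h + \<alpha> - 1)" using F by simp
    also have "\<dots> = b + (x - a) + h * \<alpha> - h" using h by (simp add: field_simps)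
    finally show ?thesis by (simp add: d_def)
  qed
  \<comment> \<open>\<open>Q0\<close> and \<open>Q1\<close> are the parts of the target reached
    without and with wrapping: they lie in the upper and the lower piece of the next cell.\<close>
  define Q0 where "Q0 = S \<inter> {b + h * \<alpha>..<b + h}"
  define Q1 where "Q1 = S \<inter> {b..<b + h * \<alpha>}"
  have Q: "Q0 \<in> sets lebesgue" "Q1 \<in> sets lebesgue" using S by (auto simp: Q0_def Q1_def)
  have A0: "{x \<in> {a..<a + h - h * \<alpha>}. f x \<in> S} = (+) (- d) ` Q0"
  proof (intro set_eqI iffI)
    fix x assume x: "x \<in> {x \<in> {a..<a + h - h * \<alpha>}. f x \<in> S}"
    then have "x + d \<in> Q0" using low[of x] by (auto simp: Q0_def d_def)
    then show "x \<in> (+) (- d) ` Q0" by (intro image_eqI[of _ _ "x + d"]) auto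
  next
    fix x assume "x \<in> (+) (- d) ` Q0"
    then have "x + d \<in> Q0" by auto
    then show "x \<in> {x \<in> {a..<a + h - h * \<alpha>}. f x \<in> S}" using low[of x] by (auto simp: Q0_def d_def)
  qed
  have A1: "{x \<in> {a + h - h * \<alpha>..<a + h}. f x \<in> S} = (+) (- (d - h)) ` Q1"
  proof (intro set_eqI iffI)
    fix x assume x: "x \<in> {x \<in> {a + h - h * \<alpha>..<a + h}. f x \<in> S}"
    then have "x + (d - h) \<in> Q1" using high[of x] by (auto simp: Q1_def d_def)
    then show "x \<in> (+) (- (d - h)) ` Q1" by (intro image_eqI[of _ _ "x + (d - h)"]) auto
  next
    fix x assume "x \<in> (+) (- (d - h)) ` Q1"
    then have "x + (d - h) \<in> Q1" by auto
    then show "x \<in> {x \<in> {a + h - h * \<alpha>..<a + h}. f x \<in> S}" using high[of x] by (auto simp: Q1_def d_def)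
  qed
  have un: "{x \<in> cell i. f x \<in> S} = (+) (- d) ` Q0 \<union> (+) (- (d - h)) ` Q1"
    unfolding A0[symmetric] A1[symmetric] cells using h\<alpha> by auto
  have meas: "(+) (- d) ` Q0 \<in> sets lebesgue" "(+) (- (d - h)) ` Q1 \<in> sets lebesgue"
    by (intro lebesgue_sets_translation Q)+
  then show "{x \<in> cell i. f x \<in> S} \<in> sets lebesgue" unfolding un by auto
  have "(+) (- d) ` Q0 \<inter> (+) (- (d - h)) ` Q1 = {}" unfolding A0[symmetric] A1[symmetric] by auto
  then have "emeasure lebesgue {x \<in> cell i. f x \<in> S} = emeasure lebesgue Q0 + emeasure lebesgue Q1"
    unfolding un using plus_emeasure[OF meas] by (simp only: emeasure_lebesgue_plus)
  also have "\<dots> = emeasure lebesgue (Q0 \<union> Q1)"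
    using Q by (intro plus_emeasure) (auto simp: Q0_def Q1_def)
  also have "Q0 \<union> Q1 = S \<inter> cell (N i)" using h\<alpha> by (auto simp: Q0_def Q1_def cells)
  finally show "emeasure lebesgue {x \<in> cell i. f x \<in> S} = emeasure lebesgue (S \<inter> cell (N i))" .
qed

lemma cell_disjoint: "disjoint_family_on (\<lambda>i. A i \<inter> cell i) I"
  unfolding disjoint_family_on_def using cell_unique by blast

lemma unit_preimage:
  assumes S: "S \<in> sets lebesgue"
  shows "{x \<in> {0..<1}. f x \<in> S} \<in> sets lebesgue"
    and "emeasure lebesgue {x \<in> {0..<1}. f x \<in> S} = emeasure lebesgue (S \<inter> {0..<1})"
proof -
  have cov: "{0..<1} = (\<Union>i\<in>I. cell i)"
  proof
    show "{0..<1} \<subseteq> (\<Union>i\<in>I. cell i)"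
    proof
      fix x :: real assume "x \<in> {0..<1}"
      then show "x \<in> (\<Union>i\<in>I. cell i)" by (rule cell_cover) blast
    qed
    show "(\<Union>i\<in>I. cell i) \<subseteq> {0..<1}" using cell_subset by (intro UN_least)
  qed
  have un: "{x \<in> {0..<1}. f x \<in> S} = (\<Union>i\<in>I. {x \<in> cell i. f x \<in> S})" unfolding cov by auto
  have un2: "S \<inter> {0..<1} = (\<Union>i\<in>I. S \<inter> cell i)" unfolding cov by auto
  have dis: "disjoint_family_on (\<lambda>i. {x \<in> cell i. f x \<in> S}) I"
    unfolding disjoint_family_on_def
  proof (intro ballI impI)
    fix i j assume "i \<in> I" "j \<in> I" "i \<noteq> j"
    then show "{x \<in> cell i. f x \<in> S} \<inter> {x \<in> cell j. f x \<in> S} = {}" using cell_unique[of i j] by auto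
  qed
  show "{x \<in> {0..<1}. f x \<in> S} \<in> sets lebesgue"
    unfolding un using finI cell_preimage(1)[OF _ S] by (intro sets.finite_UN) auto
  have "emeasure lebesgue {x \<in> {0..<1}. f x \<in> S} = (\<Sum>i\<in>I. emeasure lebesgue {x \<in> cell i. f x \<in> S})"
    unfolding un using finI cell_preimage(1)[OF _ S] dis by (intro sum_emeasure[symmetric]) auto
  also have "\<dots> = (\<Sum>i\<in>I. emeasure lebesgue (S \<inter> cell (N i)))"
    using cell_preimage(2)[OF _ S] by (intro sum.cong) auto
  also have "\<dots> = (\<Sum>i\<in>I. emeasure lebesgue (S \<inter> cell i))"
    by (rule sum.reindex_bij_betw[OF bijN])
  also have "\<dots> = emeasure lebesgue (S \<inter> {0..<1})"
    unfolding un2 using finI S cell_disjoint[of "\<lambda>_. S"] by (intro sum_emeasure) (auto simp: cell_def)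
  finally show "emeasure lebesgue {x \<in> {0..<1}. f x \<in> S} = emeasure lebesgue (S \<inter> {0..<1})" .
qed

lemma f_maps_A_mp: "f \<in> maps_A_mp"
proof -
  have into: "f \<in> {0..1} \<rightarrow> {0..1}" using f_unit by (auto simp: less_imp_le)
  have "AE x in unit_leb. infinite_orbit f x"
  proof (subst AE_restrict_space_iff)
    show "AE x in lebesgue. x \<in> {0..1} \<longrightarrow> infinite_orbit f x"
      using AE_lebesgue_neq[of 1] by eventually_elim (auto intro!: infinite_orbit_f)
  qed simp
  with into have A: "f \<in> maps_A" by (simp add: maps_A_def)
  have pre: "f -` S \<inter> {0..1} \<in> sets unit_leb \<and> emeasure unit_leb (f -` S \<inter> {0..1}) = emeasure unit_leb S"
    if "S \<in> sets unit_leb" for S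
  proof -
    have S: "S \<subseteq> {0..1}" "S \<in> sets lebesgue" using that by (auto simp: sets_unit_leb)
    have eq: "f -` S \<inter> {0..1} = {x \<in> {0..<1}. f x \<in> S} \<union> (if f 1 \<in> S then {1} else {})"
      by (auto intro: le_neq_trans)
    have m: "f -` S \<inter> {0..1} \<in> sets lebesgue" unfolding eq using unit_preimage(1)[OF S(2)] by (intro sets.Un) auto
    have "emeasure lebesgue (f -` S \<inter> {0..1}) = emeasure lebesgue {x \<in> {0..<1}. f x \<in> S}"
      by (rule emeasure_eq_AE[OF _ m unit_preimage(1)[OF S(2)]])
        (use AE_lebesgue_neq[of 1] in \<open>eventually_elim, auto\<close>)
    also have "\<dots> = emeasure lebesgue (S \<inter> {0..<1})" by (rule unit_preimage(2)[OF S(2)])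
    also have "\<dots> = emeasure lebesgue S"
    proof (rule emeasure_eq_AE)
      show "AE x in lebesgue. x \<in> S \<inter> {0..<1} \<longleftrightarrow> x \<in> S"
        using AE_lebesgue_neq[of 1] by eventually_elim (use S in auto)
    qed (use S in auto)
    finally show ?thesis using m S by (simp add: sets_unit_leb emeasure_unit_leb)
  qed
  then have "f \<in> measurable unit_leb unit_leb"
    using into by (intro measurableI) auto
  with A pre show ?thesis by (simp add: maps_A_mp_def)
qed

lemma pattern_dist_f: "pattern_dist n f = cell_dist n I w N"
proof
  fix \<sigma>
  define B where "B = {x \<in> {0..1}. infinite_orbit f x \<and> Order n (\<lambda>t. (f ^^ (t - 1)) x) = \<sigma>}"
  define J where "J = {i \<in> I. cell_pattern n N i = \<sigma>}"
  have J: "finite J" "J \<subseteq> I" using finI by (auto simp: J_def)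
  have BJ: "x \<in> B \<longleftrightarrow> x \<in> (\<Union>i\<in>J. cell i)" if x: "x \<in> {0..<1}" for x
  proof -
    obtain i where i: "i \<in> I" "x \<in> cell i" using cell_cover[OF x] .
    have "x \<in> B \<longleftrightarrow> cell_pattern n N i = \<sigma>"
      using x Order_f[OF i] infinite_orbit_f[OF x] by (auto simp: B_def)
    also have "\<dots> \<longleftrightarrow> x \<in> (\<Union>i\<in>J. cell i)" using i cell_unique by (fastforce simp: J_def)
    finally show ?thesis .
  qed
  have UJ: "(\<Union>i\<in>J. cell i) \<subseteq> {0..<1}" using J cell_subset by blast
  have mJ: "(\<Union>i\<in>J. cell i) \<in> sets lebesgue" using J by (intro sets.finite_UN) (auto simp: cell_def)
  have "B \<subseteq> {0..1}" by (auto simp: B_def)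
  have eqx: "x \<in> B \<longleftrightarrow> x \<in> (\<Union>i\<in>J. cell i)" if "x \<noteq> 1" for x
  proof (cases "x \<in> {0..<1}")
    case True then show ?thesis by (rule BJ)
  next
    case False
    then have "x \<notin> {0..1}" using that by (cases x "1 :: real" rule: linorder_cases) auto
    then show ?thesis using False UJ \<open>B \<subseteq> {0..1}\<close> by blast
  qed
  have mB: "B \<in> sets lebesgue"
  proof (cases "1 \<in> B")
    case True
    then have "B = (\<Union>i\<in>J. cell i) \<union> {1}"
      by (intro set_eqI) (metis eqx Un_iff singleton_iff)
    then show ?thesis using sets.Un[OF mJ, of "{1}"] by simp
  next
    case False
    have "1 \<notin> (\<Union>i\<in>J. cell i)" using UJ by auto
    with False have "B = (\<Union>i\<in>J. cell i)" by (intro set_eqI) (metis eqx)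
    then show ?thesis using mJ by simp
  qed
  have "pattern_dist n f \<sigma> = measure lebesgue B"
    unfolding pattern_dist_def B_def[symmetric] by (rule measure_unit_leb[OF \<open>B \<subseteq> {0..1}\<close>])
  also have "\<dots> = measure lebesgue (\<Union>i\<in>J. cell i)"
  proof (rule measure_eq_AE[OF _ mB mJ])
    show "AE x in lebesgue. x \<in> B \<longleftrightarrow> x \<in> (\<Union>i\<in>J. cell i)"
      using AE_lebesgue_neq[of 1] by eventually_elim (rule eqx)
  qed
  also have "\<dots> = (\<Sum>i\<in>J. measure lebesgue (cell i))"
  proof (rule measure_finite_Union[OF J(1)])
    show "cell ` J \<subseteq> sets lebesgue" by (auto simp: cell_def)
    show "disjoint_family_on cell J"
      using cell_disjoint[of "\<lambda>_. UNIV"] disjoint_family_on_mono[OF J(2)] by simp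
    fix i assume "i \<in> J"
    then have "0 \<le> w i" using J(2) wpos[of i] by auto
    then show "emeasure lebesgue (cell i) \<noteq> \<infinity>" by (simp add: cell_def)
  qed
  also have "\<dots> = (\<Sum>i\<in>J. w i)"
    using J wpos by (intro sum.cong) (auto simp: cell_def measure_completion less_imp_le)
  also have "\<dots> = cell_dist n I w N \<sigma>"
    unfolding cell_dist_def J_def using finI by (simp add: sum.inter_filter)
  finally show "pattern_dist n f \<sigma> = cell_dist n I w N \<sigma>" .
qed

end

lemma cell_cone_realizable:
  assumes "\<mu> \<in> cell_cone n" "\<And>\<sigma>. \<sigma> \<notin> perms n \<Longrightarrow> \<mu> \<sigma> = 0" "(\<Sum>\<sigma>\<in>perms n. \<mu> \<sigma>) = 1"
  shows "\<mu> \<in> pattern_dist n ` maps_A_mp"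
proof -
  obtain I w N where s: "cell_system n I w N" "\<mu> = cell_dist n I w N"
    using assms(1) by (auto simp: cell_cone_def)
  have pat: "cell_pattern n N i \<in> perms n" if "i \<in> I" for i
    unfolding cell_pattern_def
  proof (rule Order(1), rule inj_onI)
    fix a b assume ab: "a \<in> {1..n}" "b \<in> {1..n}" "(N ^^ (a - 1)) i = (N ^^ (b - 1)) i"
    have "inj_on (\<lambda>t. (N ^^ t) i) {..<n}" using s(1) that by (simp add: cell_system_def)
    then have "a - 1 = b - 1" using ab by (auto dest!: inj_onD[of _ _ "a - 1" "b - 1"])
    then show "a = b" using ab by auto
  qed
  have "(\<Sum>\<sigma>\<in>perms n. \<mu> \<sigma>) = (\<Sum>i\<in>I. \<Sum>\<sigma>\<in>perms n. if cell_pattern n N i = \<sigma> then w i else 0)"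
    unfolding s(2) cell_dist_def by (rule sum.swap)
  also have "\<dots> = sum w I" using pat by (intro sum.cong) (auto simp: sum.delta')
  finally have tot: "sum w I = 1" using assms(3) by simp
  have "uncountable {0<..<1 :: real}" by (rule uncountable_open_interval[THEN iffD2]) simp
  then have "\<not> {0<..<1 :: real} \<subseteq> \<rat>" using countable_rat countable_subset by blast
  then obtain \<alpha> :: real where "\<alpha> \<in> {0<..<1}" "\<alpha> \<notin> \<rat>" by blast
  then have "0 < \<alpha>" "\<alpha> < 1" "\<alpha> \<notin> \<rat>" by auto
  then interpret cell_rotation n I w N \<alpha> using s(1) tot by unfold_locales
  show ?thesis using pattern_dist_f f_maps_A_mp s(2) by (metis imageI)
qed

section \<open>Recurrence and the support graph\<close>

text \<open>A coincidence at times \<open>i < j\<close> makes the orbit eventually periodic, so its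
  first \<open>j\<close> points exhaust it.\<close>

lemma infinite_orbit_iff: "infinite_orbit f x \<longleftrightarrow> inj (\<lambda>t. (f ^^ t) x)"
proof
  assume inf: "infinite_orbit f x"
  have ne: "(f ^^ i) x \<noteq> (f ^^ j) x" if ij: "i < j" for i j
  proof
    assume eq: "(f ^^ i) x = (f ^^ j) x"
    have "(f ^^ t) x \<in> (\<lambda>s. (f ^^ s) x) ` {..<j}" for t
    proof (induction t rule: less_induct)
      case (less t)
      show ?case
      proof (cases "t < j")
        case False
        then have "(f ^^ t) x = (f ^^ (t - j)) ((f ^^ j) x)" by (simp add: funpow_add[symmetric, THEN fun_cong, unfolded comp_def])
        also have "\<dots> = (f ^^ (t - j + i)) x" unfolding eq[symmetric] by (simp add: funpow_add)
        finally show ?thesis using less[of "t - j + i"] ij False by simp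
      qed auto
    qed
    then have "range (\<lambda>t. (f ^^ t) x) \<subseteq> (\<lambda>s. (f ^^ s) x) ` {..<j}" by blast
    then show False using inf finite_subset unfolding infinite_orbit_def by blast
  qed
  show "inj (\<lambda>t. (f ^^ t) x)"
    by (rule injI) (metis ne linorder_neqE_nat)
next
  assume "inj (\<lambda>t. (f ^^ t) x)"
  then show "infinite_orbit f x" unfolding infinite_orbit_def by (rule range_inj_infinite)
qed

lemma infinite_orbit_eq_iff: "infinite_orbit f x \<Longrightarrow> (f ^^ i) x = (f ^^ j) x \<longleftrightarrow> i = j"
  by (auto simp: infinite_orbit_iff dest: injD)

definition orbit_pattern :: "nat \<Rightarrow> (real \<Rightarrow> real) \<Rightarrow> real \<Rightarrow> nat \<Rightarrow> nat" where
  "orbit_pattern m f x = Order m (\<lambda>i. (f ^^ (i - 1)) x)"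

lemma orbit_inj_on: "infinite_orbit f x \<Longrightarrow> inj_on (\<lambda>i. (f ^^ (i - 1)) x) {1..m}"
  by (auto intro!: inj_onI simp: infinite_orbit_eq_iff)

lemma orbit_pattern_perms: "infinite_orbit f x \<Longrightarrow> orbit_pattern m f x \<in> perms m"
  unfolding orbit_pattern_def by (rule Order(1)[OF orbit_inj_on])

lemma infinite_orbit_step: "infinite_orbit f (f x) \<longleftrightarrow> infinite_orbit f x"
proof -
  have "range (\<lambda>t. (f ^^ t) x) = insert x (range (\<lambda>t. (f ^^ t) (f x)))"
  proof (intro set_eqI iffI)
    fix y assume "y \<in> range (\<lambda>t. (f ^^ t) x)"
    then obtain t where "y = (f ^^ t) x" by auto
    then show "y \<in> insert x (range (\<lambda>t. (f ^^ t) (f x)))" by (cases t) (auto simp: funpow_swap1)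
  next
    fix y assume "y \<in> insert x (range (\<lambda>t. (f ^^ t) (f x)))"
    then consider "y = x" | t where "y = (f ^^ t) (f x)" by auto
    then show "y \<in> range (\<lambda>t. (f ^^ t) x)"
    proof cases
      case 1 then show ?thesis by (intro image_eqI[of _ _ 0]) auto
    next
      case 2 then show ?thesis by (intro image_eqI[of _ _ "Suc t"]) (auto simp: funpow_swap1)
    qed
  qed
  then show ?thesis by (simp add: infinite_orbit_def)
qed

lemma infinite_orbit_iter: "infinite_orbit f ((f ^^ t) x) \<longleftrightarrow> infinite_orbit f x"
  by (induction t) (auto simp: infinite_orbit_step)

lemma orbit_pattern_step:
  assumes "infinite_orbit f x"
  shows "\<rho> k (orbit_pattern (Suc k) f x) = orbit_pattern k f x"
    "\<rho>' k (orbit_pattern (Suc k) f x) = orbit_pattern k f (f x)"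
proof -
  show "\<rho> k (orbit_pattern (Suc k) f x) = orbit_pattern k f x"
    unfolding orbit_pattern_def by (rule rho_Order(1)[OF orbit_inj_on[OF assms]])
  have "(f ^^ i) x = (f ^^ (i - 1)) (f x)" if "i \<ge> 1" for i
    using that by (cases i) (auto simp: funpow_swap1)
  then show "\<rho>' k (orbit_pattern (Suc k) f x) = orbit_pattern k f (f x)"
    unfolding orbit_pattern_def rho_Order(2)[OF orbit_inj_on[OF assms]] by (intro Order_cong) auto
qed

lemma orbit_window:
  assumes "infinite_orbit f x"
  shows "map (\<lambda>a. Order (Suc k) (\<lambda>i. (f ^^ (a + i - 1)) x)) [0..<m] =
      map (\<lambda>a. orbit_pattern (Suc k) f ((f ^^ a) x)) [0..<m]"
    and "Order k (\<lambda>i. (f ^^ (m + i - 1)) x) = orbit_pattern k f ((f ^^ m) x)"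
proof -
  have *: "Order l (\<lambda>i. (f ^^ (a + i - 1)) x) = orbit_pattern l f ((f ^^ a) x)" for a l
    unfolding orbit_pattern_def
  proof (rule Order_cong)
    have e: "(f ^^ (a + i - 1)) x = (f ^^ (i - 1)) ((f ^^ a) x)" if "i \<in> {1..l}" for i
    proof -
      have "a + i - 1 = (i - 1) + a" using that by auto
      then show ?thesis by (simp only: funpow_add comp_apply)
    qed
    fix i j assume "i \<in> {1..l}" "j \<in> {1..l}"
    then show "(f ^^ (a + i - 1)) x < (f ^^ (a + j - 1)) x \<longleftrightarrow>
      (f ^^ (i - 1)) ((f ^^ a) x) < (f ^^ (j - 1)) ((f ^^ a) x)" using e by simp
  qed
  then show "map (\<lambda>a. Order (Suc k) (\<lambda>i. (f ^^ (a + i - 1)) x)) [0..<m] =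
      map (\<lambda>a. orbit_pattern (Suc k) f ((f ^^ a) x)) [0..<m]"
    and "Order k (\<lambda>i. (f ^^ (m + i - 1)) x) = orbit_pattern k f ((f ^^ m) x)" by auto
qed

text \<open>An orbit traces a walk and realizes it by its own values, which transfers poset
  relations of loops to inequalities between orbit points.\<close>

lemma orbit_path:
  assumes "infinite_orbit f x"
  shows "perm_digraph.awalk k (orbit_pattern k f x) (map (\<lambda>a. orbit_pattern (Suc k) f ((f ^^ a) x)) [0..<m])
      (orbit_pattern k f ((f ^^ m) x))"
    and "fits k (\<lambda>i. (f ^^ (i - 1)) x) (orbit_pattern k f x)
      (map (\<lambda>a. orbit_pattern (Suc k) f ((f ^^ a) x)) [0..<m])"
proof -
  have inj: "inj_on (\<lambda>i. (f ^^ (a + i - 1)) x) {1..l}" for a l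
    by (auto intro!: inj_onI simp: infinite_orbit_eq_iff[OF assms])
  note w = window_walk[where z = "\<lambda>i. (f ^^ (i - 1)) x" and k = k and m = m, OF inj inj,
      unfolded orbit_window[OF assms]]
  show "perm_digraph.awalk k (orbit_pattern k f x) (map (\<lambda>a. orbit_pattern (Suc k) f ((f ^^ a) x)) [0..<m])
      (orbit_pattern k f ((f ^^ m) x))"
    "fits k (\<lambda>i. (f ^^ (i - 1)) x) (orbit_pattern k f x)
      (map (\<lambda>a. orbit_pattern (Suc k) f ((f ^^ a) x)) [0..<m])"
    using w unfolding orbit_pattern_def[of k f x] by blast+
qed

section \<open>Invariant measure and recurrence\<close>

locale mp_map =
  fixes f :: "real \<Rightarrow> real"
  assumes f: "f \<in> maps_A_mp"
begin

lemma f_meas: "f \<in> measurable unit_leb unit_leb"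
  and f_pres: "S \<in> sets unit_leb \<Longrightarrow> emeasure unit_leb (f -` S \<inter> {0..1}) = emeasure unit_leb S"
  and f_AE: "AE x in unit_leb. infinite_orbit f x"
  using f by (auto simp: maps_A_mp_def maps_A_def)

lemma f_in: "x \<in> {0..1} \<Longrightarrow> f x \<in> {0..1}"
  using f by (auto simp: maps_A_mp_def maps_A_def)

lemma fin: "finite_measure unit_leb"
  by (rule finite_measure_lebesgue_on) simp

lemma iter_meas: "f ^^ t \<in> measurable unit_leb unit_leb"
proof (induction t)
  case (Suc t)
  then show ?case using measurable_comp[OF Suc f_meas] by (simp add: comp_def)
qed (simp add: id_def)

lemma iter_in: "x \<in> {0..1} \<Longrightarrow> (f ^^ t) x \<in> {0..1}"
  by (induction t) (use f_in in auto)

lemma iter_borel [measurable]: "f ^^ t \<in> borel_measurable unit_leb"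
proof -
  have "(\<lambda>x. x) \<in> borel_measurable unit_leb"
    by (intro measurable_restrict_space1 measurable_completion) simp
  from measurable_compose[OF iter_meas this] show ?thesis by simp
qed

lemma iter_pres: "S \<in> sets unit_leb \<Longrightarrow> emeasure unit_leb ((f ^^ t) -` S \<inter> {0..1}) = emeasure unit_leb S"
proof (induction t arbitrary: S)
  case 0
  then show ?case by (simp add: sets_unit_leb Int_absorb2)
next
  case (Suc t)
  have S': "f -` S \<inter> {0..1} \<in> sets unit_leb" using measurable_sets[OF f_meas Suc.prems] by simp
  have "(f ^^ Suc t) -` S \<inter> {0..1} = (f ^^ t) -` (f -` S \<inter> {0..1}) \<inter> {0..1}"
    using iter_in by auto
  then show ?case using Suc.IH[OF S'] f_pres[OF Suc.prems] by (simp only:)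
qed

lemma AE_iter:
  assumes "AE x in unit_leb. P x" shows "AE x in unit_leb. \<forall>t. P ((f ^^ t) x)"
  unfolding AE_all_countable
proof
  fix t
  obtain Z where Z: "Z \<in> null_sets unit_leb" "{x \<in> space unit_leb. \<not> P x} \<subseteq> Z"
    using assms by (auto simp: eventually_ae_filter)
  have "(f ^^ t) -` Z \<inter> {0..1} \<in> null_sets unit_leb"
    using Z(1) iter_pres[of Z t] measurable_sets[OF iter_meas, of Z t] by (auto simp: null_sets_def)
  then show "AE x in unit_leb. P ((f ^^ t) x)"
    by (rule AE_I') (use Z(2) iter_in in auto)
qed

text \<open>\<open>U m\<close> collects the points that visit \<open>B\<close> at time
  \<open>m\<close> or later. These sets decrease and each is the preimage of the preceding one, so
  on a finite measure space all have the same measure and differ by null sets; \<open>B\<close> lies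
  in \<open>U 0\<close>.\<close>

lemma recurrence:
  assumes B: "B \<in> sets unit_leb"
  shows "AE x in unit_leb. x \<in> B \<longrightarrow> (\<forall>m. \<exists>t\<ge>m. (f ^^ t) x \<in> B)"
proof -
  interpret finite_measure unit_leb by (rule fin)
  define U where "U m = {x \<in> {0..1}. \<exists>t\<ge>m. (f ^^ t) x \<in> B}" for m
  have U_eq: "U m = (\<Union>t\<in>{m..}. (f ^^ t) -` B \<inter> space unit_leb)" for m by (auto simp: U_def)
  have Um: "U m \<in> sets unit_leb" for m
    unfolding U_eq using measurable_sets[OF iter_meas B] by (intro sets.countable_UN') auto
  have step: "U (Suc m) = f -` U m \<inter> {0..1}" for m
  proof (intro set_eqI iffI)
    fix x assume "x \<in> U (Suc m)"
    then obtain t where t: "x \<in> {0..1}" "Suc m \<le> t" "(f ^^ t) x \<in> B" by (auto simp: U_def)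
    then have "(f ^^ (t - 1)) (f x) \<in> B" by (cases t) (auto simp: funpow_swap1)
    moreover have "m \<le> t - 1" using t(2) by simp
    ultimately show "x \<in> f -` U m \<inter> {0..1}" using t(1) f_in unfolding U_def by blast
  next
    fix x assume "x \<in> f -` U m \<inter> {0..1}"
    then obtain t where t: "x \<in> {0..1}" "m \<le> t" "(f ^^ t) (f x) \<in> B" by (auto simp: U_def)
    then have "(f ^^ Suc t) x \<in> B" by (simp add: funpow_swap1)
    then show "x \<in> U (Suc m)" using t unfolding U_def by (metis (mono_tags, lifting) Suc_le_mono mem_Collect_eq)
  qed
  have em: "emeasure unit_leb (U m) = emeasure unit_leb (U 0)" for m
    by (induction m) (use f_pres[OF Um] in \<open>auto simp: step\<close>)
  have "AE x in unit_leb. x \<in> U 0 \<longrightarrow> x \<in> U m" for m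
  proof -
    have "U m \<subseteq> U 0" by (auto simp: U_def)
    then have "emeasure unit_leb (U 0 - U m) = 0"
      using Um em[of m] emeasure_Diff[of unit_leb "U m" "U 0"] by simp
    then have "U 0 - U m \<in> null_sets unit_leb" using Um by (auto simp: null_sets_def)
    then have "AE x in unit_leb. x \<notin> U 0 - U m" by (rule AE_not_in)
    then show ?thesis by eventually_elim auto
  qed
  then have "AE x in unit_leb. \<forall>m. x \<in> U 0 \<longrightarrow> x \<in> U m" unfolding AE_all_countable by blast
  then show ?thesis
  proof eventually_elim
    case (elim x)
    show ?case
    proof
      assume "x \<in> B"
      moreover have "x \<in> {0..1}" using \<open>x \<in> B\<close> B by (auto simp: sets_unit_leb)
      ultimately have "x \<in> U 0" unfolding U_def by (auto intro: exI[of _ 0])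
      then show "\<forall>m. \<exists>t\<ge>m. (f ^^ t) x \<in> B" using elim by (auto simp: U_def)
    qed
  qed
qed

text \<open>
  A function that grows at every return to \<open>A\<close> cannot come back below a rational separating two of
  its values, which contradicts recurrence.
\<close>

lemma increasing_at_returns_null:
  fixes g :: "real \<Rightarrow> real"
  assumes A: "A \<in> sets unit_leb" and g [measurable]: "g \<in> borel_measurable unit_leb"
    and inc: "AE x in unit_leb. x \<in> A \<longrightarrow> (\<forall>t\<ge>1. (f ^^ t) x \<in> A \<longrightarrow> g x < g ((f ^^ t) x))"
  shows "emeasure unit_leb A = 0"
proof -
  have Bq: "{x \<in> A. g x < of_rat q} \<in> sets unit_leb" for q
  proof -
    have "{x \<in> space unit_leb. g x < of_rat q} \<in> sets unit_leb" by measurable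
    then have "A \<inter> {x \<in> space unit_leb. g x < of_rat q} \<in> sets unit_leb" using A by auto
    moreover have "A \<inter> {x \<in> space unit_leb. g x < of_rat q} = {x \<in> A. g x < of_rat q}"
      using A by (auto simp: sets_unit_leb)
    ultimately show ?thesis by simp
  qed
  have "AE x in unit_leb. \<forall>q. x \<in> {x \<in> A. g x < of_rat q} \<longrightarrow>
      (\<forall>m. \<exists>t\<ge>m. (f ^^ t) x \<in> {x \<in> A. g x < of_rat q})"
    unfolding AE_all_countable using recurrence[OF Bq] by blast
  with AE_iter[OF inc] recurrence[OF A] have "AE x in unit_leb. x \<notin> A"
  proof eventually_elim
    case (elim x)
    show ?case
    proof
      assume x: "x \<in> A"
      then obtain t where t: "t \<ge> 1" "(f ^^ t) x \<in> A" using elim(2) by blast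
      then have "g x < g ((f ^^ t) x)" using elim(1)[rule_format, of 0] x by simp
      then obtain q where q: "g x < of_rat q" "of_rat q < g ((f ^^ t) x)"
        using of_rat_dense by blast
      \<comment> \<open>Recurrence to the sublevel set of \<open>q\<close> happens at some time
        after \<open>t\<close>, whereas every return to \<open>A\<close> after time \<open>t\<close>
        has a value above that at time \<open>t\<close>, hence above \<open>q\<close>.\<close>
      then obtain s where s: "s \<ge> Suc t" "(f ^^ s) x \<in> A" "g ((f ^^ s) x) < of_rat q"
        using elim(3) x by blast
      have "(f ^^ (s - t)) ((f ^^ t) x) = (f ^^ s) x"
        using s(1) by (simp add: funpow_add[symmetric, THEN fun_cong, unfolded comp_def])
      then have "g ((f ^^ t) x) < g ((f ^^ s) x)"
        using elim(1)[rule_format, of t "s - t"] t(2) s by simp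
      then show False using q s by simp
    qed
  qed
  then show ?thesis using A by (subst (asm) AE_iff_measurable[OF A]) (auto simp: sets_unit_leb)
qed

section \<open>Pattern distributions as normalized flows\<close>

definition patset :: "nat \<Rightarrow> (nat \<Rightarrow> nat) \<Rightarrow> real set" where
  "patset m \<tau> = {x \<in> {0..1}. infinite_orbit f x \<and> orbit_pattern m f x = \<tau>}"

lemma preimage_patset:
  "f -` patset m \<tau> \<inter> {0..1} = {x \<in> {0..1}. infinite_orbit f x \<and> orbit_pattern m f (f x) = \<tau>}"
proof (rule set_eqI)
  fix x
  show "x \<in> f -` patset m \<tau> \<inter> {0..1} \<longleftrightarrow>
      x \<in> {x \<in> {0..1}. infinite_orbit f x \<and> orbit_pattern m f (f x) = \<tau>}"
    using f_in[of x] by (auto simp: patset_def infinite_orbit_step)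
qed

lemma pattern_dist_patset: "pattern_dist m f \<tau> = measure unit_leb (patset m \<tau>)"
  by (simp add: pattern_dist_def patset_def orbit_pattern_def)

lemma patset_sets: "patset m \<tau> \<in> sets unit_leb"
proof (cases "\<tau> \<in> perms m")
  case True
  \<comment> \<open>An infinite orbit is one without coincidences, which is a countable condition on
    the measurable iterates.\<close>
  have "patset m \<tau> = {x \<in> space unit_leb. (\<forall>i j. i < j \<longrightarrow> (f ^^ i) x \<noteq> (f ^^ j) x) \<and>
    (\<forall>a\<in>{1..m}. \<forall>b\<in>{1..m}. (f ^^ (a - 1)) x < (f ^^ (b - 1)) x \<longleftrightarrow> \<tau> a < \<tau> b)}" (is "_ = ?R")
  proof (intro set_eqI iffI)
    fix x assume x: "x \<in> patset m \<tau>"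
    then have "infinite_orbit f x" "Order m (\<lambda>i. (f ^^ (i - 1)) x) = \<tau>" "x \<in> {0..1}"
      by (auto simp: patset_def orbit_pattern_def)
    then show "x \<in> ?R" using Order(2)[OF orbit_inj_on[of f x m]]
      by (auto simp: infinite_orbit_iff dest: injD)
  next
    fix x assume x: "x \<in> ?R"
    then have "inj (\<lambda>t. (f ^^ t) x)" by (intro injI) (metis (mono_tags, lifting) mem_Collect_eq linorder_neqE_nat)
    moreover have "Order m (\<lambda>i. (f ^^ (i - 1)) x) = \<tau>" using x True by (intro Order_eqI) auto
    ultimately show "x \<in> patset m \<tau>" using x by (simp add: patset_def orbit_pattern_def infinite_orbit_iff)
  qed
  also have "\<dots> \<in> sets unit_leb" by measurable
  finally show ?thesis .
next
  case False
  then have "patset m \<tau> = {}" using orbit_pattern_perms by (auto simp: patset_def)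
  then show ?thesis by simp
qed

lemma sum_pattern_dist:
  assumes "finite S"
  shows "(\<Sum>\<sigma>\<in>S. pattern_dist m f \<sigma>) =
    measure unit_leb {x \<in> {0..1}. infinite_orbit f x \<and> orbit_pattern m f x \<in> S}"
proof -
  interpret finite_measure unit_leb by (rule fin)
  have "(\<Sum>\<sigma>\<in>S. pattern_dist m f \<sigma>) = measure unit_leb (\<Union>\<sigma>\<in>S. patset m \<sigma>)"
    unfolding pattern_dist_patset using assms patset_sets
    by (intro finite_measure_finite_Union[symmetric]) (auto simp: disjoint_family_on_def patset_def)
  also have "(\<Union>\<sigma>\<in>S. patset m \<sigma>) = {x \<in> {0..1}. infinite_orbit f x \<and> orbit_pattern m f x \<in> S}"
    by (auto simp: patset_def)
  finally show ?thesis .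
qed

text \<open>Flow conservation at \<open>\<tau>\<close> is invariance of the measure: the sum over
  edges leaving \<open>\<tau>\<close> measures \<open>patset k \<tau>\<close>, the sum over edges
  entering it measures the preimage of that set.\<close>

lemma pattern_dist_polytope: "pattern_dist (Suc k) f \<in> polytope_P (Suc k)"
proof -
  interpret finite_measure unit_leb by (rule fin)
  have z: "pattern_dist (Suc k) f \<sigma> = 0" if "\<sigma> \<notin> perms (Suc k)" for \<sigma>
  proof -
    have "patset (Suc k) \<sigma> = {}" using that orbit_pattern_perms by (auto simp: patset_def)
    then show ?thesis by (simp add: pattern_dist_patset)
  qed
  have \<Omega>: "{x \<in> {0..1}. infinite_orbit f x} \<in> sets unit_leb"
  proof -
    have "{x \<in> {0..1}. infinite_orbit f x} = (\<Union>\<sigma>\<in>perms (Suc k). patset (Suc k) \<sigma>)"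
      using orbit_pattern_perms by (auto simp: patset_def)
    also have "\<dots> \<in> sets unit_leb" using patset_sets by (intro sets.finite_UN) auto
    finally show ?thesis .
  qed
  have "{x \<in> {0..1}. infinite_orbit f x \<and> orbit_pattern (Suc k) f x \<in> perms (Suc k)} = {x \<in> {0..1}. infinite_orbit f x}"
    using orbit_pattern_perms by auto
  then have "(\<Sum>\<sigma>\<in>perms (Suc k). pattern_dist (Suc k) f \<sigma>) = measure unit_leb {x \<in> {0..1}. infinite_orbit f x}"
    using sum_pattern_dist[OF finite_perms, of "Suc k" "Suc k"] by simp
  also have "\<dots> = measure unit_leb {0..1}"
    by (rule measure_eq_AE[OF _ \<Omega>]) (use f_AE in \<open>auto simp: sets_unit_leb elim: eventually_mono\<close>)
  also have "\<dots> = 1" by (simp add: measure_unit_leb)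
  finally have one: "(\<Sum>\<sigma>\<in>perms (Suc k). pattern_dist (Suc k) f \<sigma>) = 1" .
  have flow: "(\<Sum>\<sigma>\<in>{\<sigma> \<in> perms (Suc k). \<rho> k \<sigma> = \<tau>}. pattern_dist (Suc k) f \<sigma>) =
     (\<Sum>\<sigma>\<in>{\<sigma> \<in> perms (Suc k). \<rho>' k \<sigma> = \<tau>}. pattern_dist (Suc k) f \<sigma>)" for \<tau>
  proof -
    have "(\<Sum>\<sigma>\<in>{\<sigma> \<in> perms (Suc k). \<rho> k \<sigma> = \<tau>}. pattern_dist (Suc k) f \<sigma>) = measure unit_leb (patset k \<tau>)"
      by (subst sum_pattern_dist, simp, rule arg_cong[where f = "measure unit_leb"])
        (auto simp: patset_def orbit_pattern_step orbit_pattern_perms)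
    also have "\<dots> = measure unit_leb (f -` patset k \<tau> \<inter> {0..1})"
      using f_pres[OF patset_sets] by (simp add: measure_def)
    also have "\<dots> = (\<Sum>\<sigma>\<in>{\<sigma> \<in> perms (Suc k). \<rho>' k \<sigma> = \<tau>}. pattern_dist (Suc k) f \<sigma>)"
      unfolding preimage_patset
      by (subst sum_pattern_dist, simp, rule arg_cong[where f = "measure unit_leb"])
        (auto simp: orbit_pattern_step orbit_pattern_perms)
    finally show ?thesis .
  qed
  show ?thesis unfolding polytope_P_def prob_simplex_def
    using z one flow by (simp add: pattern_dist_patset)
qed

lemma positive_AE_obtains:
  assumes "A \<in> sets unit_leb" "measure unit_leb A > 0" "AE x in unit_leb. P x"
  obtains x where "x \<in> A" "P x"
proof (rule ccontr)
  assume "\<not> thesis"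
  then have "\<And>x. P x \<Longrightarrow> x \<notin> A" using that by blast
  then have "AE x in unit_leb. x \<notin> A" using assms(3) by (auto elim: eventually_mono)
  then have "emeasure unit_leb A = 0" using assms(1)
    by (subst (asm) AE_iff_measurable[OF assms(1)]) (auto simp: sets_unit_leb)
  then show False using assms(2) by (simp add: measure_def)
qed

section \<open>The support graph\<close>

definition supp :: "nat \<Rightarrow> (nat \<Rightarrow> nat) set" where
  "supp k = {\<sigma> \<in> perms (Suc k). pattern_dist (Suc k) f \<sigma> > 0}"

definition supp_graph :: "nat \<Rightarrow> (nat \<Rightarrow> nat, nat \<Rightarrow> nat) pre_digraph" where
  "supp_graph k = \<lparr>verts = \<rho> k ` supp k \<union> \<rho>' k ` supp k, arcs = supp k, tail = \<rho> k, head = \<rho>' k\<rparr>"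

lemma supp_graph_simps [simp]:
  "verts (supp_graph k) = \<rho> k ` supp k \<union> \<rho>' k ` supp k" "arcs (supp_graph k) = supp k"
  "tail (supp_graph k) = \<rho> k" "head (supp_graph k) = \<rho>' k"
  by (simp_all add: supp_graph_def)

lemma supp_subgraph: "subgraph (supp_graph k) (perm_digraph k)"
proof (rule subgraphI)
  show "wf_digraph (supp_graph k)" by unfold_locales auto
qed (auto simp: supp_def compatible_def wf_perm_digraph)

lemma AE_orbit_in_supp:
  "AE x in unit_leb. infinite_orbit f x \<and> (\<forall>t. orbit_pattern (Suc k) f ((f ^^ t) x) \<in> supp k)"
proof -
  interpret finite_measure unit_leb by (rule fin)
  have "AE x in unit_leb. \<forall>\<sigma>\<in>perms (Suc k) - supp k. x \<notin> patset (Suc k) \<sigma>"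
  proof (rule AE_finite_allI)
    fix \<sigma> assume "\<sigma> \<in> perms (Suc k) - supp k"
    then have "measure unit_leb (patset (Suc k) \<sigma>) = 0"
      using measure_nonneg[of unit_leb "patset (Suc k) \<sigma>"]
      by (auto simp: supp_def pattern_dist_patset not_less simp del: measure_nonneg)
    then have "patset (Suc k) \<sigma> \<in> null_sets unit_leb"
      using patset_sets by (auto simp: null_sets_def emeasure_eq_measure)
    then show "AE x in unit_leb. x \<notin> patset (Suc k) \<sigma>" by (rule AE_not_in)
  qed simp
  moreover have "AE x in unit_leb. x \<in> {0..1}" by (rule AE_I2) simp
  ultimately have "AE x in unit_leb. orbit_pattern (Suc k) f x \<in> supp k"
    using f_AE
  proof eventually_elim
    case (elim x)
    then have "orbit_pattern (Suc k) f x \<in> perms (Suc k)" "x \<in> patset (Suc k) (orbit_pattern (Suc k) f x)"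
      using orbit_pattern_perms by (auto simp: patset_def)
    then show ?case using elim(1) by blast
  qed
  from AE_iter[OF this] f_AE show ?thesis by eventually_elim blast
qed

lemma supp_awalk:
  assumes "infinite_orbit f x" "\<And>t. orbit_pattern (Suc k) f ((f ^^ t) x) \<in> supp k" "0 < m"
  shows "pre_digraph.awalk (supp_graph k) (orbit_pattern k f x)
    (map (\<lambda>a. orbit_pattern (Suc k) f ((f ^^ a) x)) [0..<m]) (orbit_pattern k f ((f ^^ m) x))"
proof -
  interpret H: wf_digraph "supp_graph k" using supp_subgraph by auto
  have "H.awalk (orbit_pattern k f ((f ^^ 0) x)) (map (\<lambda>a. orbit_pattern (Suc k) f ((f ^^ a) x)) [0..<m])
    (orbit_pattern k f ((f ^^ m) x))"
    by (rule H.awalk_seq[where x = "\<lambda>t. orbit_pattern k f ((f ^^ t) x)"])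
      (use assms in \<open>auto simp: orbit_pattern_step infinite_orbit_iter\<close>)
  then show ?thesis by simp
qed

text \<open>Almost every point whose first pattern is \<open>e\<close> sees \<open>e\<close> again,
  and the walk in between is a loop through \<open>e\<close>.\<close>

lemma supp_face: "face_subgraph k (supp_graph k)"
  unfolding face_subgraph_def
proof (intro conjI ballI supp_subgraph)
  fix e assume "e \<in> arcs (supp_graph k)"
  then have e: "e \<in> supp k" by simp
  then have "measure unit_leb (patset (Suc k) e) > 0" by (simp add: supp_def pattern_dist_patset)
  moreover have "AE x in unit_leb. (infinite_orbit f x \<and> (\<forall>t. orbit_pattern (Suc k) f ((f ^^ t) x) \<in> supp k)) \<and>
    (x \<in> patset (Suc k) e \<longrightarrow> (\<forall>m. \<exists>t\<ge>m. (f ^^ t) x \<in> patset (Suc k) e))"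
    using AE_orbit_in_supp recurrence[OF patset_sets] by (rule AE_conjI)
  ultimately obtain x where x: "x \<in> patset (Suc k) e" "infinite_orbit f x"
    "\<And>t. orbit_pattern (Suc k) f ((f ^^ t) x) \<in> supp k" "\<And>m. \<exists>t\<ge>m. (f ^^ t) x \<in> patset (Suc k) e"
    by (rule positive_AE_obtains[OF patset_sets]) blast
  then obtain t where t: "t \<ge> 1" "(f ^^ t) x \<in> patset (Suc k) e" by blast
  have px: "orbit_pattern (Suc k) f x = e" "orbit_pattern (Suc k) f ((f ^^ t) x) = e"
    using x(1) t(2) by (auto simp: patset_def)
  have v: "orbit_pattern k f x = \<rho> k e" "orbit_pattern k f ((f ^^ t) x) = \<rho> k e"
    using orbit_pattern_step(1)[of f x k] orbit_pattern_step(1)[of f "(f ^^ t) x" k] x(2) px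
    by (auto simp: infinite_orbit_iter)
  have "e \<in> set (map (\<lambda>a. orbit_pattern (Suc k) f ((f ^^ a) x)) [0..<t])"
    using t(1) px(1) by (auto intro!: image_eqI[of _ _ 0])
  then show "\<exists>v p. pre_digraph.awalk (supp_graph k) v p v \<and> e \<in> set p"
    using supp_awalk[OF x(2,3), of t] t(1) v by (metis less_le_trans zero_less_one)
qed auto

text \<open>Constant drift at \<open>v\<close> and \<open>j\<close> would make the coordinate
  \<open>(f ^^ (j - 1)) x\<close>, taken with the sign \<open>\<epsilon>\<close>, strictly increase
  at every return to \<open>patset k v\<close>.\<close>

lemma supp_driftless: "driftless k (supp_graph k)"
  unfolding driftless_iff[OF supp_subgraph]
proof (intro ballI, rule ccontr)
  fix v j and \<epsilon> :: int
  assume v: "v \<in> verts (supp_graph k)" and j: "j \<in> {1..k}" and \<epsilon>: "\<epsilon> \<in> {1, -1}"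
    and "\<nexists>p. p \<noteq> [] \<and> pre_digraph.awalk (supp_graph k) v p v \<and> Drift k v p j \<noteq> \<epsilon>"
  then have D: "Drift k v p j = \<epsilon>" if "p \<noteq> []" "pre_digraph.awalk (supp_graph k) v p v" for p
    using that by blast
  interpret finite_measure unit_leb by (rule fin)
  \<comment> \<open>\<open>v\<close> inherits positive measure from an edge: by inclusion if
    \<open>v\<close> is its tail, through the preimage and invariance if \<open>v\<close> is its
    head.\<close>
  obtain e where e: "e \<in> supp k" "v = \<rho> k e \<or> v = \<rho>' k e" using v by auto
  have "0 < measure unit_leb (patset (Suc k) e)" using e(1) by (simp add: supp_def pattern_dist_patset)
  also have "\<dots> \<le> measure unit_leb (patset k v)"
  proof (cases "v = \<rho> k e")
    case True
    then show ?thesis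
      by (intro finite_measure_mono patset_sets) (auto simp: patset_def orbit_pattern_step)
  next
    case False
    then have "v = \<rho>' k e" using e(2) by simp
    then have "measure unit_leb (patset (Suc k) e) \<le> measure unit_leb (f -` patset k v \<inter> {0..1})"
    proof (intro finite_measure_mono)
      show "f -` patset k v \<inter> {0..1} \<in> sets unit_leb"
        using measurable_sets[OF f_meas patset_sets[of k v]] by simp
      show "patset (Suc k) e \<subseteq> f -` patset k v \<inter> {0..1}"
        unfolding preimage_patset using \<open>v = \<rho>' k e\<close> by (auto simp: patset_def orbit_pattern_step)
    qed
    also have "\<dots> = measure unit_leb (patset k v)" using f_pres[OF patset_sets] by (simp add: measure_def)
    finally show ?thesis .
  qed
  finally have pos: "0 < measure unit_leb (patset k v)" .
  define g where "g x = of_int \<epsilon> * (f ^^ (j - 1)) x" for x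
  have "emeasure unit_leb (patset k v) = 0"
  proof (rule increasing_at_returns_null[OF patset_sets, of g])
    show "g \<in> borel_measurable unit_leb" unfolding g_def by measurable
    show "AE x in unit_leb. x \<in> patset k v \<longrightarrow>
      (\<forall>t\<ge>1. (f ^^ t) x \<in> patset k v \<longrightarrow> g x < g ((f ^^ t) x))"
      using AE_orbit_in_supp[of k]
    proof eventually_elim
      case (elim x)
      show ?case
      proof (intro impI allI)
        fix t :: nat assume x: "x \<in> patset k v" and t: "1 \<le> t" "(f ^^ t) x \<in> patset k v"
        define p where "p = map (\<lambda>a. orbit_pattern (Suc k) f ((f ^^ a) x)) [0..<t]"
        have pv: "orbit_pattern k f x = v" "orbit_pattern k f ((f ^^ t) x) = v"
          using x t by (auto simp: patset_def)
        have inf: "infinite_orbit f x" and len: "length p = t" "p \<noteq> []" using elim t by (auto simp: p_def)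
        have "pre_digraph.awalk (supp_graph k) v p v"
          using supp_awalk[OF inf, of k t] elim t pv by (simp add: p_def)
        from D[OF len(2) this] have dr: "Drift k v p j = \<epsilon>" .
        have walk: "perm_digraph.awalk k v p v" "fits k (\<lambda>i. (f ^^ (i - 1)) x) v p"
          using orbit_path[OF inf, of k t] pv by (auto simp: p_def)
        note le = fits_path_le[OF walk]
        have fj: "(f ^^ (j - 1)) ((f ^^ t) x) = (f ^^ (t + j - 1)) x"
        proof -
          have "t + j - 1 = (j - 1) + t" using j by auto
          then show ?thesis by (simp only: funpow_add comp_apply)
        qed
        have "(f ^^ (j - 1)) x \<noteq> (f ^^ (t + j - 1)) x"
          using infinite_orbit_eq_iff[OF inf] t j by auto
        moreover have "g x \<le> g ((f ^^ t) x)"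
          using \<epsilon> dr le[of j "t + j"] le[of "t + j" j] fj len
          by (auto simp: g_def Drift_def Drift2_def split: if_splits)
        ultimately show "g x < g ((f ^^ t) x)" using \<epsilon> fj by (auto simp: g_def)
      qed
    qed
  qed
  then show False using pos by (simp add: measure_def)
qed

lemma supp_open_face: "pattern_dist (Suc k) f \<in> open_face (Suc k) (supp_graph k)"
  using pattern_dist_polytope by (auto simp: open_face_def supp_def)

end

section \<open>The faces\<close>

lemma pattern_dist_in_driftless_face:
  assumes "f \<in> maps_A_mp"
  obtains H where "face_subgraph k H" "driftless k H" "pattern_dist (Suc k) f \<in> open_face (Suc k) H"
proof -
  interpret mp_map f using assms by unfold_locales
  show thesis using that[OF supp_face supp_driftless supp_open_face] .
qed

lemma open_face_realizable:
  assumes "face_subgraph k H" "driftless k H" "k \<ge> 1"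
  shows "open_face (Suc k) H \<subseteq> pattern_dist (Suc k) ` maps_A_mp"
proof
  fix \<mu> assume \<mu>: "\<mu> \<in> open_face (Suc k) H"
  then have "\<mu> \<in> prob_simplex (Suc k)" by (simp add: open_face_def polytope_P_def)
  then show "\<mu> \<in> pattern_dist (Suc k) ` maps_A_mp"
    by (intro cell_cone_realizable open_face_cell_cone[OF assms \<mu>]) (auto simp: prob_simplex_def)
qed

text \<open>A distribution determines the edges as its support, and face subgraphs have no isolated
  vertices. Open faces of different graphs are thus disjoint, so a single attained point suffices to
  identify the graph of its open face as driftless.\<close>

lemma open_face_unique:
  assumes "face_subgraph k H" "face_subgraph k H'" "\<mu> \<in> open_face (Suc k) H" "\<mu> \<in> open_face (Suc k) H'"
  shows "H = H'"
proof -
  have sub: "subgraph H (perm_digraph k)" "subgraph H' (perm_digraph k)"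
    using assms(1,2) by (simp_all add: face_subgraph_def)
  interpret H: wf_digraph H using sub(1) by auto
  interpret H': wf_digraph H' using sub(2) by auto
  have arcs: "arcs H = arcs H'"
    using assms(3,4) subgraph_permD(2)[OF sub(1)] subgraph_permD(2)[OF sub(2)]
    by (auto simp: open_face_def)
  have V: "verts H = \<rho> k ` arcs H \<union> \<rho>' k ` arcs H"
  proof
    show "verts H \<subseteq> \<rho> k ` arcs H \<union> \<rho>' k ` arcs H"
      using assms(1) subgraph_permD(3,4)[OF sub(1)] by (fastforce simp: face_subgraph_def)
    show "\<rho> k ` arcs H \<union> \<rho>' k ` arcs H \<subseteq> verts H"
      using H.tail_in_verts H.head_in_verts subgraph_permD(3,4)[OF sub(1)] by auto
  qed
  have V': "verts H' = \<rho> k ` arcs H' \<union> \<rho>' k ` arcs H'"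
  proof
    show "verts H' \<subseteq> \<rho> k ` arcs H' \<union> \<rho>' k ` arcs H'"
      using assms(2) subgraph_permD(3,4)[OF sub(2)] by (fastforce simp: face_subgraph_def)
    show "\<rho> k ` arcs H' \<union> \<rho>' k ` arcs H' \<subseteq> verts H'"
      using H'.tail_in_verts H'.head_in_verts subgraph_permD(3,4)[OF sub(2)] by auto
  qed
  show ?thesis
    using V V' arcs subgraph_permD(3,4)[OF sub(1)] subgraph_permD(3,4)[OF sub(2)]
    by (intro pre_digraph.equality) auto
qed

text \<open>Choosing a loop through each edge and adding the edge counts gives a flow that is
  positive exactly on \<open>arcs H\<close>; it is then divided by its total mass
  \<open>T\<close>.\<close>

lemma open_face_nonempty:
  assumes face: "face_subgraph k H" and ne: "verts H \<noteq> {}"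
  shows "open_face (Suc k) H \<noteq> {}"
proof -
  have sub: "subgraph H (perm_digraph k)" using face by (simp add: face_subgraph_def)
  interpret H: wf_digraph H using sub by auto
  have aH: "arcs H \<subseteq> perms (Suc k)" using subgraph_permD(2)[OF sub] .
  have finA: "finite (arcs H)" using aH by (rule finite_subset) simp
  have ane: "arcs H \<noteq> {}" using face ne by (auto simp: face_subgraph_def)
  have "\<forall>e\<in>arcs H. \<exists>p. \<exists>v. H.awalk v p v \<and> e \<in> set p"
    using face unfolding face_subgraph_def by blast
  then obtain p where p: "\<And>e. e \<in> arcs H \<Longrightarrow> \<exists>v. H.awalk v (p e) v" "\<And>e. e \<in> arcs H \<Longrightarrow> e \<in> set (p e)"
    by metis
  define \<nu> where "\<nu> \<sigma> = (\<Sum>e\<in>arcs H. edge_count (p e) \<sigma>)" for \<sigma>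
  have nn: "0 \<le> \<nu> \<sigma>" for \<sigma> by (simp add: \<nu>_def sum_nonneg)
  have z: "\<nu> \<sigma> = 0" if "\<sigma> \<notin> arcs H" for \<sigma>
    unfolding \<nu>_def
  proof (rule sum.neutral, rule ballI)
    fix e assume "e \<in> arcs H"
    then have "\<sigma> \<notin> set (p e)" using p(1)[of e] that by (auto simp: H.awalk_def)
    then show "edge_count (p e) \<sigma> = 0" by simp
  qed
  have pos: "0 < \<nu> \<sigma>" if "\<sigma> \<in> arcs H" for \<sigma>
    unfolding \<nu>_def
  proof (rule sum_pos2[OF finA that])
    show "0 < edge_count (p \<sigma>) \<sigma>" using p(2)[OF that] count_list_0_iff[of "p \<sigma>" \<sigma>] by simp
  qed simp
  have "flow k (edge_count (p e))" if "e \<in> arcs H" for e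
    using p(1)[OF that] perm_digraph.subgraph_awalk_imp_awalk[OF _ sub] loop_flow by blast
  then have fl: "flow k \<nu>" unfolding \<nu>_def using finA by (intro flow_sum)
  define T where "T = (\<Sum>\<sigma>\<in>perms (Suc k). \<nu> \<sigma>)"
  obtain e where "e \<in> arcs H" using ane by blast
  then have T: "T > 0" unfolding T_def using aH pos nn by (intro sum_pos2[of _ e]) auto
  have "(\<lambda>\<sigma>. inverse T * \<nu> \<sigma>) \<in> polytope_P (Suc k)"
    unfolding polytope_P_def prob_simplex_def
    using flow_scale[OF fl, of "inverse T"] T nn z aH
    by (auto simp: flow_def sum_distrib_left[symmetric] T_def[symmetric])
  then have "(\<lambda>\<sigma>. inverse T * \<nu> \<sigma>) \<in> open_face (Suc k) H"
    unfolding open_face_def using T pos z by (auto simp: zero_less_mult_iff) (metis less_irrefl)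
  then show ?thesis by blast
qed

section \<open>Loops of the full permutation digraph\<close>

lemma perm_loop_beside:
  assumes v: "v \<in> perms k" and k: "k \<ge> 1" and z: "inj_on z {1..2 * k}"
    and lo: "\<And>c d. c \<in> {1..k} \<Longrightarrow> d \<in> {1..k} \<Longrightarrow> z c < z d \<longleftrightarrow> v c < v d"
    and hi: "\<And>c d. c \<in> {1..k} \<Longrightarrow> d \<in> {1..k} \<Longrightarrow> z (k + c) < z (k + d) \<longleftrightarrow> v c < v d"
  obtains p where "length p = k" "perm_digraph.awalk k v p v" "fits k z v p"
proof -
  define p where "p = map (\<lambda>a. Order (Suc k) (\<lambda>i. z (a + i))) [0..<k]"
  have inj: "inj_on (\<lambda>i. z (a + i)) {1..l}" if "a + l \<le> 2 * k" for a l
  proof (rule inj_onI)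
    fix c d assume "c \<in> {1..l}" "d \<in> {1..l}" "z (a + c) = z (a + d)"
    then show "c = d" using inj_onD[OF z, of "a + c" "a + d"] that by auto
  qed
  have "Order k z = v" "Order k (\<lambda>i. z (k + i)) = v"
    using Order_eqI[OF v, of z] Order_eqI[OF v, of "\<lambda>i. z (k + i)"] lo hi by blast+
  moreover note window_walk[of k z k]
  ultimately have "perm_digraph.awalk k v p v" "fits k z v p"
    using inj unfolding p_def by auto
  then show thesis by (intro that[of p]) (auto simp: p_def)
qed

text \<open>Two copies of the pattern \<open>v\<close> follow each other, the second one wholly
  below the first for \<open>\<epsilon> = 1\<close> and wholly above it for
  \<open>\<epsilon> = -1\<close>; the values themselves then refute the drift.\<close>

lemma perm_loop_Drift:
  assumes v: "v \<in> perms k" and j: "j \<in> {1..k}" and \<epsilon>: "\<epsilon> \<in> {1, -1}"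
  shows "\<exists>p. p \<noteq> [] \<and> perm_digraph.awalk k v p v \<and> Drift k v p j \<noteq> \<epsilon>"
proof -
  have k: "k \<ge> 1" using j by auto
  have vk: "1 \<le> v i" "v i \<le> k" if "1 \<le> i" "i \<le> k" for i using perms_in_iff[OF v, of i] that by auto
  define z where "z i = (if (i \<le> k) = (\<epsilon> = -1) then 0 else k) + v (if i \<le> k then i else i - k)" for i
  have "inj_on z {1..2 * k}"
  proof (rule inj_onI)
    fix c d assume cd: "c \<in> {1..2 * k}" "d \<in> {1..2 * k}" "z c = z d"
    define c' where "c' = (if c \<le> k then c else c - k)"
    define d' where "d' = (if d \<le> k then d else d - k)"
    have "1 \<le> c'" "c' \<le> k" "1 \<le> d'" "d' \<le> k" using cd by (auto simp: c'_def d'_def)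
    then have "1 \<le> v c'" "v c' \<le> k" "1 \<le> v d'" "v d' \<le> k" using vk by auto
    then have "(c \<le> k) = (d \<le> k) \<and> v c' = v d'"
      using cd(3) unfolding z_def c'_def[symmetric] d'_def[symmetric] by (auto split: if_splits)
    then show "c = d" using perms_eq_iff[OF v] cd unfolding c'_def d'_def by (auto split: if_splits)
  qed
  moreover have "z c < z d \<longleftrightarrow> v c < v d" "z (k + c) < z (k + d) \<longleftrightarrow> v c < v d"
    if "c \<in> {1..k}" "d \<in> {1..k}" for c d using that by (auto simp: z_def)
  ultimately obtain p where p: "length p = k" "perm_digraph.awalk k v p v" "fits k z v p"
    using perm_loop_beside[OF v k] by metis
  have "Drift k v p j \<noteq> \<epsilon>"
  proof
    assume D: "Drift k v p j = \<epsilon>"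
    note le = fits_path_le[OF p(2,3)]
    show False
    proof (cases "\<epsilon> = -1")
      case True
      then have "path_le k v p (k + j) j" using D p(1) by (auto simp: Drift_def Drift2_def split: if_splits)
      from le[OF this] show False using True j by (auto simp: z_def)
    next
      case False
      then have "path_le k v p j (k + j)" using D \<epsilon> p(1) by (auto simp: Drift_def Drift2_def split: if_splits)
      from le[OF this] show False using False j by (auto simp: z_def)
    qed
  qed
  moreover have "p \<noteq> []" using p(1) k by auto
  ultimately show ?thesis using p(2) by blast
qed

lemma perm_digraph_driftless: "driftless k (perm_digraph k)"
  unfolding driftless_iff[OF perm_digraph.subgraph_refl] using perm_loop_Drift by simp

text \<open>The values of \<open>e\<close>, repeated with period \<open>Suc k\<close>, have
  injective windows of that length, so they trace a closed walk of cyclic shifts that starts with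
  \<open>e\<close>.\<close>

lemma perm_edge_loop:
  assumes e: "e \<in> perms (Suc k)"
  shows "\<exists>v p. perm_digraph.awalk k v p v \<and> e \<in> set p"
proof -
  define z where "z i = e (Suc ((i - 1) mod Suc k))" for i
  have inj: "inj_on (\<lambda>i. z (a + i)) {1..Suc k}" for a
  proof (rule inj_onI)
    fix c d assume cd: "c \<in> {1..Suc k}" "d \<in> {1..Suc k}" "z (a + c) = z (a + d)"
    then have "(a + c - 1) mod Suc k = (a + d - 1) mod Suc k" using perms_eq_iff[OF e] by (simp add: z_def)
    then have "[a + (c - 1) = a + (d - 1)] (mod Suc k)" using cd by (simp add: cong_def)
    then have "[c - 1 = d - 1] (mod Suc k)" by (simp only: cong_add_lcancel_nat)
    moreover have "c - 1 < Suc k" "d - 1 < Suc k" using cd by auto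
    ultimately have "c - 1 = d - 1" by (simp add: cong_def)
    then show "c = d" using cd by auto
  qed
  have "inj_on (\<lambda>i. z (a + i)) {1..k}" for a by (rule inj_on_subset[OF inj]) auto
  from window_walk(1)[of "Suc k" z k, OF this inj]
  have w: "perm_digraph.awalk k (Order k z) (map (\<lambda>a. Order (Suc k) (\<lambda>i. z (a + i))) [0..<Suc k])
      (Order k (\<lambda>i. z (Suc k + i)))" by simp
  have "z (Suc k + i) = z i" if "i \<in> {1..k}" for i
  proof -
    have "Suc k + i - 1 = (i - 1) + Suc k" using that by auto
    then show ?thesis unfolding z_def by (simp only: mod_add_self2)
  qed
  then have "Order k (\<lambda>i. z (Suc k + i)) = Order k z" by (intro Order_cong) auto
  moreover have "Order (Suc k) z = e"
    by (rule Order_eqI[OF e]) (auto simp: z_def)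
  then have "e \<in> set (map (\<lambda>a. Order (Suc k) (\<lambda>i. z (a + i))) [0..<Suc k])"
    by (auto simp del: upt_Suc intro!: image_eqI[of _ _ 0])
  ultimately show ?thesis using w by metis
qed

lemma perm_digraph_face:
  assumes "k \<ge> 1" shows "face_subgraph k (perm_digraph k)"
  unfolding face_subgraph_def
proof (intro conjI ballI perm_digraph.subgraph_refl)
  fix e assume "e \<in> arcs (perm_digraph k)"
  then show "\<exists>v p. perm_digraph.awalk k v p v \<and> e \<in> set p" using perm_edge_loop by simp
next
  fix v assume "v \<in> verts (perm_digraph k)"
  then obtain p where "p \<noteq> []" "perm_digraph.awalk k v p v"
    using perm_loop_Drift[of v k 1 1] assms by auto
  then have "hd p \<in> perms (Suc k)" "v = \<rho> k (hd p)" by (cases p; simp add: awalk_perm_Cons)+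
  then show "\<exists>e\<in>arcs (perm_digraph k). v = tail (perm_digraph k) e \<or> v = head (perm_digraph k) e"
    by auto
qed

section \<open>Density in the polytope\<close>

lemma closed_polytope_P: "closed (polytope_P n)"
proof -
  have eq: "polytope_P n = (\<Inter>\<sigma>\<in>perms n. {\<mu>. 0 \<le> \<mu> \<sigma>}) \<inter> (\<Inter>\<sigma>\<in>- perms n. {\<mu>. \<mu> \<sigma> = 0}) \<inter>
    {\<mu>. (\<Sum>\<sigma>\<in>perms n. \<mu> \<sigma>) = 1} \<inter>
    (\<Inter>\<tau>\<in>perms (n - 1). {\<mu>. (\<Sum>\<sigma> \<in> {\<sigma> \<in> perms n. \<rho> (n - 1) \<sigma> = \<tau>}. \<mu> \<sigma>) =
     (\<Sum>\<sigma> \<in> {\<sigma> \<in> perms n. \<rho>' (n - 1) \<sigma> = \<tau>}. \<mu> \<sigma>)})"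
    unfolding polytope_P_def prob_simplex_def by auto
  have c: "continuous_on UNIV (\<lambda>\<mu> :: (nat \<Rightarrow> nat) \<Rightarrow> real. \<mu> \<sigma>)" for \<sigma>
    by (rule continuous_on_product_coordinates)
  show ?thesis unfolding eq
    by (intro closed_Int closed_INT ballI closed_Collect_le closed_Collect_eq continuous_on_const continuous_on_sum c)
qed

lemma polytope_P_mix_open_face:
  assumes "\<mu> \<in> polytope_P (Suc k)" "u \<in> open_face (Suc k) (perm_digraph k)" "0 < t" "t \<le> 1"
  shows "(\<lambda>\<sigma>. (1 - t) * \<mu> \<sigma> + t * u \<sigma>) \<in> open_face (Suc k) (perm_digraph k)"
proof -
  have \<mu>: "\<And>\<sigma>. \<sigma> \<in> perms (Suc k) \<Longrightarrow> 0 \<le> \<mu> \<sigma>" "\<And>\<sigma>. \<sigma> \<notin> perms (Suc k) \<Longrightarrow> \<mu> \<sigma> = 0"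
    "sum \<mu> (perms (Suc k)) = 1" "flow k \<mu>"
    using assms(1) by (auto simp: polytope_P_def prob_simplex_def flow_def)
  have u: "\<And>\<sigma>. \<sigma> \<in> perms (Suc k) \<Longrightarrow> 0 < u \<sigma>" "\<And>\<sigma>. \<sigma> \<notin> perms (Suc k) \<Longrightarrow> u \<sigma> = 0"
    "sum u (perms (Suc k)) = 1" "flow k u"
    using assms(2) by (auto simp: open_face_def polytope_P_def prob_simplex_def flow_def)
  have "flow k (\<lambda>\<sigma>. (1 - t) * \<mu> \<sigma> + t * u \<sigma>)" by (intro flow_add flow_scale \<mu>(4) u(4))
  moreover have pos: "0 < (1 - t) * \<mu> \<sigma> + t * u \<sigma>" if "\<sigma> \<in> perms (Suc k)" for \<sigma>
    using \<mu>(1)[OF that] u(1)[OF that] assms(3,4) by (intro add_nonneg_pos) auto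
  moreover have "(\<Sum>\<sigma>\<in>perms (Suc k). (1 - t) * \<mu> \<sigma> + t * u \<sigma>) = 1"
    by (simp add: sum.distrib sum_distrib_left[symmetric] \<mu>(3) u(3))
  ultimately show ?thesis
    by (auto simp: open_face_def polytope_P_def prob_simplex_def flow_def \<mu>(2) u(2) less_imp_le)
qed

theorem theorem5p8:
  fixes n :: nat
  assumes "n \<ge> 2"
  shows "(\<exists>\<F> \<subseteq> open_faces n. pattern_dist n ` maps_A_mp = \<Union>\<F>) \<and>
    (\<forall>H. face_subgraph (n - 1) H \<and> verts H \<noteq> {} \<longrightarrow>
       (open_face n H \<subseteq> pattern_dist n ` maps_A_mp \<longleftrightarrow> driftless (n - 1) H)) \<and>
    closure (pattern_dist n ` maps_A_mp) = polytope_P n"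
proof -
  obtain k where n: "n = Suc k" "k \<ge> 1" using assms by (cases n) auto
  let ?R = "pattern_dist (Suc k) ` maps_A_mp"
  let ?\<F> = "{open_face (Suc k) H | H. face_subgraph k H \<and> driftless k H}"
  have "?R = \<Union>?\<F>"
  proof
    show "?R \<subseteq> \<Union>?\<F>"
    proof
      fix \<mu> assume "\<mu> \<in> ?R"
      then obtain f where "f \<in> maps_A_mp" "\<mu> = pattern_dist (Suc k) f" by blast
      then show "\<mu> \<in> \<Union>?\<F>" using pattern_dist_in_driftless_face[of f k] by blast
    qed
    show "\<Union>?\<F> \<subseteq> ?R" using open_face_realizable n(2) by blast
  qed
  moreover have "?\<F> \<subseteq> open_faces (Suc k)" by (auto simp: open_faces_def)
  ultimately have 1: "\<exists>\<F> \<subseteq> open_faces (Suc k). ?R = \<Union>\<F>" by blast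
  have 2: "open_face (Suc k) H \<subseteq> ?R \<longleftrightarrow> driftless k H" if H: "face_subgraph k H" "verts H \<noteq> {}" for H
  proof
    assume sub: "open_face (Suc k) H \<subseteq> ?R"
    obtain \<mu> where \<mu>: "\<mu> \<in> open_face (Suc k) H" using open_face_nonempty[OF H] by blast
    then obtain f where f: "f \<in> maps_A_mp" "\<mu> = pattern_dist (Suc k) f" using sub by blast
    obtain H' where H': "face_subgraph k H'" "driftless k H'" "pattern_dist (Suc k) f \<in> open_face (Suc k) H'"
      using pattern_dist_in_driftless_face[OF f(1)] .
    then have "H = H'" using open_face_unique[OF H(1) H'(1) \<mu>] f(2) by simp
    then show "driftless k H" using H'(2) by simp
  next
    assume "driftless k H"
    then show "open_face (Suc k) H \<subseteq> ?R" using open_face_realizable[OF H(1) _ n(2)] by simp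
  qed
  have 3: "closure ?R = polytope_P (Suc k)"
  proof
    have "?R \<subseteq> polytope_P (Suc k)" using mp_map.pattern_dist_polytope by (auto simp: mp_map_def)
    then show "closure ?R \<subseteq> polytope_P (Suc k)" using closed_polytope_P by (rule closure_minimal)
    show "polytope_P (Suc k) \<subseteq> closure ?R"
    proof
      fix \<mu> assume \<mu>: "\<mu> \<in> polytope_P (Suc k)"
      have face: "face_subgraph k (perm_digraph k)" using perm_digraph_face[OF n(2)] .
      have "id \<in> verts (perm_digraph k)" by (simp add: perms_def)
      then have "verts (perm_digraph k) \<noteq> {}" by blast
      then obtain u where u: "u \<in> open_face (Suc k) (perm_digraph k)"
        using open_face_nonempty[OF face] by blast
      \<comment> \<open>For \<open>0 < t < 1\<close> the segment from \<open>\<mu>\<close> to the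
        interior point \<open>u\<close> lies in the open face of the full digraph, and it tends to
        \<open>\<mu>\<close> as \<open>t\<close> goes to 0.\<close>
      define c where "c t = (\<lambda>\<sigma>. (1 - t) * \<mu> \<sigma> + t * u \<sigma>)" for t :: real
      have cont: "continuous_on UNIV c"
        by (rule continuous_on_coordinatewise_then_product) (auto simp: c_def intro!: continuous_intros)
      have "c ` {0<..<1} \<subseteq> ?R"
        using polytope_P_mix_open_face[OF \<mu> u] open_face_realizable[OF face perm_digraph_driftless n(2)]
        by (force simp: c_def)
      then have "c ` closure {0<..<1} \<subseteq> closure ?R"
        using subset_trans[OF _ closure_subset]
        by (intro image_closure_subset continuous_on_subset[OF cont]) simp_all
      moreover have "0 \<in> closure {0<..<1 :: real}" by simp
      ultimately have "c 0 \<in> closure ?R" by blast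
      then show "\<mu> \<in> closure ?R" by (simp add: c_def)
    qed
  qed
  show ?thesis using 1 2 3 n(1) by simp
qed

end
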